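(* Let $\varphi:\mathbb{R}^n\to\mathbb{R}$ be twice continuously differentiable and $x_0\in\mathbb{R}^n$. Suppose the level set $L_\varphi(x_0)=\{x:\varphi(x)\le\varphi(x_0)\}$ is compact and $\nabla^2\varphi$ is $L_H$-Lipschitz continuous on an open neighborhood of $L_\varphi(x_0)$ containing the trial points generated by the algorithm ARNCG (defined in the context). Let $\{x_k\}_{k\ge0}$ be generated by ARNCG, and put $g_k=\|\nabla\varphi(x_k)\|$, $\epsilon_k=\min_{0\le i\le k}g_i$, with $g_{-1}=\epsilon_{-1}=g_0$, $\Delta_\varphi=\varphi(x_0)-\inf\varphi$, $U_\varphi=\sup_{\varphi(x)\le\varphi(x_0)}\|\nabla\varphi(x)\|$. Let $\theta\ge0$. Then the following iteration bounds hold for the number $k$ of iterations needed to reach an $\epsilon$-stationary point (a point $x_k$ with $g_k\le\epsilon$): 1. If $\omega_k^{\mathrm f}=\sqrt{g_k}$, $\omega_k^{\mathrm t}=\omega_k^{\mathrm f}\delta_k^\theta$ and $\delta_k=\min(1,g_kg_{k-1}^{-1})$, then $$k\lesssim \Delta_\varphi L_H^{1/2}\epsilon^{-3/2}\log\log\frac{U_\varphi}{\epsilon}+|\log L_H|\log\frac{U_\varphi}{\epsilon}.$$ 2. If $\omega_k^{\mathrm f}=\sqrt{\epsilon_k}$, $\omega_k^{\mathrm t}=\omega_k^{\mathrm f}\delta_k^\theta$ and $\delta_k=\epsilon_k\epsilon_{k-1}^{-1}$, then $$k\lesssim \Delta_\varphi L_H^{1/2}\epsilon^{-3/2}+|\log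 L_H|+\log\frac{U_\varphi}{\epsilon}.$$ Furthermore (for each of these two choices), there exists a subsequence $\{x_{k_j}\}_{j\ge0}$ such that $\lim_{j\to\infty}x_{k_j}=x^*$ with $\nabla\varphi(x^* )=0$. If $\theta>1$ and $\nabla^2\varphi(x^* )\succ0$, then the whole sequence $\{x_k\}$ converges to the local minimum $x^*$, and a quadratic local rate holds for both choices: $g_{k+1}\le O(g_k^2)$ for all sufficiently large $k$.
   Context: Notation. $\|\cdot\|$ is the Euclidean norm, $\mathrm I_n$ the identity. $k\lesssim B(\epsilon)$ means that there is a constant $c>0$ depending only on $\theta$ and the algorithm parameters listed below such that, for all sufficiently small $\epsilon>0$, an $\epsilon$-stationary point is found within $c\,B(\epsilon)$ iterations. $g_{k+1}\le O(g_k^2)$ means $g_{k+1}\le Cg_k^2$ with $C$ independent of $k$. Regularizers must be positive, so iterates are considered as long as $g_k>0$. Convention: $\mathrm{sign}(0)=1$. Algorithm ARNCG. Parameters: $\mu\in(0,1/2)$, $\beta\in(0,1)$, $\tau_-\in(0,1)$, $\tau_+\in(0,1]$, $\tau\in(0,1]$, $\gamma\in(1,\infty)$, $m_{\max}\in[1,\infty)$, $M_0\in(0,\infty)$, $\eta\in[0,1]$; regularizers $\omega_k^{\mathrm t},\omega_k^{\mathrm f}>0$. For $k=0,1,\dots$: compute $(x_{k+1/2},M_{k+1})=\mathrm{NewtonStep}(x_k,\omega_k^{\mathrm t},M_k,\omega_k^{\mathrm f})$ (trial step). If this call returns FAIL, or if ($g_{k+1/2}>g_k$ and $g_k\le g_{k-1}$),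 where $g_{k+1/2}=\|\nabla\varphi(x_{k+1/2})\|$, then set $(x_{k+1},M_{k+1})=\mathrm{NewtonStep}(x_k,\omega_k^{\mathrm f},M_k,\omega_k^{\mathrm f})$ (fallback step); otherwise accept the trial step, $x_{k+1}=x_{k+1/2}$. NewtonStep$(x,\omega,M,\bar\omega)$. Let $\tilde\eta=\min(\eta,\sqrt M\omega)$ and $(\mathrm{type},\tilde d)=\mathrm{CappedCG}(\nabla^2\varphi(x),\nabla\varphi(x),\sqrt M\omega,\tilde\eta,\tau\sqrt M\bar\omega)$. - If type $=$ TERM: return FAIL. - If type $=$ SOL: $d=\tilde d$. Let $0\le m\le m_{\max}$ be the minimum integer with (LS1) $\varphi(x+\beta^md)\le\varphi(x)+\mu\beta^md^\top\nabla\varphi(x)$, and $\alpha=\beta^m$. If no such $m$ exists, set $\hat\alpha=\min(1,\omega^{1/2}M^{-1/4}\|d\|^{-1/2})$, let $0\le\hat m\le m_{\max}$ be the minimum integer with (LS2) $\varphi(x+\hat\alpha\beta^{\hat m}d)\le\varphi(x)+\mu\hat\alpha\beta^{\hat m}d^\top\nabla\varphi(x)$, and $\alpha=\hat\alpha\beta^{\hat m}$; if no such $\hat m$ exists return $(x,\gamma M)$. - If type $=$ NC: $\bar d=\tilde d/\|\tilde d\|$, $d=-L(\bar d)\,\mathrm{sign}(\bar d^\top\nabla\varphi(x))\,\bar d$ with $L(\bar d)=M^{-1}|\bar d^\top\nabla^2\varphi(x)\bar d|$; $\alpha=\beta^m$ with $0\le m\le m_{\max}$ the minimum integer with $\varphi(x+\beta^md)\le\varphi(x)-M\mu\beta^{2m}\|d\|^3$;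 if no such $m$ exists return $(x,\gamma M)$. Finally $x^+=x+\alpha d$; return $(x^+,M^+)$, where with $\Delta=\varphi(x)-\varphi(x^+)$ the value $M^+$ is: (i) if type $=$ SOL and $m=0$ satisfies (LS1): $M^+=\gamma M$ if $\Delta\le\frac4{33}\mu\tau_+M^{-1/2}\min(\|\nabla\varphi(x^+)\|^2\omega^{-1},\omega^3)$; else $M^+=\gamma^{-1}M$ if $\Delta\ge\frac4{33}\mu\tau_-M^{-1/2}\bar\omega^3$; else $M^+=M$; (ii) otherwise: $M^+=\gamma M$ if (type $=$ SOL and $\Delta\le\tau_+\beta\mu M^{-1/2}\omega^3$) or (type $=$ NC and $\Delta\le\tau_+(1-2\mu)^2\beta^2\mu M^{-1/2}\omega^3$); else $M^+=\gamma^{-1}M$ if $\Delta\ge\mu\tau_-M^{-1/2}\bar\omega^3$; else $M^+=M$. CappedCG$(H,g,\rho,\xi,\bar\rho)$. Let $y_0=0$, $r_0=g$, $p_0=-g$, $\bar H=H+2\rho\mathrm I_n$, $N=\|Hp_0\|/\|p_0\|$, $k=0$. If $p_0^\top\bar Hp_0<\rho\|p_0\|^2$ return (NC, $p_0$). Repeat: do one standard CG iteration $\alpha_k=\|r_k\|^2/(p_k^\top\bar Hp_k)$, $y_{k+1}=y_k+\alpha_kp_k$, $r_{k+1}=r_k+\alpha_k\bar Hp_k$, $\beta_{k+1}=\|r_{k+1}\|^2/\|r_k\|^2$, $p_{k+1}=-r_{k+1}+\beta_{k+1}p_k$; set $k\leftarrow k+1$; $N\leftarrow\max(N,\|Hp_k\|/\|p_k\|,\|Hr_k\|/\|r_k\|,\|Hy_k\|/\|y_k\|)$;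 $\kappa=(N+2\rho)/\rho$, $\hat\xi=\xi/(3\kappa)$, $\sigma=\sqrt\kappa/(\sqrt\kappa+1)$, $T=4\kappa^4/(1-\sqrt\sigma)^2$. Then test in order: if $y_k^\top\bar Hy_k<\rho\|y_k\|^2$ return (NC, $y_k$); else if $\|r_k\|\le\hat\xi\|r_0\|$ return (SOL, $y_k$); else if $p_k^\top\bar Hp_k<\rho\|p_k\|^2$ return (NC, $p_k$); else if $\|r_k\|>\sqrt T\sigma^{k/2}\|r_0\|$, compute $\alpha_k=\|r_k\|^2/(p_k^\top\bar Hp_k)$ and $y_{k+1}=y_k+\alpha_kp_k$, find $i\in\{0,\dots,k-1\}$ with $(y_{k+1}-y_i)^\top\bar H(y_{k+1}-y_i)<\rho\|y_{k+1}-y_i\|^2$ and return (NC, $y_{k+1}-y_i$); else if $k\ge J(N,\bar\rho,\xi)+1$ return (TERM, $y_k$). Here $J(N,\rho,\xi)=1+(\sqrt{\kappa'}+\frac12)\log\big(144(\sqrt{\kappa'}+1)^2\kappa'^6/\xi^2\big)$ with $\kappa'=(N+\rho)/\rho$. *)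

theory Defs
  imports "HOL-Analysis.Analysis"
begin

section \<open>Euclidean spaces of all dimensions inside one type\<close>

text \<open>
  The constant hidden in the complexity bounds must not depend on the dimension, so the
  dimension \<open>n\<close> has to be quantified inside the statement, after that constant. The type
  \<open>fsvec\<close> of finitely supported real sequences with the Euclidean inner product contains an
  isometric copy of every \<open>\<real>\<^sup>n\<close>, namely the subspace \<open>Rn n\<close> of the sequences supported on
  the first \<open>n\<close> coordinates.
\<close>

typedef fsvec = "{f :: nat \<Rightarrow> real. finite {i. f i \<noteq> 0}}"
  morphisms coord Abs_fsvec
  by (rule exI[of _ "\<lambda>_. 0"]) simp

setup_lifting type_definition_fsvec

lemma finite_coord: "finite {i. coord x i \<noteq> 0}"
  using coord[of x] by simp

lemma fsvec_eqI: "(\<And>i. coord x i = coord y i) \<Longrightarrow> x = y"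
  by (simp add: coord_inject[symmetric] ext)

instantiation fsvec :: real_vector
begin

lift_definition zero_fsvec :: fsvec is "\<lambda>_. 0" by simp

lift_definition plus_fsvec :: "fsvec \<Rightarrow> fsvec \<Rightarrow> fsvec" is "\<lambda>f g i. f i + g i"
  subgoal for f g by (rule finite_subset[of _ "{i. f i \<noteq> 0} \<union> {i. g i \<noteq> 0}"]) auto
  done

lift_definition minus_fsvec :: "fsvec \<Rightarrow> fsvec \<Rightarrow> fsvec" is "\<lambda>f g i. f i - g i"
  subgoal for f g by (rule finite_subset[of _ "{i. f i \<noteq> 0} \<union> {i. g i \<noteq> 0}"]) auto
  done

lift_definition uminus_fsvec :: "fsvec \<Rightarrow> fsvec" is "\<lambda>f i. - f i" by simp

lift_definition scaleR_fsvec :: "real \<Rightarrow> fsvec \<Rightarrow> fsvec" is "\<lambda>a f i. a * f i"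
  subgoal for a f by (rule finite_subset[of _ "{i. f i \<noteq> 0}"]) auto
  done

instance
proof
  fix x y z :: fsvec and a b :: real
  show "x + y + z = x + (y + z)" by transfer (simp add: add.assoc)
  show "x + y = y + x" by transfer (simp add: add.commute)
  show "0 + x = x" by transfer simp
  show "- x + x = 0" by transfer simp
  show "x - y = x + - y" by transfer simp
  show "a *\<^sub>R (x + y) = a *\<^sub>R x + a *\<^sub>R y" by transfer (simp add: algebra_simps)
  show "(a + b) *\<^sub>R x = a *\<^sub>R x + b *\<^sub>R x" by transfer (simp add: algebra_simps)
  show "a *\<^sub>R b *\<^sub>R x = (a * b) *\<^sub>R x" by transfer (simp add: algebra_simps)
  show "1 *\<^sub>R x = x" by transfer simp
qed

end

instantiation fsvec :: real_inner
begin

definition inner_fsvec :: "fsvec \<Rightarrow> fsvec \<Rightarrow> real"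
  where "inner_fsvec x y = (\<Sum>i | coord x i \<noteq> 0. coord x i * coord y i)"

definition norm_fsvec :: "fsvec \<Rightarrow> real"
  where "norm_fsvec x = sqrt (inner x x)"

definition dist_fsvec :: "fsvec \<Rightarrow> fsvec \<Rightarrow> real"
  where "dist_fsvec x y = norm (x - y)"

definition sgn_fsvec :: "fsvec \<Rightarrow> fsvec"
  where "sgn_fsvec x = x /\<^sub>R norm x"

definition uniformity_fsvec :: "(fsvec \<times> fsvec) filter"
  where "uniformity_fsvec = (INF e\<in>{0<..}. principal {(x, y). dist x y < e})"

definition open_fsvec :: "fsvec set \<Rightarrow> bool"
  where "open_fsvec U = (\<forall>x\<in>U. \<forall>\<^sub>F (x', y) in uniformity. x' = x \<longrightarrow> y \<in> U)"

instance
proof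
  fix x y z :: fsvec and a b :: real
  have inner_superset: "inner u v = (\<Sum>i\<in>A. coord u i * coord v i)"
    if "finite A" "{i. coord u i \<noteq> 0} \<subseteq> A" for A and u v :: fsvec
    unfolding inner_fsvec_def by (rule sum.mono_neutral_left) (use that in auto)
  show "dist x y = norm (x - y)" by (rule dist_fsvec_def)
  show "sgn x = x /\<^sub>R norm x" by (rule sgn_fsvec_def)
  show "uniformity = (INF e\<in>{0<..}. principal {(x::fsvec, y). dist x y < e})"
    by (rule uniformity_fsvec_def)
  show "open U = (\<forall>x\<in>U. \<forall>\<^sub>F (x', y) in uniformity. x' = x \<longrightarrow> y \<in> U)" for U :: "fsvec set"
    by (rule open_fsvec_def)
  let ?A = "{i. coord x i \<noteq> 0} \<union> {i. coord y i \<noteq> 0}"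
  have A: "finite ?A" using finite_coord by simp
  have "inner x y = (\<Sum>i\<in>?A. coord x i * coord y i)" "inner y x = (\<Sum>i\<in>?A. coord y i * coord x i)"
    by (rule inner_superset[OF A]; blast)+
  then show "inner x y = inner y x" by (simp add: mult.commute)
  have "{i. coord (x + y) i \<noteq> 0} \<subseteq> ?A" by (auto simp: plus_fsvec.rep_eq)
  then have "inner (x + y) z = (\<Sum>i\<in>?A. coord (x + y) i * coord z i)"
    by (rule inner_superset[OF A])
  moreover have "inner x z = (\<Sum>i\<in>?A. coord x i * coord z i)"
    by (rule inner_superset[OF A]) blast
  moreover have "inner y z = (\<Sum>i\<in>?A. coord y i * coord z i)"
    by (rule inner_superset[OF A]) blast
  ultimately show "inner (x + y) z = inner x z + inner y z"
    by (simp add: plus_fsvec.rep_eq algebra_simps sum.distrib)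
  have "inner (a *\<^sub>R x) y = (\<Sum>i | coord x i \<noteq> 0. coord (a *\<^sub>R x) i * coord y i)"
    by (rule inner_superset[OF finite_coord]) (auto simp: scaleR_fsvec.rep_eq)
  then show "inner (a *\<^sub>R x) y = a * inner x y"
    by (simp add: scaleR_fsvec.rep_eq inner_fsvec_def sum_distrib_left mult.assoc)
  show "0 \<le> inner x x" by (simp add: inner_fsvec_def sum_nonneg)
  have "inner x x = 0 \<longleftrightarrow> (\<forall>i\<in>{i. coord x i \<noteq> 0}. coord x i * coord x i = 0)"
    unfolding inner_fsvec_def by (rule sum_nonneg_eq_0_iff[OF finite_coord]) simp
  also have "\<dots> \<longleftrightarrow> x = 0" by (auto intro: fsvec_eqI simp: zero_fsvec.rep_eq)
  finally show "inner x x = 0 \<longleftrightarrow> x = 0" .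
  show "norm x = sqrt (inner x x)" by (rule norm_fsvec_def)
qed

end

definition Rn :: "nat \<Rightarrow> fsvec set"
  where "Rn n = {x. \<forall>i\<ge>n. coord x i = 0}"

lemma norm_Rn: "x \<in> Rn n \<Longrightarrow> norm x = sqrt (\<Sum>i<n. (coord x i)\<^sup>2)"
proof -
  assume "x \<in> Rn n"
  then have "{i. coord x i \<noteq> 0} \<subseteq> {..<n}" by (force simp: Rn_def not_less[symmetric])
  then have "inner x x = (\<Sum>i<n. coord x i * coord x i)"
    unfolding inner_fsvec_def by (rule sum.mono_neutral_left[OF finite_lessThan]) auto
  then show ?thesis by (simp add: norm_fsvec_def power2_eq_square)
qed


section \<open>Twice continuously differentiable functions and level sets\<close>

text \<open>
  \<open>C2_on_Rn n \<phi> G H\<close>: on \<open>\<real>\<^sup>n\<close> the function \<open>\<phi>\<close> is twice continuously differentiable with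
  gradient \<open>G\<close> and Hessian \<open>H\<close>. Requiring \<open>H x\<close> to vanish on the orthogonal complement of
  \<open>Rn n\<close> makes \<open>H x\<close> unique for \<open>x\<close> in \<open>Rn n\<close>, and makes its norm in \<open>\<Rightarrow>\<^sub>L\<close> the
  spectral norm of the \<open>n \<times> n\<close> Hessian matrix.
\<close>

definition C2_on_Rn ::
  "nat \<Rightarrow> (fsvec \<Rightarrow> real) \<Rightarrow> (fsvec \<Rightarrow> fsvec) \<Rightarrow> (fsvec \<Rightarrow> fsvec \<Rightarrow>\<^sub>L fsvec) \<Rightarrow> bool"
  where "C2_on_Rn n \<phi> G H \<longleftrightarrow>
    (\<forall>x\<in>Rn n.
        G x \<in> Rn n \<and>
        (\<phi> has_derivative (\<lambda>h. G x \<bullet> h)) (at x within Rn n) \<and>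
        (G has_derivative blinfun_apply (H x)) (at x within Rn n) \<and>
        (\<forall>v\<in>Rn n. blinfun_apply (H x) v \<in> Rn n) \<and>
        (\<forall>v. (\<forall>w\<in>Rn n. v \<bullet> w = 0) \<longrightarrow> blinfun_apply (H x) v = 0)) \<and>
    continuous_on (Rn n) H"

definition level_set :: "nat \<Rightarrow> (fsvec \<Rightarrow> real) \<Rightarrow> fsvec \<Rightarrow> fsvec set"
  where "level_set n \<phi> x0 = {x \<in> Rn n. \<phi> x \<le> \<phi> x0}"


section \<open>Capped conjugate gradients\<close>

datatype cg_type = SOL | NC | TERMINATED

context
  fixes H :: "fsvec \<Rightarrow>\<^sub>L fsvec" and g :: fsvec and \<rho> :: real
begin

definition cg_Hbar :: "fsvec \<Rightarrow> fsvec"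
  where "cg_Hbar v = blinfun_apply H v + (2 * \<rho>) *\<^sub>R v"

text \<open>The triple \<open>(y\<^sub>k, r\<^sub>k, p\<^sub>k)\<close> of the standard conjugate gradient recursion.\<close>

primrec cg_iter :: "nat \<Rightarrow> fsvec \<times> fsvec \<times> fsvec" where
  "cg_iter 0 = (0, g, - g)"
| "cg_iter (Suc k) =
    (let (y, r, p) = cg_iter k;
         \<alpha> = (norm r)\<^sup>2 / (p \<bullet> cg_Hbar p);
         r' = r + \<alpha> *\<^sub>R cg_Hbar p;
         \<beta> = (norm r')\<^sup>2 / (norm r)\<^sup>2
     in (y + \<alpha> *\<^sub>R p, r', - r' + \<beta> *\<^sub>R p))"

definition cg_y :: "nat \<Rightarrow> fsvec" where "cg_y k = fst (cg_iter k)"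
definition cg_r :: "nat \<Rightarrow> fsvec" where "cg_r k = fst (snd (cg_iter k))"
definition cg_p :: "nat \<Rightarrow> fsvec" where "cg_p k = snd (snd (cg_iter k))"

definition cg_ratio :: "fsvec \<Rightarrow> real"
  where "cg_ratio v = norm (blinfun_apply H v) / norm v"

primrec cg_N :: "nat \<Rightarrow> real" where
  "cg_N 0 = cg_ratio (cg_p 0)"
| "cg_N (Suc k) = Max {cg_N k, cg_ratio (cg_p (Suc k)), cg_ratio (cg_r (Suc k)), cg_ratio (cg_y (Suc k))}"

definition cg_kappa :: "nat \<Rightarrow> real" where "cg_kappa k = (cg_N k + 2 * \<rho>) / \<rho>"

definition cg_sigma :: "nat \<Rightarrow> real"
  where "cg_sigma k = sqrt (cg_kappa k) / (sqrt (cg_kappa k) + 1)"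

definition cg_T :: "nat \<Rightarrow> real"
  where "cg_T k = 4 * cg_kappa k ^ 4 / (1 - sqrt (cg_sigma k))\<^sup>2"

definition low_curv :: "fsvec \<Rightarrow> bool"
  where "low_curv v \<longleftrightarrow> v \<bullet> cg_Hbar v < \<rho> * (norm v)\<^sup>2"

end

text \<open>
  For \<open>\<xi> = 0\<close> (which happens exactly when \<open>\<eta> = 0\<close>) the argument of the logarithm is infinite;
  the iteration cap is then infinite, whereas the totalised \<open>ln (_ / 0) = 0\<close> would make it 1.
\<close>

definition cg_J :: "real \<Rightarrow> real \<Rightarrow> real \<Rightarrow> ereal"
  where "cg_J N \<rho> \<xi> =
    (let \<kappa> = (N + \<rho>) / \<rho>
     in if \<xi> = 0 then \<infinity>
        else ereal (1 + (sqrt \<kappa> + 1/2) * ln (144 * (sqrt \<kappa> + 1)\<^sup>2 * \<kappa> ^ 6 / \<xi>\<^sup>2)))"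

context
  fixes H :: "fsvec \<Rightarrow>\<^sub>L fsvec" and g :: fsvec and \<rho> \<xi> \<rho>bar :: real
begin

definition cg_solved :: "nat \<Rightarrow> bool"
  where "cg_solved k \<longleftrightarrow> norm (cg_r H g \<rho> k) \<le> \<xi> / (3 * cg_kappa H g \<rho> k) * norm (cg_r H g \<rho> 0)"

definition cg_slow :: "nat \<Rightarrow> bool"
  where "cg_slow k \<longleftrightarrow>
    norm (cg_r H g \<rho> k) > sqrt (cg_T H g \<rho> k) * cg_sigma H g \<rho> k powr (real k / 2) * norm (cg_r H g \<rho> 0)"

definition cg_capped :: "nat \<Rightarrow> bool"
  where "cg_capped k \<longleftrightarrow> ereal (real k) \<ge> cg_J (cg_N H g \<rho> k) \<rho>bar \<xi> + 1"

definition cg_stops :: "nat \<Rightarrow> bool"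
  where "cg_stops k \<longleftrightarrow>
    low_curv H \<rho> (cg_y H g \<rho> k) \<or> cg_solved k \<or> low_curv H \<rho> (cg_p H g \<rho> k) \<or> cg_slow k \<or> cg_capped k"

text \<open>The tests at the end of pass \<open>k\<close>, in order; a relation because the index \<open>i\<close> in the
  fourth test is not specified uniquely.\<close>

definition cg_returns :: "nat \<Rightarrow> cg_type \<times> fsvec \<Rightarrow> bool"
  where "cg_returns k res \<longleftrightarrow>
    (if low_curv H \<rho> (cg_y H g \<rho> k) then res = (NC, cg_y H g \<rho> k)
     else if cg_solved k then res = (SOL, cg_y H g \<rho> k)
     else if low_curv H \<rho> (cg_p H g \<rho> k) then res = (NC, cg_p H g \<rho> k)
     else if cg_slow k then
       (\<exists>i<k. low_curv H \<rho> (cg_y H g \<rho> (Suc k) - cg_y H g \<rho> i) \<and>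
              res = (NC, cg_y H g \<rho> (Suc k) - cg_y H g \<rho> i))
     else cg_capped k \<and> res = (TERMINATED, cg_y H g \<rho> k))"

definition capped_cg :: "cg_type \<times> fsvec \<Rightarrow> bool"
  where "capped_cg res \<longleftrightarrow>
    (if low_curv H \<rho> (cg_p H g \<rho> 0) then res = (NC, cg_p H g \<rho> 0)
     else \<exists>k\<ge>1. (\<forall>j. 1 \<le> j \<and> j < k \<longrightarrow> \<not> cg_stops j) \<and> cg_returns k res)"

end


section \<open>The algorithm\<close>

record arncg_params =
  mu :: real
  beta :: real
  tau_minus :: real
  tau_plus :: real
  tau :: real
  gam :: real
  m_max :: real
  M_init :: real
  eta :: real

definition valid_params :: "arncg_params \<Rightarrow> bool"
  where "valid_params P \<longleftrightarrow>
    0 < mu P \<and> mu P < 1/2 \<and> 0 < beta P \<and> beta P < 1 \<and>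
    0 < tau_minus P \<and> tau_minus P < 1 \<and> 0 < tau_plus P \<and> tau_plus P \<le> 1 \<and>
    0 < tau P \<and> tau P \<le> 1 \<and> 1 < gam P \<and> 1 \<le> m_max P \<and> 0 < M_init P \<and>
    0 \<le> eta P \<and> eta P \<le> 1"

text \<open>\<open>first_upto b Q\<close> is the least \<open>m \<le> b\<close> satisfying \<open>Q\<close>, if there is one;
  \<open>tested_upto b Q\<close> are the \<open>m\<close> examined by the search for it.\<close>

definition first_upto :: "real \<Rightarrow> (nat \<Rightarrow> bool) \<Rightarrow> nat option"
  where "first_upto b Q = (if \<exists>m. real m \<le> b \<and> Q m then Some (LEAST m. Q m) else None)"

definition tested_upto :: "real \<Rightarrow> (nat \<Rightarrow> bool) \<Rightarrow> nat set"
  where "tested_upto b Q = {m. real m \<le> b \<and> (\<forall>j<m. \<not> Q j)}"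

text \<open>\<open>full\<close> says that the unit step of a \<open>SOL\<close> direction was accepted, and \<open>gplus\<close> is the
  gradient norm at the new point.\<close>

definition new_M ::
  "arncg_params \<Rightarrow> cg_type \<Rightarrow> bool \<Rightarrow> real \<Rightarrow> real \<Rightarrow> real \<Rightarrow> real \<Rightarrow> real \<Rightarrow> real"
  where "new_M P ty full \<Delta> gplus \<omega> M \<omega>bar =
    (if ty = SOL \<and> full then
       (if \<Delta> \<le> 4/33 * mu P * tau_plus P * M powr (-1/2) * min (gplus\<^sup>2 * inverse \<omega>) (\<omega> ^ 3) then gam P * M
        else if \<Delta> \<ge> 4/33 * mu P * tau_minus P * M powr (-1/2) * \<omega>bar ^ 3 then inverse (gam P) * M
        else M)
     else
       (if ty = SOL \<and> \<Delta> \<le> tau_plus P * beta P * mu P * M powr (-1/2) * \<omega> ^ 3 \<or>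
           ty = NC \<and> \<Delta> \<le> tau_plus P * (1 - 2 * mu P)\<^sup>2 * (beta P)\<^sup>2 * mu P * M powr (-1/2) * \<omega> ^ 3
        then gam P * M
        else if \<Delta> \<ge> mu P * tau_minus P * M powr (-1/2) * \<omega>bar ^ 3 then inverse (gam P) * M
        else M))"

context
  fixes P :: arncg_params
    and \<phi> :: "fsvec \<Rightarrow> real" and G :: "fsvec \<Rightarrow> fsvec" and H :: "fsvec \<Rightarrow> fsvec \<Rightarrow>\<^sub>L fsvec"
begin

text \<open>(LS1) is the case \<open>a = 1\<close>, and (LS2) the case of \<open>a = sol_alpha d \<omega> M\<close>.\<close>

definition armijo :: "fsvec \<Rightarrow> fsvec \<Rightarrow> real \<Rightarrow> nat \<Rightarrow> bool"
  where "armijo x d a m \<longleftrightarrow>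
    \<phi> (x + (a * beta P ^ m) *\<^sub>R d) \<le> \<phi> x + mu P * (a * beta P ^ m) * (d \<bullet> G x)"

definition sol_alpha :: "fsvec \<Rightarrow> real \<Rightarrow> real \<Rightarrow> real"
  where "sol_alpha d \<omega> M = min 1 (\<omega> powr (1/2) * M powr (-1/4) * norm d powr (-1/2))"

definition nc_decrease :: "fsvec \<Rightarrow> fsvec \<Rightarrow> real \<Rightarrow> nat \<Rightarrow> bool"
  where "nc_decrease x d M m \<longleftrightarrow>
    \<phi> (x + (beta P ^ m) *\<^sub>R d) \<le> \<phi> x - M * mu P * beta P ^ (2 * m) * (norm d) ^ 3"

text \<open>The sign of zero is 1 here, unlike for the library's \<open>sgn\<close>.\<close>

definition nc_direction :: "fsvec \<Rightarrow> real \<Rightarrow> fsvec \<Rightarrow> fsvec"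
  where "nc_direction x M dt =
    (let e = dt /\<^sub>R norm dt;
         L = inverse M * \<bar>e \<bullet> blinfun_apply (H x) e\<bar>;
         s = (if e \<bullet> G x < 0 then -1 else 1)
     in - ((L * s) *\<^sub>R e))"

definition accept_step ::
  "fsvec \<Rightarrow> fsvec \<Rightarrow> real \<Rightarrow> cg_type \<Rightarrow> bool \<Rightarrow> real \<Rightarrow> real \<Rightarrow> real \<Rightarrow> fsvec \<times> real"
  where "accept_step x d \<alpha> ty full \<omega> M \<omega>bar =
    (let x' = x + \<alpha> *\<^sub>R d
     in (x', new_M P ty full (\<phi> x - \<phi> x') (norm (G x')) \<omega> M \<omega>bar))"

text \<open>
  The part of NewtonStep after the call of CappedCG, as a function of the output \<open>(ty, dt)\<close> of
  that call (\<open>newton_cg\<close> below relates the call to its possible outputs). The result \<open>None\<close>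
  stands for FAIL.
\<close>

definition newton_result ::
  "fsvec \<Rightarrow> real \<Rightarrow> real \<Rightarrow> real \<Rightarrow> cg_type \<times> fsvec \<Rightarrow> (fsvec \<times> real) option"
  where "newton_result x \<omega> M \<omega>bar res =
    (case res of (ty, dt) \<Rightarrow>
      (case ty of
         TERMINATED \<Rightarrow> None
       | SOL \<Rightarrow>
           (case first_upto (m_max P) (armijo x dt 1) of
              Some m \<Rightarrow> Some (accept_step x dt (beta P ^ m) SOL (m = 0) \<omega> M \<omega>bar)
            | None \<Rightarrow>
                (case first_upto (m_max P) (armijo x dt (sol_alpha dt \<omega> M)) of
                   Some m \<Rightarrow> Some (accept_step x dt (sol_alpha dt \<omega> M * beta P ^ m) SOL False \<omega> M \<omega>bar)
                 | None \<Rightarrow> Some (x, gam P * M)))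
       | NC \<Rightarrow>
           (let d = nc_direction x M dt
            in case first_upto (m_max P) (nc_decrease x d M) of
                 Some m \<Rightarrow> Some (accept_step x d (beta P ^ m) NC False \<omega> M \<omega>bar)
               | None \<Rightarrow> Some (x, gam P * M))))"

text \<open>The points at which that part evaluates the objective.\<close>

definition newton_trials :: "fsvec \<Rightarrow> real \<Rightarrow> real \<Rightarrow> cg_type \<times> fsvec \<Rightarrow> fsvec set"
  where "newton_trials x \<omega> M res =
    (case res of (ty, dt) \<Rightarrow>
      (case ty of
         TERMINATED \<Rightarrow> {}
       | SOL \<Rightarrow>
           {x + (beta P ^ m) *\<^sub>R dt | m. m \<in> tested_upto (m_max P) (armijo x dt 1)} \<union>
           (if first_upto (m_max P) (armijo x dt 1) = None
            then {x + (sol_alpha dt \<omega> M * beta P ^ m) *\<^sub>R dt | m.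
                    m \<in> tested_upto (m_max P) (armijo x dt (sol_alpha dt \<omega> M))}
            else {})
       | NC \<Rightarrow>
           (let d = nc_direction x M dt
            in {x + (beta P ^ m) *\<^sub>R d | m. m \<in> tested_upto (m_max P) (nc_decrease x d M)})))"

definition newton_cg :: "fsvec \<Rightarrow> real \<Rightarrow> real \<Rightarrow> real \<Rightarrow> cg_type \<times> fsvec \<Rightarrow> bool"
  where "newton_cg x \<omega> M \<omega>bar res \<longleftrightarrow>
    capped_cg (H x) (G x) (sqrt M * \<omega>) (min (eta P) (sqrt M * \<omega>)) (tau P * sqrt M * \<omega>bar) res"

text \<open>
  In the sequel \<open>x\<close> and \<open>M\<close> are the sequences of iterates and of estimates, \<open>tr k\<close> and \<open>fb k\<close>
  the outputs of CappedCG in the trial and fallback step of iteration \<open>k\<close>, and \<open>\<omega>t\<close>, \<open>\<omega>f\<close> the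
  regularizers. Throughout, \<open>s (k - 1)\<close> with truncated subtraction implements the convention that
  the sequences \<open>s\<close> in question have the same value at \<open>-1\<close> as at \<open>0\<close>.
\<close>

definition trial_result ::
  "(nat \<Rightarrow> real) \<Rightarrow> (nat \<Rightarrow> real) \<Rightarrow> (nat \<Rightarrow> fsvec) \<Rightarrow> (nat \<Rightarrow> real) \<Rightarrow>
   (nat \<Rightarrow> cg_type \<times> fsvec) \<Rightarrow> nat \<Rightarrow> (fsvec \<times> real) option"
  where "trial_result \<omega>t \<omega>f x M tr k = newton_result (x k) (\<omega>t k) (M k) (\<omega>f k) (tr k)"

definition needs_fallback ::
  "(nat \<Rightarrow> real) \<Rightarrow> (nat \<Rightarrow> real) \<Rightarrow> (nat \<Rightarrow> fsvec) \<Rightarrow> (nat \<Rightarrow> real) \<Rightarrow>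
   (nat \<Rightarrow> cg_type \<times> fsvec) \<Rightarrow> nat \<Rightarrow> bool"
  where "needs_fallback \<omega>t \<omega>f x M tr k \<longleftrightarrow>
    (case trial_result \<omega>t \<omega>f x M tr k of
       None \<Rightarrow> True
     | Some (xh, _) \<Rightarrow>
         norm (G xh) > norm (G (x k)) \<and> norm (G (x k)) \<le> norm (G (x (k - 1))))"

text \<open>
  A run of the algorithm. The iteration is only performed while the gradient is nonzero (the
  regularizers must be positive); after that the sequence is continued as a constant one.
\<close>

definition arncg_run ::
  "(nat \<Rightarrow> real) \<Rightarrow> (nat \<Rightarrow> real) \<Rightarrow> fsvec \<Rightarrow> (nat \<Rightarrow> fsvec) \<Rightarrow> (nat \<Rightarrow> real) \<Rightarrow>
   (nat \<Rightarrow> cg_type \<times> fsvec) \<Rightarrow> (nat \<Rightarrow> cg_type \<times> fsvec) \<Rightarrow> bool"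
  where "arncg_run \<omega>t \<omega>f x0 x M tr fb \<longleftrightarrow>
    x 0 = x0 \<and> M 0 = M_init P \<and>
    (\<forall>k. if G (x k) = 0 then x (Suc k) = x k \<and> M (Suc k) = M k
         else
           newton_cg (x k) (\<omega>t k) (M k) (\<omega>f k) (tr k) \<and>
           (if needs_fallback \<omega>t \<omega>f x M tr k then
              newton_cg (x k) (\<omega>f k) (M k) (\<omega>f k) (fb k) \<and>
              newton_result (x k) (\<omega>f k) (M k) (\<omega>f k) (fb k) = Some (x (Suc k), M (Suc k))
            else trial_result \<omega>t \<omega>f x M tr k = Some (x (Suc k), M (Suc k))))"

definition arncg_trials ::
  "(nat \<Rightarrow> real) \<Rightarrow> (nat \<Rightarrow> real) \<Rightarrow> (nat \<Rightarrow> fsvec) \<Rightarrow> (nat \<Rightarrow> real) \<Rightarrow>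
   (nat \<Rightarrow> cg_type \<times> fsvec) \<Rightarrow> (nat \<Rightarrow> cg_type \<times> fsvec) \<Rightarrow> fsvec set"
  where "arncg_trials \<omega>t \<omega>f x M tr fb =
    (\<Union>k\<in>{k. G (x k) \<noteq> 0}.
       newton_trials (x k) (\<omega>t k) (M k) (tr k) \<union>
       (if needs_fallback \<omega>t \<omega>f x M tr k then newton_trials (x k) (\<omega>f k) (M k) (fb k) else {}))"

end


section \<open>The two choices of the regularizers\<close>

text \<open>Here \<open>g\<close> is the sequence of gradient norms.\<close>

definition eps_seq :: "(nat \<Rightarrow> real) \<Rightarrow> nat \<Rightarrow> real"
  where "eps_seq g k = Min (g ` {0..k})"

definition reg_choice1 :: "real \<Rightarrow> (nat \<Rightarrow> real) \<Rightarrow> (nat \<Rightarrow> real) \<Rightarrow> (nat \<Rightarrow> real) \<Rightarrow> bool"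
  where "reg_choice1 \<theta> g \<omega>t \<omega>f \<longleftrightarrow>
    (\<forall>k. \<omega>f k = sqrt (g k) \<and>
         \<omega>t k = \<omega>f k * (min 1 (g k * inverse (g (k - 1)))) powr \<theta>)"

definition reg_choice2 :: "real \<Rightarrow> (nat \<Rightarrow> real) \<Rightarrow> (nat \<Rightarrow> real) \<Rightarrow> (nat \<Rightarrow> real) \<Rightarrow> bool"
  where "reg_choice2 \<theta> g \<omega>t \<omega>f \<longleftrightarrow>
    (\<forall>k. \<omega>f k = sqrt (eps_seq g k) \<and>
         \<omega>t k = \<omega>f k * (eps_seq g k * inverse (eps_seq g (k - 1))) powr \<theta>)"

end

theory Submission
  imports Defs "HOL-Real_Asymp.Real_Asymp"
begin

text \<open>
  The number of iterations splits according to what happens to the estimate \<open>M\<close>. An iteration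
  that decreases \<open>M\<close> lowers the objective by a multiple of the cube of the fallback
  regularizer; an iteration that keeps \<open>M\<close> lowers it comparably, or else the gradient norm
  has just dropped sharply or is about to; and the iterations that increase \<open>M\<close> are, up to a
  constant, at most as many as those that decrease it, because \<open>M\<close> stays bounded
  (\<open>increases_le_decreases\<close>). Boundedness holds because no step increases \<open>M\<close> once it is
  large (\<open>estimate_not_increased\<close>): negative curvature directions then are short enough for a
  Taylor expansion; an accepted unit step of type \<open>SOL\<close> is too long or its new gradient too small
  for the threshold (\<open>full_step_decrease\<close>); and a step size that is rejected before another one
  is accepted is so long that the decrease exceeds every threshold (\<open>armijo_rejected_long\<close>).

  The threshold below which \<open>\<epsilon>\<close> has to lie may depend on the whole problem. Thus the constants
  in the counting may depend on it too, if the final bound has a factor \<open>o(1)\<close> to absorb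
  them. Such a factor is available: the objective values converge, so the decreases by at least
  \<open>t\<close> are at most \<open>C + \<eta> / t\<close> in number, for every \<open>\<eta> > 0\<close> (\<open>card_large_decreases\<close>).
  With \<open>t\<close> proportional to \<open>\<epsilon> powr (3/2)\<close> and \<open>\<eta>\<close> chosen small in comparison with
  \<open>\<Delta> * L_H powr (1/2)\<close>, the constant \<open>c = 1\<close> works. For the first choice of the regularizers
  every such decrease may be followed by a stretch of iterations without progress in the objective,
  in which the logarithm of the gradient norm divided by \<open>\<epsilon>\<close> shrinks geometrically; this
  gives the factor \<open>ln (ln (U / \<epsilon>))\<close> (\<open>excursion_count\<close>, \<open>bound_choice1\<close>). For the second
  choice these iterations halve the monotone quantity \<open>\<epsilon>\<^sub>k\<close>, so there are only \<open>O(ln (U / \<epsilon>))\<close>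
  of them (\<open>halving_count\<close>, \<open>bound_choice2\<close>).

  Arbitrarily small gradients and compactness of the level set give a stationary limit point. If the
  Hessian is positive definite there, then near it CG converges linearly at a rate that does not
  depend on the iterate, while the iteration cap tends to infinity with \<open>1 / \<omega>f\<close>; so the trial
  step is never cut off (\<open>capped_cg_solves\<close>). Its full length is accepted, it halves the gradient
  norm, and its length is bounded by the gradient norm (\<open>local_iteration\<close>). Hence the iterates
  cannot leave the neighbourhood and converge. The new gradient norm is at most a multiple of
  \<open>g\<^sub>k (\<omega>t k + g\<^sub>k)\<close>, and since \<open>\<omega>t k\<close> itself contains a power of \<open>g\<^sub>k / g\<^sub>k\<^sub>-\<^sub>1\<close>,
  a rate of order \<open>\<nu> < 2\<close> improves itself to order \<open>2\<close> in finitely many rounds when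
  \<open>\<theta> > 1\<close> (\<open>quadratic_rate\<close>).
\<close>

section \<open>Coordinate subspaces\<close>

lemma subspace_Rn: "subspace (Rn n)"
  by (auto simp: subspace_def Rn_def zero_fsvec.rep_eq plus_fsvec.rep_eq scaleR_fsvec.rep_eq)

lemmas Rn_closed [intro] =
  subspace_0[OF subspace_Rn] subspace_add[OF subspace_Rn] subspace_diff[OF subspace_Rn]
  subspace_scale[OF subspace_Rn] subspace_neg[OF subspace_Rn]

lift_definition unit_vec :: "nat \<Rightarrow> fsvec" is "\<lambda>n i. if i = n then 1 else 0" by simp

text \<open>
  Bounded closed subsets of the infinite-dimensional type \<open>fsvec\<close> need not be compact; inside
  \<open>Rn n\<close> they are, because adding one coordinate is the continuous image of a product with an
  interval.
\<close>

lemma compact_box_Rn: "compact {x \<in> Rn n. \<forall>i<n. \<bar>coord x i\<bar> \<le> R}"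
proof (induction n)
  case 0
  have "{x \<in> Rn 0. \<forall>i<0. \<bar>coord x i\<bar> \<le> R} = {0}"
    by (auto simp: Rn_def zero_fsvec.rep_eq intro: fsvec_eqI)
  then show ?case by simp
next
  case (Suc n)
  let ?B = "{x \<in> Rn n. \<forall>i<n. \<bar>coord x i\<bar> \<le> R}"
  let ?h = "\<lambda>p. fst p + snd p *\<^sub>R unit_vec n"
  have "{x \<in> Rn (Suc n). \<forall>i<Suc n. \<bar>coord x i\<bar> \<le> R} = ?h ` (?B \<times> {-R..R})" (is "?L = ?R")
  proof
    show "?R \<subseteq> ?L"
      by (auto simp: Rn_def plus_fsvec.rep_eq scaleR_fsvec.rep_eq unit_vec.rep_eq less_Suc_eq)
    show "?L \<subseteq> ?R"
    proof
      fix x assume x: "x \<in> ?L"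
      define y where "y = x - coord x n *\<^sub>R unit_vec n"
      have c: "coord y i = (if i = n then 0 else coord x i)" for i
        by (simp add: y_def minus_fsvec.rep_eq scaleR_fsvec.rep_eq unit_vec.rep_eq)
      have "y \<in> ?B"
        using x by (auto simp: c Rn_def le_Suc_eq Suc_le_eq less_Suc_eq nat_less_le)
      moreover have "coord x n \<in> {-R..R}" using x by (auto simp: abs_le_iff)
      moreover have "x = ?h (y, coord x n)" by (simp add: y_def)
      ultimately show "x \<in> ?R" by blast
    qed
  qed
  moreover have "compact (?h ` (?B \<times> {-R..R}))"
    by (intro compact_continuous_image compact_Times Suc continuous_intros compact_Icc)
  ultimately show ?case by simp
qed

lemma compact_sphere_Rn: "compact {x \<in> Rn n. norm x = 1}"
proof -
  have "\<bar>coord x i\<bar> \<le> 1" if x: "x \<in> Rn n" "norm x = 1" and i: "i < n" for x i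
  proof -
    have "(coord x i)\<^sup>2 \<le> (\<Sum>i<n. (coord x i)\<^sup>2)"
      by (rule member_le_sum) (use i in auto)
    also have "\<dots> = 1" using norm_Rn[OF x(1)] x(2) by (simp add: real_sqrt_eq_1_iff)
    finally show ?thesis by (simp add: abs_square_le_1)
  qed
  then have "{x \<in> Rn n. norm x = 1} = {x \<in> Rn n. \<forall>i<n. \<bar>coord x i\<bar> \<le> 1} \<inter> {x. norm x = 1}"
    by auto
  moreover have "closed {x::fsvec. norm x = 1}"
    by (intro closed_Collect_eq continuous_intros)
  ultimately show ?thesis by (simp only: compact_Int_closed[OF compact_box_Rn])
qed

text \<open>
  On the compact unit sphere of \<open>Rn n\<close> the quadratic form attains its smallest value,
  the smallest eigenvalue.
\<close>

lemma pos_def_uniform_Rn: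
  assumes "\<forall>v\<in>Rn n - {0}. v \<bullet> blinfun_apply A v > 0"
  shows "\<exists>m>0. \<forall>v\<in>Rn n. v \<bullet> blinfun_apply A v \<ge> m * (norm v)\<^sup>2"
proof (cases "{x \<in> Rn n. norm x = 1} = {}")
  case True
  have "v = 0" if "v \<in> Rn n" for v
  proof (rule ccontr)
    assume "v \<noteq> 0"
    then have "v /\<^sub>R norm v \<in> {x \<in> Rn n. norm x = 1}" using that by auto
    with True show False by blast
  qed
  then have "\<forall>v\<in>Rn n. v \<bullet> blinfun_apply A v \<ge> 1 * (norm v)\<^sup>2" by fastforce
  then show ?thesis by (intro exI[of _ 1]) simp
next
  case False
  have "continuous_on {x \<in> Rn n. norm x = 1} (\<lambda>v. v \<bullet> blinfun_apply A v)"
    by (intro continuous_intros)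
  from continuous_attains_inf[OF compact_sphere_Rn False this]
  obtain u where u: "u \<in> Rn n" "norm u = 1"
    and min: "\<And>v. v \<in> Rn n \<Longrightarrow> norm v = 1 \<Longrightarrow> u \<bullet> blinfun_apply A u \<le> v \<bullet> blinfun_apply A v"
    by auto
  have "u \<bullet> blinfun_apply A u * (norm v)\<^sup>2 \<le> v \<bullet> blinfun_apply A v" if v: "v \<in> Rn n" for v
  proof (cases "v = 0")
    case False
    have "u \<bullet> blinfun_apply A u \<le> (v /\<^sub>R norm v) \<bullet> blinfun_apply A (v /\<^sub>R norm v)"
      by (rule min) (use v False in auto)
    also have "\<dots> = (v \<bullet> blinfun_apply A v) / (norm v)\<^sup>2"
      by (simp add: blinfun.scaleR_right power2_eq_square divide_simps)
    finally show ?thesis using False by (simp add: field_simps)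
  qed (simp add: blinfun.zero_right)
  moreover have "u \<bullet> blinfun_apply A u > 0" using u assms by force
  ultimately show ?thesis by blast
qed

section \<open>Taylor estimates near the level set\<close>

locale smooth_problem =
  fixes n :: nat and \<phi> :: "fsvec \<Rightarrow> real" and G :: "fsvec \<Rightarrow> fsvec"
    and H :: "fsvec \<Rightarrow> fsvec \<Rightarrow>\<^sub>L fsvec" and x0 :: fsvec and L :: real and N :: "fsvec set"
  assumes C2: "C2_on_Rn n \<phi> G H" and x0: "x0 \<in> Rn n"
    and compact_level: "compact (level_set n \<phi> x0)"
    and openin_N: "openin (top_of_set (Rn n)) N" and level_N: "level_set n \<phi> x0 \<subseteq> N"
    and L_pos: "L > 0" and lipschitz: "L-lipschitz_on N H"
begin

abbreviation S :: "fsvec set" where "S \<equiv> level_set n \<phi> x0"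

lemma S_Rn: "x \<in> S \<Longrightarrow> x \<in> Rn n" and x0_S: "x0 \<in> S"
  using x0 by (auto simp: level_set_def)

lemma G_Rn [intro]: "x \<in> Rn n \<Longrightarrow> G x \<in> Rn n"
  and H_Rn [intro]: "x \<in> Rn n \<Longrightarrow> v \<in> Rn n \<Longrightarrow> blinfun_apply (H x) v \<in> Rn n"
  using C2 by (simp_all add: C2_on_Rn_def)

lemma phi_has_derivative: "y \<in> Rn n \<Longrightarrow> (\<phi> has_derivative (\<lambda>h. G y \<bullet> h)) (at y within Rn n)"
  and G_has_derivative: "y \<in> Rn n \<Longrightarrow> (G has_derivative blinfun_apply (H y)) (at y within Rn n)"
  using C2 by (simp_all add: C2_on_Rn_def)

lemma continuous_phi: "continuous_on (Rn n) \<phi>"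
  by (rule has_derivative_continuous_on[OF phi_has_derivative])

lemma continuous_G: "continuous_on (Rn n) G"
  by (rule has_derivative_continuous_on[OF G_has_derivative])

lemma continuous_H: "continuous_on (Rn n) H"
  using C2 by (simp add: C2_on_Rn_def)

lemma line_Rn: "x \<in> Rn n \<Longrightarrow> d \<in> Rn n \<Longrightarrow> x + t *\<^sub>R d \<in> Rn n"
  by (intro Rn_closed)

lemma line_has_derivative:
  fixes x d :: fsvec shows "((\<lambda>t. x + t *\<^sub>R d) has_derivative (\<lambda>h. h *\<^sub>R d)) (at t)"
  by (auto intro!: derivative_eq_intros)

lemma phi_along_line:
  assumes "x \<in> Rn n" "d \<in> Rn n"
  shows "((\<lambda>t. \<phi> (x + t *\<^sub>R d)) has_real_derivative G (x + t *\<^sub>R d) \<bullet> d) (at t)"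
proof -
  have "(\<phi> has_derivative (\<lambda>h. G (x + t *\<^sub>R d) \<bullet> h)) (at (x + t *\<^sub>R d) within range (\<lambda>t. x + t *\<^sub>R d))"
    using line_Rn[OF assms] by (intro has_derivative_subset[OF phi_has_derivative]) blast+
  from has_derivative_in_compose[OF line_has_derivative this]
  have "((\<lambda>t. \<phi> (x + t *\<^sub>R d)) has_derivative (\<lambda>h. G (x + t *\<^sub>R d) \<bullet> (h *\<^sub>R d))) (at t)" .
  then show ?thesis by (simp add: has_field_derivative_def mult_commute_abs)
qed

lemma G_along_line:
  assumes "x \<in> Rn n" "d \<in> Rn n"
  shows "((\<lambda>t. G (x + t *\<^sub>R d) \<bullet> w) has_real_derivative blinfun_apply (H (x + t *\<^sub>R d)) d \<bullet> w) (at t)"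
proof -
  have "(G has_derivative blinfun_apply (H (x + t *\<^sub>R d))) (at (x + t *\<^sub>R d) within range (\<lambda>t. x + t *\<^sub>R d))"
    using line_Rn[OF assms] by (intro has_derivative_subset[OF G_has_derivative]) blast+
  from has_derivative_in_compose[OF line_has_derivative this]
  have "((\<lambda>t. G (x + t *\<^sub>R d)) has_derivative (\<lambda>h. blinfun_apply (H (x + t *\<^sub>R d)) (h *\<^sub>R d))) (at t)" .
  then have "((\<lambda>t. G (x + t *\<^sub>R d) \<bullet> w) has_derivative (\<lambda>h. blinfun_apply (H (x + t *\<^sub>R d)) (h *\<^sub>R d) \<bullet> w)) (at t)"
    by (rule has_derivative_inner_left)
  then show ?thesis
    by (simp add: has_field_derivative_def blinfun.scaleR_right mult_commute_abs)
qed

text \<open>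
  The set \<open>N\<close> need not be convex, so a segment between two of its points may leave it. Taylor
  expansions are therefore only used for steps from the level set that are shorter than the distance
  \<open>\<delta>\<close> of the level set from the complement of \<open>N\<close>; such segments stay in \<open>N\<close>.
\<close>

lemma level_neighbourhood: "\<exists>\<delta>>0. \<forall>x\<in>S. \<forall>d\<in>Rn n. norm d < \<delta> \<longrightarrow> x + d \<in> N"
proof -
  obtain T where T: "open T" "N = T \<inter> Rn n"
    using openin_N by (auto simp: openin_open)
  then obtain e where e: "e > 0" "(\<Union>x\<in>S. ball x e) \<subseteq> T"
    using compact_subset_open_imp_ball_epsilon_subset[of S T] compact_level level_N by blast
  have "x + d \<in> N" if "x \<in> S" "d \<in> Rn n" "norm d < e" for x d
    using that e(2) T(2) S_Rn by (force simp: dist_norm)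
  with e(1) show ?thesis by blast
qed

definition \<delta> :: real
  where "\<delta> = (SOME \<delta>. \<delta> > 0 \<and> (\<forall>x\<in>S. \<forall>d\<in>Rn n. norm d < \<delta> \<longrightarrow> x + d \<in> N))"

lemma \<delta>_pos: "\<delta> > 0"
  and near_level: "x \<in> S \<Longrightarrow> d \<in> Rn n \<Longrightarrow> norm d < \<delta> \<Longrightarrow> x + d \<in> N"
  using someI_ex[OF level_neighbourhood] unfolding \<delta>_def[symmetric] by simp_all

lemma Hessian_diff:
  assumes "x \<in> S" "d \<in> Rn n" "norm d < \<delta>"
  shows "norm (blinfun_apply (H (x + d)) v - blinfun_apply (H x) v) \<le> L * norm d * norm v"
proof -
  have "x + d \<in> N" "x \<in> N" using assms near_level level_N by auto
  then have "norm (H (x + d) - H x) \<le> L * norm d"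
    using lipschitz_onD[OF lipschitz, of "x + d" x] by (simp add: dist_norm)
  then have "norm (H (x + d) - H x) * norm v \<le> L * norm d * norm v"
    by (rule mult_right_mono) simp
  then show ?thesis
    using norm_blinfun[of "H (x + d) - H x" v] by (simp add: blinfun.diff_left)
qed

text \<open>
  The mean value theorem is applied to the component of the gradient along the remainder \<open>w\<close>
  itself, which turns a bound on one component into a bound on the norm.
\<close>

lemma gradient_taylor:
  assumes "x \<in> S" "d \<in> Rn n" "norm d < \<delta>"
  shows "norm (G (x + d) - G x - blinfun_apply (H x) d) \<le> L * (norm d)\<^sup>2"
proof -
  \<comment> \<open>\<open>f 1 - f 0\<close> is the squared norm of the remainder \<open>w\<close>.\<close>
  define w where "w = G (x + d) - G x - blinfun_apply (H x) d"
  define f where "f t = G (x + t *\<^sub>R d) \<bullet> w - t * (blinfun_apply (H x) d \<bullet> w)" for t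
  have xR: "x \<in> Rn n" using assms S_Rn by auto
  have "(f has_real_derivative (blinfun_apply (H (x + t *\<^sub>R d)) d \<bullet> w - blinfun_apply (H x) d \<bullet> w)) (at t)" for t
    unfolding f_def by (rule derivative_eq_intros G_along_line[OF xR assms(2)] refl | simp)+
  from MVT2[of 0 1 f, OF _ this] obtain t where t: "0 < t" "t < 1"
    and eq: "f 1 - f 0 = (blinfun_apply (H (x + t *\<^sub>R d)) d - blinfun_apply (H x) d) \<bullet> w"
    by (auto simp: inner_diff_left)
  have td: "norm (t *\<^sub>R d) \<le> norm d" using t by (simp add: mult_left_le_one_le)
  have "(norm w)\<^sup>2 = f 1 - f 0"
    by (simp add: f_def w_def power2_norm_eq_inner inner_diff_left)
  also have "\<dots> \<le> norm (blinfun_apply (H (x + t *\<^sub>R d)) d - blinfun_apply (H x) d) * norm w"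
    unfolding eq by (rule norm_cauchy_schwarz)
  also have "\<dots> \<le> (L * norm (t *\<^sub>R d) * norm d) * norm w"
    by (intro mult_right_mono Hessian_diff) (use assms td in auto)
  also have "\<dots> \<le> (L * norm d * norm d) * norm w"
    using td L_pos by (intro mult_right_mono mult_left_mono) auto
  finally have "norm w * norm w \<le> (L * (norm d)\<^sup>2) * norm w"
    by (simp add: power2_eq_square mult.assoc)
  then have "norm w \<le> L * (norm d)\<^sup>2"
    using L_pos by (cases "norm w = 0") (auto dest: mult_right_le_imp_le)
  then show ?thesis by (simp add: w_def)
qed

text \<open>
  The factor \<open>1/2\<close> has to be exact, since the line searches compare it with the parameter
  \<open>\<mu> < 1/2\<close>; of the cubic term only the order matters.
\<close>

lemma objective_taylor:
  assumes "x \<in> S" "d \<in> Rn n" "norm d < \<delta>"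
  shows "\<phi> (x + d) \<le> \<phi> x + G x \<bullet> d + 1/2 * (d \<bullet> blinfun_apply (H x) d) + L * (norm d) ^ 3"
proof -
  define f where "f t = \<phi> (x + t *\<^sub>R d) - t * (G x \<bullet> d) - t\<^sup>2 / 2 * (d \<bullet> blinfun_apply (H x) d) - t * (L * (norm d) ^ 3)" for t
  have xR: "x \<in> Rn n" using assms S_Rn by auto
  have "f 1 \<le> f 0"
  proof (rule DERIV_nonpos_imp_nonincreasing[of 0 1 f])
    fix t :: real assume t: "0 \<le> t" "t \<le> 1"
    let ?y = "G (x + t *\<^sub>R d) \<bullet> d - G x \<bullet> d - t * (d \<bullet> blinfun_apply (H x) d) - L * (norm d) ^ 3"
    have "(f has_real_derivative ?y) (at t)"
      unfolding f_def
      by (rule derivative_eq_intros phi_along_line[OF xR assms(2)] refl | simp)+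
    moreover have "?y \<le> 0"
    proof -
      have td: "norm (t *\<^sub>R d) \<le> norm d" using t by (simp add: mult_left_le_one_le)
      have "G (x + t *\<^sub>R d) \<bullet> d - G x \<bullet> d - t * (d \<bullet> blinfun_apply (H x) d)
          = (G (x + t *\<^sub>R d) - G x - blinfun_apply (H x) (t *\<^sub>R d)) \<bullet> d"
        by (simp add: inner_diff_left inner_diff_right blinfun.scaleR_right inner_commute[of _ d])
      also have "\<dots> \<le> norm (G (x + t *\<^sub>R d) - G x - blinfun_apply (H x) (t *\<^sub>R d)) * norm d"
        by (rule norm_cauchy_schwarz)
      also have "\<dots> \<le> (L * (norm (t *\<^sub>R d))\<^sup>2) * norm d"
        by (intro mult_right_mono gradient_taylor) (use assms td in auto)
      also have "\<dots> \<le> (L * (norm d)\<^sup>2) * norm d"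
        using td L_pos by (intro mult_right_mono mult_left_mono power_mono) auto
      finally show ?thesis by (simp add: power2_eq_square power3_eq_cube mult.assoc)
    qed
    ultimately show "\<exists>y. (f has_real_derivative y) (at t) \<and> y \<le> 0" by blast
  qed simp
  then show ?thesis by (simp add: f_def)
qed

text \<open>
  Symmetry of the Hessian is read off the second difference of the objective, which is symmetric in
  \<open>u\<close> and \<open>v\<close>: along \<open>u\<close> the mean value theorem reduces it to a difference of gradients, and
  that is \<open>t\<close> times the Hessian applied to \<open>v\<close> up to second order.
\<close>

lemma second_difference_bound:
  assumes x: "x \<in> S" and u: "u \<in> Rn n" and v: "v \<in> Rn n" and t: "0 < t"
    and small: "t * (norm u + norm v) < \<delta>"
  shows "\<bar>\<phi> (x + t *\<^sub>R u + t *\<^sub>R v) - \<phi> (x + t *\<^sub>R u) - \<phi> (x + t *\<^sub>R v) + \<phi> x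
          - t\<^sup>2 * (blinfun_apply (H x) v \<bullet> u)\<bar> \<le> 2 * L * (t * (norm u + norm v))\<^sup>2 * (t * norm u)"
proof -
  have xR: "x \<in> Rn n" using x S_Rn by auto
  define f where "f s = \<phi> ((x + t *\<^sub>R v) + s *\<^sub>R u) - \<phi> (x + s *\<^sub>R u)" for s
  have "(f has_real_derivative (G ((x + t *\<^sub>R v) + s *\<^sub>R u) \<bullet> u - G (x + s *\<^sub>R u) \<bullet> u)) (at s)" for s
    unfolding f_def by (intro DERIV_diff phi_along_line) (use xR u v in auto)
  from MVT2[of 0 t f, OF t this] obtain s where s: "0 < s" "s < t"
    and eq: "f t - f 0 = t * ((G (x + t *\<^sub>R v + s *\<^sub>R u) - G (x + s *\<^sub>R u)) \<bullet> u)"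
    by (auto simp: inner_diff_left)
  let ?a = "t *\<^sub>R v + s *\<^sub>R u" and ?b = "s *\<^sub>R u" and ?R = "t * (norm u + norm v)"
  have su: "norm ?b \<le> t * norm u" using s by (simp add: mult_right_mono)
  have na: "norm ?a \<le> ?R"
  proof -
    have "norm ?a \<le> norm (t *\<^sub>R v) + norm ?b" by (rule norm_triangle_ineq)
    then show ?thesis using su t by (simp add: algebra_simps)
  qed
  have "0 \<le> t * norm v" using t by simp
  then have nb: "norm ?b \<le> ?R" using su by (simp add: distrib_left)
  have aR: "?a \<in> Rn n" and bR: "?b \<in> Rn n" using u v by auto
  define e where "e = (G (x + ?a) - G x - blinfun_apply (H x) ?a) - (G (x + ?b) - G x - blinfun_apply (H x) ?b)"
  have "norm e \<le> L * (norm ?a)\<^sup>2 + L * (norm ?b)\<^sup>2"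
    unfolding e_def using x aR bR na nb small
    by (intro order_trans[OF norm_triangle_ineq4] add_mono gradient_taylor) auto
  also have "\<dots> \<le> L * ?R\<^sup>2 + L * ?R\<^sup>2"
    using na nb L_pos by (intro add_mono mult_left_mono power_mono) auto
  finally have e: "norm e \<le> 2 * L * ?R\<^sup>2" by simp
  have "G (x + t *\<^sub>R v + s *\<^sub>R u) - G (x + s *\<^sub>R u) = e + t *\<^sub>R blinfun_apply (H x) v"
    by (simp add: e_def blinfun.add_right blinfun.scaleR_right add.assoc)
  then have "f t - f 0 - t\<^sup>2 * (blinfun_apply (H x) v \<bullet> u) = t * (e \<bullet> u)"
    unfolding eq by (simp add: inner_add_left power2_eq_square algebra_simps)
  also have "\<bar>\<dots>\<bar> \<le> t * (norm e * norm u)"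
    using t Cauchy_Schwarz_ineq2[of e u] by (simp add: abs_mult)
  also have "\<dots> \<le> t * ((2 * L * ?R\<^sup>2) * norm u)"
    using t e by (intro mult_left_mono mult_right_mono) auto
  finally have "\<bar>f t - f 0 - t\<^sup>2 * (blinfun_apply (H x) v \<bullet> u)\<bar> \<le> 2 * L * ?R\<^sup>2 * (t * norm u)"
    by (simp only: mult.left_commute mult.assoc)
  moreover have "f t - f 0 = \<phi> (x + t *\<^sub>R u + t *\<^sub>R v) - \<phi> (x + t *\<^sub>R u) - \<phi> (x + t *\<^sub>R v) + \<phi> x"
    by (simp add: f_def add.assoc add.commute[of "t *\<^sub>R v"])
  ultimately show ?thesis by simp
qed

lemma Hessian_symmetric:
  assumes x: "x \<in> S" and u: "u \<in> Rn n" and v: "v \<in> Rn n"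
  shows "blinfun_apply (H x) v \<bullet> u = v \<bullet> blinfun_apply (H x) u"
proof -
  let ?D = "\<bar>blinfun_apply (H x) v \<bullet> u - v \<bullet> blinfun_apply (H x) u\<bar>"
  define A where "A = norm u + norm v"
  define K where "K = 4 * L * A ^ 3"
  have A: "A \<ge> 0" by (simp add: A_def)
  \<comment> \<open>Up to a multiple of \<open>t ^ 3\<close>, the second difference is \<open>t\<^sup>2\<close> times either side.\<close>
  have bound: "?D \<le> K * t" if t: "0 < t" "t * A < \<delta>" for t
  proof -
    let ?B = "2 * L * (t * A)\<^sup>2 * (t * A)"
    define Q where "Q = \<phi> (x + t *\<^sub>R u + t *\<^sub>R v) - \<phi> (x + t *\<^sub>R u) - \<phi> (x + t *\<^sub>R v) + \<phi> x"
    have B: "2 * L * (t * A)\<^sup>2 * (t * norm w) \<le> ?B" if "norm w \<le> A" for w :: fsvec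
      using that t L_pos by (intro mult_left_mono) auto
    have 1: "\<bar>Q - t\<^sup>2 * (blinfun_apply (H x) v \<bullet> u)\<bar> \<le> ?B"
      using second_difference_bound[OF x u v t(1) t(2)[unfolded A_def]] B[of u]
      unfolding A_def[symmetric] Q_def[symmetric] by (simp add: A_def)
    have swap: "x + t *\<^sub>R v + t *\<^sub>R u = x + t *\<^sub>R u + t *\<^sub>R v" by (simp add: ac_simps)
    have "Q = \<phi> (x + t *\<^sub>R v + t *\<^sub>R u) - \<phi> (x + t *\<^sub>R v) - \<phi> (x + t *\<^sub>R u) + \<phi> x"
      unfolding Q_def swap by simp
    then have 2: "\<bar>Q - t\<^sup>2 * (v \<bullet> blinfun_apply (H x) u)\<bar> \<le> ?B"
      using second_difference_bound[OF x v u t(1)] t(2) B[of v]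
      by (simp add: A_def add.commute[of "norm v"] inner_commute[of v])
    have "t\<^sup>2 * ?D = \<bar>t\<^sup>2 * (blinfun_apply (H x) v \<bullet> u) - t\<^sup>2 * (v \<bullet> blinfun_apply (H x) u)\<bar>"
      by (simp only: right_diff_distrib[symmetric] abs_mult abs_power2)
    also have "\<dots> \<le> 2 * ?B" using 1 2 by linarith
    also have "\<dots> = t\<^sup>2 * (K * t)" by (simp add: K_def power2_eq_square power3_eq_cube)
    finally show ?thesis using t by simp
  qed
  have "?D \<le> 0"
  proof (rule tendsto_lowerbound)
    show "((\<lambda>t. K * t) \<longlongrightarrow> 0) (at_right 0)" by (auto intro!: tendsto_eq_intros)
    have "eventually (\<lambda>t. t * A < \<delta>) (at_right 0)"
      by (rule order_tendstoD(2)[of _ 0]) (auto intro!: tendsto_eq_intros simp: \<delta>_pos)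
    then show "eventually (\<lambda>t. ?D \<le> K * t) (at_right 0)"
      using eventually_at_right_less[of "0::real"] by eventually_elim (use bound in auto)
  qed simp
  then show ?thesis by simp
qed

end

section \<open>Outputs of capped conjugate gradients\<close>

lemma cg_Hbar_add: "cg_Hbar A \<rho> (u + v) = cg_Hbar A \<rho> u + cg_Hbar A \<rho> v"
  and cg_Hbar_scaleR: "cg_Hbar A \<rho> (c *\<^sub>R u) = c *\<^sub>R cg_Hbar A \<rho> u"
  and cg_Hbar_diff: "cg_Hbar A \<rho> (u - v) = cg_Hbar A \<rho> u - cg_Hbar A \<rho> v"
  and cg_Hbar_minus: "cg_Hbar A \<rho> (- u) = - cg_Hbar A \<rho> u"
  and cg_Hbar_zero: "cg_Hbar A \<rho> 0 = 0"
  by (simp_all add: cg_Hbar_def blinfun.add_right blinfun.scaleR_right blinfun.diff_right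
      blinfun.minus_right blinfun.zero_right algebra_simps)

lemma cg_start [simp]: "cg_y A g \<rho> 0 = 0" "cg_r A g \<rho> 0 = g" "cg_p A g \<rho> 0 = - g"
  by (simp_all add: cg_y_def cg_r_def cg_p_def)

lemma cg_step:
  fixes A g \<rho> k
  defines "p \<equiv> cg_p A g \<rho> k" and "r \<equiv> cg_r A g \<rho> k" and "r' \<equiv> cg_r A g \<rho> (Suc k)"
  defines "\<alpha> \<equiv> (norm r)\<^sup>2 / (p \<bullet> cg_Hbar A \<rho> p)"
  shows "cg_y A g \<rho> (Suc k) = cg_y A g \<rho> k + \<alpha> *\<^sub>R p"
    and "r' = r + \<alpha> *\<^sub>R cg_Hbar A \<rho> p"
    and "cg_p A g \<rho> (Suc k) = - r' + ((norm r')\<^sup>2 / (norm r)\<^sup>2) *\<^sub>R p"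
  unfolding assms cg_y_def cg_r_def cg_p_def by (simp_all add: Let_def split: prod.split)

lemma cg_residual: "cg_r A g \<rho> k = g + cg_Hbar A \<rho> (cg_y A g \<rho> k)"
  by (induction k) (simp_all add: cg_step(1,2) cg_Hbar_add cg_Hbar_scaleR cg_Hbar_zero)

lemma cg_Rn:
  assumes "g \<in> Rn n" "\<And>v. v \<in> Rn n \<Longrightarrow> blinfun_apply A v \<in> Rn n"
  shows "cg_y A g \<rho> k \<in> Rn n" "cg_r A g \<rho> k \<in> Rn n" "cg_p A g \<rho> k \<in> Rn n"
proof -
  have A: "cg_Hbar A \<rho> v \<in> Rn n" if "v \<in> Rn n" for v
    unfolding cg_Hbar_def using assms(2)[OF that] that by (intro Rn_closed)
  have "cg_y A g \<rho> k \<in> Rn n \<and> cg_r A g \<rho> k \<in> Rn n \<and> cg_p A g \<rho> k \<in> Rn n"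
  proof (induction k)
    case 0
    then show ?case using assms(1) Rn_closed(1,5) by auto
  next
    case (Suc k)
    then have "cg_r A g \<rho> (Suc k) \<in> Rn n"
      by (simp add: cg_step(2) A Rn_closed)
    with Suc show ?case by (simp add: cg_step(1,3) Rn_closed)
  qed
  then show "cg_y A g \<rho> k \<in> Rn n" "cg_r A g \<rho> k \<in> Rn n" "cg_p A g \<rho> k \<in> Rn n" by auto
qed

lemma cg_ratio_nonneg: "0 \<le> cg_ratio A v"
  and cg_ratio_le: "cg_ratio A v \<le> norm A"
  using norm_blinfun[of A v] by (auto simp: cg_ratio_def divide_simps mult.commute)

lemma cg_N_bounds: "cg_ratio A g \<le> cg_N A g \<rho> k" "cg_N A g \<rho> k \<le> norm A"
proof -
  have "cg_ratio A (- g) = cg_ratio A g" by (simp add: cg_ratio_def blinfun.minus_right)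
  then show "cg_ratio A g \<le> cg_N A g \<rho> k" "cg_N A g \<rho> k \<le> norm A"
    by (induction k) (auto simp: cg_ratio_le le_max_iff_disj)
qed

lemma cg_N_nonneg: "0 \<le> cg_N A g \<rho> k"
  using cg_N_bounds(1) cg_ratio_nonneg order_trans by blast

lemma cg_N_iterate: "norm (blinfun_apply A (cg_y A g \<rho> (Suc k))) \<le> cg_N A g \<rho> (Suc k) * norm (cg_y A g \<rho> (Suc k))"
proof (cases "cg_y A g \<rho> (Suc k) = 0")
  case False
  have "cg_ratio A (cg_y A g \<rho> (Suc k)) \<le> cg_N A g \<rho> (Suc k)" by simp
  with False show ?thesis by (simp add: cg_ratio_def pos_divide_le_eq del: cg_N.simps)
qed (simp add: blinfun.zero_right)

lemma capped_cg_SOL_iterate: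
  assumes "capped_cg A g \<rho> \<xi> \<rho>bar (SOL, d)"
  obtains k where "d = cg_y A g \<rho> (Suc k)" "\<not> low_curv A \<rho> d" "cg_solved A g \<rho> \<xi> (Suc k)"
proof -
  obtain k where k: "k \<ge> 1" "cg_returns A g \<rho> \<xi> \<rho>bar k (SOL, d)"
    using assms by (auto simp: capped_cg_def split: if_splits)
  then have "d = cg_y A g \<rho> k" "\<not> low_curv A \<rho> d" "cg_solved A g \<rho> \<xi> k"
    by (auto simp: cg_returns_def split: if_splits)
  with k(1) that[of "k - 1"] show thesis by simp
qed

text \<open>
  Together with \<open>capped_cg_NC\<close> this is all that the global analysis needs to know of a CG
  output. The residual is tested against \<open>\<xi> / (3 * \<kappa>)\<close> times the norm of the gradient, and the
  gradient is at most \<open>\<kappa> * \<rho> * norm d\<close> plus the residual; with \<open>\<kappa> \<ge> 2\<close> and \<open>\<xi> \<le> 1\<close>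
  this leaves the factor \<open>2/5\<close>.
\<close>

lemma capped_cg_SOL:
  assumes cg: "capped_cg A g \<rho> \<xi> \<rho>bar (SOL, d)" and \<rho>: "\<rho> > 0" and \<xi>: "0 \<le> \<xi>" "\<xi> \<le> 1"
  shows "norm (g + cg_Hbar A \<rho> d) \<le> 2/5 * \<rho> * norm d"
    and "\<rho> * (norm d)\<^sup>2 \<le> d \<bullet> cg_Hbar A \<rho> d"
proof -
  obtain k where d: "d = cg_y A g \<rho> (Suc k)" and curv: "\<not> low_curv A \<rho> d"
    and solved: "cg_solved A g \<rho> \<xi> (Suc k)"
    using capped_cg_SOL_iterate[OF cg] .
  show "\<rho> * (norm d)\<^sup>2 \<le> d \<bullet> cg_Hbar A \<rho> d" using curv by (simp add: low_curv_def)
  define \<kappa> where "\<kappa> = cg_kappa A g \<rho> (Suc k)"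
  define r where "r = g + cg_Hbar A \<rho> d"
  have N: "\<kappa> * \<rho> = cg_N A g \<rho> (Suc k) + 2 * \<rho>" using \<rho> by (simp add: \<kappa>_def cg_kappa_def)
  have \<kappa>: "\<kappa> \<ge> 2"
    using \<rho> cg_N_nonneg[of A g \<rho> "Suc k"] by (simp add: \<kappa>_def cg_kappa_def divide_simps)
  have "norm (cg_Hbar A \<rho> d) \<le> norm (blinfun_apply A d) + 2 * \<rho> * norm d"
    unfolding cg_Hbar_def using norm_triangle_ineq[of "blinfun_apply A d" "(2 * \<rho>) *\<^sub>R d"] \<rho> by simp
  also have "\<dots> \<le> \<kappa> * \<rho> * norm d"
    using cg_N_iterate[of A g \<rho> k] by (simp add: N d distrib_right)
  finally have Hd: "norm (cg_Hbar A \<rho> d) \<le> \<kappa> * \<rho> * norm d" .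
  have "norm g \<le> norm (cg_Hbar A \<rho> d) + norm r"
    using norm_triangle_ineq4[of r "cg_Hbar A \<rho> d"] by (simp add: r_def)
  then have g: "norm g \<le> \<kappa> * \<rho> * norm d + norm r" using Hd by linarith
  have "norm r \<le> \<xi> / (3 * \<kappa>) * norm g"
    using solved by (simp add: cg_solved_def r_def d cg_residual[of _ _ _ "Suc k"] \<kappa>_def)
  then have "3 * \<kappa> * norm r \<le> \<xi> * norm g" using \<kappa> by (simp add: field_simps)
  also have "\<dots> \<le> 1 * (\<kappa> * \<rho> * norm d + norm r)"
    using g \<xi> by (intro mult_mono) auto
  finally have "(3 * \<kappa> - 1) * norm r \<le> \<kappa> * \<rho> * norm d" by (simp add: algebra_simps)
  moreover have "(5/2 * \<kappa>) * norm r \<le> (3 * \<kappa> - 1) * norm r"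
    using \<kappa> by (intro mult_right_mono) auto
  ultimately have "\<kappa> * (5/2 * norm r) \<le> \<kappa> * (\<rho> * norm d)" by (simp add: algebra_simps)
  then have "5/2 * norm r \<le> \<rho> * norm d" using \<kappa> by simp
  then show "norm (g + cg_Hbar A \<rho> d) \<le> 2/5 * \<rho> * norm d" by (simp add: r_def)
qed

lemma capped_cg_NC: "capped_cg A g \<rho> \<xi> \<rho>bar (NC, d) \<Longrightarrow> low_curv A \<rho> d"
  by (auto simp: capped_cg_def cg_returns_def split: if_splits)

lemma capped_cg_Rn:
  assumes "capped_cg A g \<rho> \<xi> \<rho>bar (ty, d)" "g \<in> Rn n" "\<And>v. v \<in> Rn n \<Longrightarrow> blinfun_apply A v \<in> Rn n"
  shows "d \<in> Rn n"
proof -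
  have "d = cg_p A g \<rho> 0 \<or> (\<exists>k. d = cg_y A g \<rho> k \<or> d = cg_p A g \<rho> k \<or> (\<exists>i. d = cg_y A g \<rho> (Suc k) - cg_y A g \<rho> i))"
    using assms(1) unfolding capped_cg_def cg_returns_def by (auto simp del: cg_start split: if_splits)
  then show ?thesis using cg_Rn[OF assms(2,3)] Rn_closed(3) by metis
qed

section \<open>Outcomes of a Newton step\<close>

lemma first_upto_Some:
  assumes "first_upto b Q = Some m"
  shows "real m \<le> b" "Q m" "\<And>j. j < m \<Longrightarrow> \<not> Q j"
proof -
  from assms obtain k where k: "real k \<le> b" "Q k" and m: "m = (LEAST m. Q m)"
    by (auto simp: first_upto_def split: if_splits)
  show "Q m" unfolding m using k(2) by (rule LeastI)
  show "real m \<le> b" using Least_le[of Q k] k m by simp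
  show "\<not> Q j" if "j < m" for j using that not_less_Least m by blast
qed

lemma first_upto_None: "first_upto b Q = None \<longleftrightarrow> (\<forall>m. real m \<le> b \<longrightarrow> \<not> Q m)"
  by (auto simp: first_upto_def)

text \<open>
  The five ways in which a Newton step can end: a step size accepted by (LS1), one accepted by (LS2),
  neither, and success or failure of the search along a negative curvature direction.
\<close>

lemma newton_resultE:
  assumes "newton_result P \<phi> G H x \<omega> M \<omega>bar (ty, dt) = Some (x', M')"
  obtains
    (armijo) m where "ty = SOL" "armijo P \<phi> G x dt 1 m" "\<And>j. j < m \<Longrightarrow> \<not> armijo P \<phi> G x dt 1 j"
      "x' = x + (beta P ^ m) *\<^sub>R dt"
      "M' = new_M P SOL (m = 0) (\<phi> x - \<phi> x') (norm (G x')) \<omega> M \<omega>bar"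
  | (short_armijo) m where "ty = SOL" "\<And>j. real j \<le> m_max P \<Longrightarrow> \<not> armijo P \<phi> G x dt 1 j"
      "armijo P \<phi> G x dt (sol_alpha dt \<omega> M) m"
      "\<And>j. j < m \<Longrightarrow> \<not> armijo P \<phi> G x dt (sol_alpha dt \<omega> M) j"
      "x' = x + (sol_alpha dt \<omega> M * beta P ^ m) *\<^sub>R dt"
      "M' = new_M P SOL False (\<phi> x - \<phi> x') (norm (G x')) \<omega> M \<omega>bar"
  | (no_armijo) "ty = SOL" "\<And>j. real j \<le> m_max P \<Longrightarrow> \<not> armijo P \<phi> G x dt 1 j"
      "\<And>j. real j \<le> m_max P \<Longrightarrow> \<not> armijo P \<phi> G x dt (sol_alpha dt \<omega> M) j" "x' = x" "M' = gam P * M"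
  | (curvature) m where "ty = NC" "nc_decrease P \<phi> x (nc_direction G H x M dt) M m"
      "\<And>j. j < m \<Longrightarrow> \<not> nc_decrease P \<phi> x (nc_direction G H x M dt) M j"
      "x' = x + (beta P ^ m) *\<^sub>R nc_direction G H x M dt"
      "M' = new_M P NC False (\<phi> x - \<phi> x') (norm (G x')) \<omega> M \<omega>bar"
  | (no_curvature) "ty = NC" "\<And>j. real j \<le> m_max P \<Longrightarrow> \<not> nc_decrease P \<phi> x (nc_direction G H x M dt) M j"
      "x' = x" "M' = gam P * M"
proof (cases ty)
  case SOL
  show thesis
  proof (cases "first_upto (m_max P) (armijo P \<phi> G x dt 1)")
    case (Some m)
    then show thesis
      using assms SOL first_upto_Some[OF Some]
      by (intro armijo[of m]) (auto simp: newton_result_def accept_step_def Let_def)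
  next
    case None
    show thesis
    proof (cases "first_upto (m_max P) (armijo P \<phi> G x dt (sol_alpha dt \<omega> M))")
      case (Some m)
      then show thesis
        using assms SOL first_upto_Some[OF Some] None[unfolded first_upto_None] None
        by (intro short_armijo[of m]) (auto simp: newton_result_def accept_step_def Let_def)
    next
      case 2: None
      then show thesis
        using assms SOL 2[unfolded first_upto_None] None[unfolded first_upto_None] None
        by (intro no_armijo) (auto simp: newton_result_def)
    qed
  qed
next
  case NC
  show thesis
  proof (cases "first_upto (m_max P) (nc_decrease P \<phi> x (nc_direction G H x M dt) M)")
    case (Some m)
    then show thesis
      using assms NC first_upto_Some[OF Some]
      by (intro curvature[of m]) (auto simp: newton_result_def accept_step_def Let_def)
  next
    case None
    then show thesis
      using assms NC None[unfolded first_upto_None] None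
      by (intro no_curvature) (auto simp: newton_result_def)
  qed
next
  case TERMINATED
  then show thesis using assms by (simp add: newton_result_def)
qed

text \<open>
  A common lower bound, up to the factor \<open>M powr (-1/2)\<close>, of all thresholds for the decrease
  of the objective in the update of the estimate.
\<close>

definition decrease_const :: "arncg_params \<Rightarrow> real"
  where "decrease_const P = 4/33 * mu P * tau_minus P * tau_plus P * (beta P)\<^sup>2 * (1 - 2 * mu P)\<^sup>2"

lemma decrease_const_pos: "valid_params P \<Longrightarrow> decrease_const P > 0"
  by (auto simp: decrease_const_def valid_params_def)

lemma powr_neg_half: "M > 0 \<Longrightarrow> M powr (-1/2) = 1 / sqrt (M::real)"
  using powr_minus[of M "1/2"] powr_half_sqrt[of M] by (simp add: inverse_eq_divide)

lemma decrease_const_le: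
  assumes "valid_params P"
  shows "decrease_const P \<le> 4/33 * mu P * tau_minus P" "decrease_const P \<le> mu P * tau_minus P"
    "decrease_const P \<le> 4/33 * mu P * tau_plus P" "decrease_const P \<le> tau_plus P * beta P * mu P"
    "decrease_const P \<le> tau_plus P * (1 - 2 * mu P)\<^sup>2 * (beta P)\<^sup>2 * mu P"
proof -
  note v = assms[unfolded valid_params_def]
  define a b c where "a = tau_minus P" and "b = tau_plus P" and "c = (1 - 2 * mu P)\<^sup>2"
  have c: "0 < c" "c \<le> 1" using v by (auto simp: c_def power_le_one_iff)
  have a: "0 < a" "a \<le> 1" and b: "0 < b" "b \<le> 1" and m: "0 < mu P" using v by (auto simp: a_def b_def)
  have B: "0 < beta P" "beta P \<le> 1" "(beta P)\<^sup>2 \<le> 1" "(beta P)\<^sup>2 \<le> beta P"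
    using v by (auto simp: power_le_one power2_eq_square mult_left_le mult_le_one)
  have D: "decrease_const P = 4/33 * (mu P * a * b * (beta P)\<^sup>2 * c)" by (simp add: decrease_const_def a_def b_def c_def)
  have le: "x * y \<le> x" if "0 \<le> x" "y \<le> 1" for x y :: real using that mult_left_le[of y x] by simp
  have "mu P * a * b * (beta P)\<^sup>2 * c \<le> mu P * a * b * (beta P)\<^sup>2"
    using a b c m B by (intro le) auto
  also have "\<dots> \<le> mu P * a * b" using a b m B by (intro le) auto
  also have abm: "mu P * a * b \<le> mu P * a" using a b m by (intro le) auto
  finally have 1: "mu P * a * b * (beta P)\<^sup>2 * c \<le> mu P * a" .
  show "decrease_const P \<le> 4/33 * mu P * tau_minus P" using 1 unfolding D a_def[symmetric] by linarith
  have "mu P * a > 0" using m a by simp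
  then show "decrease_const P \<le> mu P * tau_minus P" using 1 unfolding D a_def[symmetric] by linarith
  have e: "mu P * a * b * (beta P)\<^sup>2 * c = (b * c * (beta P)\<^sup>2 * mu P) * a" by simp
  have 2: "mu P * a * b * (beta P)\<^sup>2 * c \<le> b * c * (beta P)\<^sup>2 * mu P"
    unfolding e using a b c m B by (intro le) auto
  moreover have "0 < b * c * (beta P)\<^sup>2 * mu P" using b c m B by simp
  ultimately show "decrease_const P \<le> tau_plus P * (1 - 2 * mu P)\<^sup>2 * (beta P)\<^sup>2 * mu P"
    unfolding D b_def[symmetric] c_def[symmetric] by linarith
  have "b * c * (beta P)\<^sup>2 * mu P = (b * (beta P)\<^sup>2 * mu P) * c" by simp
  also have "\<dots> \<le> b * (beta P)\<^sup>2 * mu P" using b c m B by (intro le) auto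
  also have "\<dots> \<le> b * beta P * mu P" using b m B by (intro mult_right_mono mult_left_mono) auto
  finally have 3: "mu P * a * b * (beta P)\<^sup>2 * c \<le> b * beta P * mu P" using 2 by linarith
  moreover have "0 < b * beta P * mu P" using b m B by simp
  ultimately show "decrease_const P \<le> tau_plus P * beta P * mu P" unfolding D b_def[symmetric] by linarith
  have "b * beta P * mu P \<le> mu P * b" using b m B le[of "mu P * b" "beta P"] by (simp add: ac_simps)
  then show "decrease_const P \<le> 4/33 * mu P * tau_plus P" using 3 unfolding D b_def[symmetric] by linarith
qed

lemma new_M_cases:
  assumes P: "valid_params P" and "M > 0" "\<omega> > 0" "\<omega>bar > 0" and ty: "ty \<noteq> TERMINATED"
  shows "new_M P ty full \<Delta> gp \<omega> M \<omega>bar = gam P * M \<or>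
    new_M P ty full \<Delta> gp \<omega> M \<omega>bar = M / gam P \<and> \<Delta> \<ge> decrease_const P / sqrt M * \<omega>bar ^ 3 \<or>
    new_M P ty full \<Delta> gp \<omega> M \<omega>bar = M \<and> \<Delta> \<ge> decrease_const P / sqrt M * min (gp\<^sup>2 / \<omega>) (\<omega> ^ 3)"
proof -
  let ?s = "1 / sqrt M"
  have down: "decrease_const P / sqrt M * \<omega>bar ^ 3 \<le> c * ?s * \<omega>bar ^ 3" if "decrease_const P \<le> c" for c
    using that assms by (intro mult_right_mono) (auto simp: divide_right_mono)
  have m: "0 \<le> min (gp\<^sup>2 / \<omega>) (\<omega> ^ 3)" using assms by simp
  have same1: "decrease_const P / sqrt M * min (gp\<^sup>2 / \<omega>) (\<omega> ^ 3) \<le> c * ?s * min (gp\<^sup>2 / \<omega>) (\<omega> ^ 3)"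
    if "decrease_const P \<le> c" for c
    using that assms m by (intro mult_right_mono) (auto simp: divide_right_mono)
  have same2: "decrease_const P / sqrt M * min (gp\<^sup>2 / \<omega>) (\<omega> ^ 3) \<le> c * ?s * \<omega> ^ 3"
    if "decrease_const P \<le> c" for c
  proof -
    have "0 \<le> c" using that decrease_const_pos[OF P] by simp
    then have "c * ?s * min (gp\<^sup>2 / \<omega>) (\<omega> ^ 3) \<le> c * ?s * \<omega> ^ 3"
      using assms by (intro mult_left_mono) auto
    then show ?thesis using same1[OF that] by linarith
  qed
  note le = decrease_const_le[OF P]
  have pw: "M powr (-1/2) = ?s" using powr_neg_half assms by blast
  define a1 a2 a3 a4 a5 d1 d2 where defs: "a1 = 4/33 * mu P * tau_plus P * ?s * min (gp\<^sup>2 / \<omega>) (\<omega> ^ 3)"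
    "a2 = 4/33 * mu P * tau_minus P * ?s * \<omega>bar ^ 3" "a3 = tau_plus P * beta P * mu P * ?s * \<omega> ^ 3"
    "a4 = tau_plus P * (1 - 2 * mu P)\<^sup>2 * (beta P)\<^sup>2 * mu P * ?s * \<omega> ^ 3"
    "a5 = mu P * tau_minus P * ?s * \<omega>bar ^ 3"
    "d1 = decrease_const P / sqrt M * \<omega>bar ^ 3" "d2 = decrease_const P / sqrt M * min (gp\<^sup>2 / \<omega>) (\<omega> ^ 3)"
  have e: "inverse (gam P) * M = M / gam P" "gp\<^sup>2 * inverse \<omega> = gp\<^sup>2 / \<omega>"
    by (simp_all add: divide_inverse)
  have le: "d1 \<le> a2" "d1 \<le> a5" "d2 \<le> a1" "d2 \<le> a3" "d2 \<le> a4"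
    unfolding defs by (intro down same1 same2 le)+
  have "new_M P ty full \<Delta> gp \<omega> M \<omega>bar =
      (if ty = SOL \<and> full then if \<Delta> \<le> a1 then gam P * M else if a2 \<le> \<Delta> then M / gam P else M
       else if ty = SOL \<and> \<Delta> \<le> a3 \<or> ty = NC \<and> \<Delta> \<le> a4 then gam P * M else if a5 \<le> \<Delta> then M / gam P else M)"
    unfolding new_M_def pw defs e by (rule refl)
  then show ?thesis
    unfolding defs(6,7)[symmetric] using ty le by (cases ty) (auto split: if_splits)
qed

section \<open>Line searches with a large estimate\<close>

locale arncg_problem = smooth_problem +
  fixes P :: arncg_params
  assumes P: "valid_params P"
begin

lemma param_facts:
  "0 < mu P" "mu P < 1/2" "0 < beta P" "beta P < 1" "1 < gam P" "0 < M_init P" "0 \<le> eta P" "eta P \<le> 1"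
  "0 \<le> m_max P" "0 < tau_plus P" "tau_plus P \<le> 1" "0 < tau P" "tau P \<le> 1"
  using P by (auto simp: valid_params_def)

lemma gradient_bound: "\<exists>U>0. \<forall>x\<in>S. norm (G x) \<le> U"
proof -
  have "compact (G ` S)"
    using compact_level S_Rn by (intro compact_continuous_image continuous_on_subset[OF continuous_G]) auto
  then show ?thesis using compact_imp_bounded by (fastforce simp: bounded_pos)
qed

lemma Hessian_bound: "\<exists>B>0. \<forall>x\<in>S. norm (H x) \<le> B"
proof -
  have "compact (H ` S)"
    using compact_level S_Rn by (intro compact_continuous_image continuous_on_subset[OF continuous_H]) auto
  then show ?thesis using compact_imp_bounded by (fastforce simp: bounded_pos)
qed

definition U where "U = (SOME U. U > 0 \<and> (\<forall>x\<in>S. norm (G x) \<le> U))"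
definition B where "B = (SOME B. B > 0 \<and> (\<forall>x\<in>S. norm (H x) \<le> B))"

lemma U: "U > 0" "x \<in> S \<Longrightarrow> norm (G x) \<le> U"
  using someI_ex[OF gradient_bound] unfolding U_def[symmetric] by auto

lemma B: "B > 0" "x \<in> S \<Longrightarrow> norm (H x) \<le> B"
  using someI_ex[OF Hessian_bound] unfolding B_def[symmetric] by auto

text \<open>
  The margin \<open>1/2 - \<mu>\<close> of the sufficient decrease condition, times the factor \<open>3/5 = 1 - 2/5\<close>
  that the inexact solution leaves of the slope.
\<close>

definition armijo_const where "armijo_const = 3/5 * (1/2 - mu P)"

lemma armijo_const_pos: "armijo_const > 0"
  using param_facts by (simp add: armijo_const_def)

text \<open>
  Above this value a step never increases the estimate. The summand with \<open>U\<close> makes every length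
  of order \<open>\<omega> / sqrt M\<close> shorter than \<open>\<delta>\<close>, the one with \<open>B\<close> does the same for
  negative curvature directions, and the summands with \<open>L\<close> make the Taylor remainders small in
  comparison with the regularization.
\<close>

definition M_large :: real
  where "M_large = 1 + 17 * U / \<delta>\<^sup>2 + 50 * L + 4 * L / armijo_const + B / \<delta>"

lemma M_large:
  assumes "M \<ge> M_large"
  shows "M > 0" "M * \<delta>\<^sup>2 > 17 * U" "M > 50 * L" "M * armijo_const > 4 * L" "M * \<delta> > B"
proof -
  have p: "0 < U / \<delta>\<^sup>2" "0 < L" "0 < L / armijo_const" "0 < B / \<delta>"
    using U(1) B(1) L_pos \<delta>_pos armijo_const_pos by auto
  have "M > 17 * U / \<delta>\<^sup>2" "M > 4 * L / armijo_const" "M > B / \<delta>"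
    using p assms by (simp_all add: M_large_def)
  then show "M * \<delta>\<^sup>2 > 17 * U" "M * armijo_const > 4 * L" "M * \<delta> > B"
    using \<delta>_pos armijo_const_pos by (simp_all add: pos_divide_less_eq)
  show "M > 0" "M > 50 * L" using p assms by (simp_all add: M_large_def)
qed

end

locale newton_direction = arncg_problem +
  fixes x :: fsvec and \<omega> M \<omega>bar :: real and ty :: cg_type and dt :: fsvec
  assumes x: "x \<in> S" and gx: "G x \<noteq> 0" and \<omega>: "0 < \<omega>" "\<omega> \<le> \<omega>bar" "\<omega>bar \<le> sqrt (norm (G x))"
    and M: "M > 0" and cg: "newton_cg P G H x \<omega> M \<omega>bar (ty, dt)"
begin

lemma xR: "x \<in> Rn n" using S_Rn[OF x] .

definition \<rho> where "\<rho> = sqrt M * \<omega>"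

lemma \<rho>_pos: "\<rho> > 0" using M \<omega> by (simp add: \<rho>_def)

lemma \<omega>_sq: "\<omega>\<^sup>2 \<le> norm (G x)" "\<omega>\<^sup>2 \<le> U"
proof -
  have "\<omega>\<^sup>2 \<le> (sqrt (norm (G x)))\<^sup>2" using \<omega> by (intro power_mono) auto
  then show "\<omega>\<^sup>2 \<le> norm (G x)" by simp
  then show "\<omega>\<^sup>2 \<le> U" using U(2)[OF x] by simp
qed

lemma dtR: "dt \<in> Rn n"
  using capped_cg_Rn[OF cg[unfolded newton_cg_def \<rho>_def[symmetric]] G_Rn[OF xR] H_Rn[OF xR]] .

definition r where "r = G x + cg_Hbar (H x) \<rho> dt"

lemma cg_args: "0 \<le> min (eta P) \<rho>" "min (eta P) \<rho> \<le> 1"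
  using param_facts \<rho>_pos by auto

lemma sol_residual: "ty = SOL \<Longrightarrow> norm r \<le> 2/5 * \<rho> * norm dt"
  using capped_cg_SOL(1)[OF _ \<rho>_pos cg_args] cg unfolding newton_cg_def r_def \<rho>_def[symmetric] by blast

lemma sol_curvature: "ty = SOL \<Longrightarrow> \<rho> * (norm dt)\<^sup>2 \<le> dt \<bullet> cg_Hbar (H x) \<rho> dt"
  using capped_cg_SOL(2)[OF _ \<rho>_pos cg_args] cg unfolding newton_cg_def \<rho>_def[symmetric] by blast

lemma slope_eq: "dt \<bullet> G x = dt \<bullet> r - dt \<bullet> cg_Hbar (H x) \<rho> dt"
  by (simp add: r_def inner_add_right)

lemma Hbar_eq: "dt \<bullet> cg_Hbar (H x) \<rho> dt = dt \<bullet> blinfun_apply (H x) dt + 2 * \<rho> * (norm dt)\<^sup>2"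
  by (simp add: cg_Hbar_def inner_add_right power2_norm_eq_inner)

lemma sol_inner_residual: "ty = SOL \<Longrightarrow> \<bar>dt \<bullet> r\<bar> \<le> 2/5 * \<rho> * (norm dt)\<^sup>2"
proof -
  assume "ty = SOL"
  have "\<bar>dt \<bullet> r\<bar> \<le> norm dt * norm r" by (rule Cauchy_Schwarz_ineq2)
  also have "\<dots> \<le> norm dt * (2/5 * \<rho> * norm dt)" using sol_residual[OF \<open>ty = SOL\<close>] by (rule mult_left_mono) simp
  finally show ?thesis by (simp add: power2_eq_square ac_simps)
qed

lemma sol_nonzero: "ty = SOL \<Longrightarrow> dt \<noteq> 0"
  using sol_residual gx by (auto simp: r_def cg_Hbar_zero)

lemma sol_descent: "ty = SOL \<Longrightarrow> dt \<bullet> G x \<le> - (3/5) * \<rho> * (norm dt)\<^sup>2"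
  using slope_eq sol_curvature sol_inner_residual by (simp add: abs_le_iff)

text \<open>
  The regularization outweighs the residual: twice \<open>\<rho>\<close> against two fifths of it.
\<close>

lemma sol_curvature_slope: "ty = SOL \<Longrightarrow> dt \<bullet> blinfun_apply (H x) dt \<le> - (dt \<bullet> G x)"
proof -
  assume ty: "ty = SOL"
  have "0 \<le> \<rho> * (norm dt)\<^sup>2" using \<rho>_pos by simp
  then show ?thesis using slope_eq Hbar_eq sol_inner_residual[OF ty] by (simp add: abs_le_iff)
qed

lemma sol_length: "ty = SOL \<Longrightarrow> 3/5 * \<rho> * norm dt \<le> norm (G x)"
proof -
  assume ty: "ty = SOL"
  have "3/5 * \<rho> * (norm dt)\<^sup>2 \<le> norm dt * norm (G x)"
    using sol_descent[OF ty] Cauchy_Schwarz_ineq2[of dt "G x"] by (simp add: abs_le_iff)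
  then have "norm dt * (3/5 * \<rho> * norm dt) \<le> norm dt * norm (G x)" by (simp add: power2_eq_square ac_simps)
  then show ?thesis using sol_nonzero[OF ty] mult_le_cancel_left_pos[of "norm dt"] by simp
qed

text \<open>
  For a step shorter than \<open>\<delta>\<close> the quadratic terms of the expansion leave a margin
  \<open>(1/2 - \<mu>) * t\<close> times the slope, so rejection is the fault of the cubic term.
\<close>

lemma armijo_rejected:
  assumes ty: "ty = SOL" and t: "0 < t" "t \<le> 1"
    and rej: "\<not> \<phi> (x + t *\<^sub>R dt) \<le> \<phi> x + mu P * t * (dt \<bullet> G x)"
  shows "t * norm dt \<ge> \<delta> \<or> armijo_const * \<rho> < L * (t\<^sup>2 * norm dt)"
proof (rule ccontr)
  assume neg: "\<not> ?thesis"
  then have "\<phi> (x + t *\<^sub>R dt) \<le> \<phi> x + G x \<bullet> (t *\<^sub>R dt)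
      + 1/2 * ((t *\<^sub>R dt) \<bullet> blinfun_apply (H x) (t *\<^sub>R dt)) + L * (norm (t *\<^sub>R dt)) ^ 3"
    using t by (intro objective_taylor x Rn_closed dtR) auto
  then have T: "\<phi> (x + t *\<^sub>R dt) \<le> \<phi> x + t * (dt \<bullet> G x) + t\<^sup>2 / 2 * (dt \<bullet> blinfun_apply (H x) dt) + L * (t ^ 3 * norm dt ^ 3)"
    using t by (simp add: blinfun.scaleR_right inner_commute power2_eq_square power_mult_distrib mult.assoc)
  define a where "a = - (dt \<bullet> G x)"
  define h where "h = dt \<bullet> blinfun_apply (H x) dt"
  have a: "a \<ge> 3/5 * \<rho> * (norm dt)\<^sup>2" using sol_descent[OF ty] by (simp add: a_def)
  moreover have "3/5 * \<rho> * (norm dt)\<^sup>2 \<ge> 0" using \<rho>_pos by simp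
  ultimately have a0: "a \<ge> 0" by linarith
  have "h \<le> a" using sol_curvature_slope[OF ty] by (simp add: a_def h_def)
  then have "t\<^sup>2 / 2 * h \<le> t\<^sup>2 / 2 * a" by (intro mult_left_mono) auto
  also have "\<dots> \<le> t / 2 * a"
    using t a0 by (intro mult_right_mono) (auto simp: power2_eq_square mult_left_le_one_le)
  finally have "t\<^sup>2 / 2 * h \<le> t / 2 * a" .
  moreover have "\<phi> (x + t *\<^sub>R dt) > \<phi> x - mu P * (t * a)" using rej by (simp add: a_def algebra_simps)
  moreover have "\<phi> (x + t *\<^sub>R dt) \<le> \<phi> x - t * a + t\<^sup>2 / 2 * h + L * (t ^ 3 * norm dt ^ 3)"
    using T by (simp add: a_def h_def)
  ultimately have "(1/2 - mu P) * (t * a) < L * (t ^ 3 * norm dt ^ 3)"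
    by (simp add: algebra_simps)
  moreover have "(1/2 - mu P) * (t * (3/5 * \<rho> * (norm dt)\<^sup>2)) \<le> (1/2 - mu P) * (t * a)"
    using a t param_facts by (intro mult_left_mono) auto
  moreover have "(1/2 - mu P) * (t * (3/5 * \<rho> * (norm dt)\<^sup>2)) = (armijo_const * \<rho>) * (t * (norm dt)\<^sup>2)"
    by (simp add: armijo_const_def)
  moreover have "L * (t ^ 3 * norm dt ^ 3) = (L * (t\<^sup>2 * norm dt)) * (t * (norm dt)\<^sup>2)"
    by (simp add: power2_eq_square power3_eq_cube)
  ultimately have "(armijo_const * \<rho>) * (t * (norm dt)\<^sup>2) < (L * (t\<^sup>2 * norm dt)) * (t * (norm dt)\<^sup>2)"
    by linarith
  then have "armijo_const * \<rho> < L * (t\<^sup>2 * norm dt)"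
    using t sol_nonzero[OF ty] mult_less_cancel_right_pos[of "t * (norm dt)\<^sup>2"] by simp
  with neg show False by simp
qed

text \<open>
  The first alternative of \<open>armijo_rejected\<close> is a length independent of \<open>M\<close> and the second one
  bounds the length from below by a multiple of \<open>sqrt M * \<omega>\<close>; for large \<open>M\<close> both are long in
  comparison with \<open>\<omega> / sqrt M\<close>.
\<close>

lemma armijo_rejected_long:
  assumes ty: "ty = SOL" and t: "0 < t" "t \<le> 1"
    and rej: "\<not> \<phi> (x + t *\<^sub>R dt) \<le> \<phi> x + mu P * t * (dt \<bullet> G x)" and big: "M \<ge> M_large"
  shows "t * norm dt \<ge> 4 * \<omega> / sqrt M"
  using armijo_rejected[OF assms(1-4)]
proof
  assume *: "\<delta> \<le> t * norm dt"
  have "(4 * \<omega> / sqrt M)\<^sup>2 = 16 * \<omega>\<^sup>2 / M" using M by (simp add: power_divide power_mult_distrib)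
  also have "\<dots> \<le> \<delta>\<^sup>2" using M_large(2)[OF big] \<omega>_sq U(1) M by (simp add: divide_le_eq mult.commute)
  finally have "4 * \<omega> / sqrt M \<le> \<delta>" using \<delta>_pos power2_le_imp_le by fastforce
  with * show ?thesis by linarith
next
  assume *: "armijo_const * \<rho> < L * (t\<^sup>2 * norm dt)"
  have sM: "sqrt M * sqrt M = M" using M by simp
  have "t\<^sup>2 * norm dt \<le> t * norm dt"
    using t by (intro mult_right_mono) (auto simp: power2_eq_square mult_left_le_one_le)
  then have "L * (t\<^sup>2 * norm dt) \<le> L * (t * norm dt)" using L_pos by (intro mult_left_mono) auto
  with * have "armijo_const * \<rho> < L * (t * norm dt)" by linarith
  moreover have "L * (4 * \<omega> / sqrt M) \<le> armijo_const * \<rho>"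
  proof -
    have "4 * L * \<omega> \<le> M * armijo_const * \<omega>"
      using M_large(4)[OF big] \<omega> by (intro mult_right_mono) auto
    also have "\<dots> = armijo_const * \<rho> * sqrt M" using sM by (simp add: \<rho>_def ac_simps)
    finally show ?thesis using M by (simp add: divide_le_eq ac_simps)
  qed
  ultimately have "L * (4 * \<omega> / sqrt M) < L * (t * norm dt)" by linarith
  then show ?thesis using L_pos mult_less_cancel_left_pos[of L] by (simp only: less_imp_le)
qed

text \<open>
  This is the scale at which lengths become decreases of the objective: the thresholds for the
  estimate are multiples of \<open>\<omega> ^ 3 / sqrt M\<close>, and a length of \<open>c * \<omega> / sqrt M\<close> decreases
  the linear model by that, up to a constant.
\<close>

lemma descent_of_long:
  assumes ty: "ty = SOL" and t: "0 \<le> t" "t \<le> 1" and long: "t * norm dt \<ge> c * (\<omega> / sqrt M)" "c \<ge> 0"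
  shows "t * - (dt \<bullet> G x) \<ge> 3/5 * c\<^sup>2 * (\<omega> ^ 3 / sqrt M)"
proof -
  have sM: "sqrt M * sqrt M = M" using M by simp
  have "3/5 * c\<^sup>2 * (\<omega> ^ 3 / sqrt M) = 3/5 * \<rho> * (c * (\<omega> / sqrt M))\<^sup>2"
    using M sM by (simp add: \<rho>_def power2_eq_square power3_eq_cube field_simps)
  also have "\<dots> \<le> 3/5 * \<rho> * (t * norm dt)\<^sup>2"
    using long \<omega> M \<rho>_pos by (intro mult_left_mono power_mono) auto
  also have "\<dots> \<le> 3/5 * \<rho> * (t * (norm dt)\<^sup>2)"
  proof -
    have "t * t \<le> t * 1" using t by (intro mult_left_mono) auto
    then have "(t * norm dt)\<^sup>2 \<le> t * (norm dt)\<^sup>2"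
      by (simp add: power_mult_distrib power2_eq_square[of t] mult_right_mono)
    then show ?thesis using \<rho>_pos by (intro mult_left_mono) auto
  qed
  also have "\<dots> = t * (3/5 * \<rho> * (norm dt)\<^sup>2)" by simp
  also have "\<dots> \<le> t * - (dt \<bullet> G x)" using sol_descent[OF ty] t by (intro mult_left_mono) auto
  finally show ?thesis .
qed

lemma gradient_after_full_step:
  assumes "ty = SOL" "norm dt < \<delta>"
  shows "norm (G (x + dt)) \<le> norm (r - (2 * \<rho>) *\<^sub>R dt) + L * (norm dt)\<^sup>2"
proof -
  have "G (x + dt) = (r - (2 * \<rho>) *\<^sub>R dt) + (G (x + dt) - G x - blinfun_apply (H x) dt)"
    (is "_ = ?u + ?v") by (simp add: r_def cg_Hbar_def)
  then have "norm (G (x + dt)) \<le> norm ?u + norm ?v" using norm_triangle_ineq[of ?u ?v] by presburger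
  then show ?thesis using gradient_taylor[OF x dtR assms(2)] by linarith
qed

text \<open>
  If the decrease were below the threshold, then by the bound with \<open>\<omega> ^ 3\<close> the step would be so
  short that the new gradient is essentially \<open>r - 2 * \<rho> * dt\<close>, whose square is at most
  \<open>4.21 * a\<^sup>2 - 4 * e\<close> with \<open>a = \<rho> * norm dt\<close> and \<open>e = \<rho> * (dt \<bullet> r)\<close>. The slope gives
  the decrease \<open>(a\<^sup>2 - e) / \<rho>\<close>, so the bound with the new gradient would give
  \<open>a\<^sup>2 - e \<le> 4/33 * (4.21 * a\<^sup>2 - 4 * e)\<close>, which is false for \<open>\<bar>e\<bar> \<le> 2/5 * a\<^sup>2\<close>.
\<close>

lemma full_step_decrease:
  assumes ty: "ty = SOL" and big: "M \<ge> M_large"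
    and dec: "\<phi> x - \<phi> (x + dt) \<ge> mu P * - (dt \<bullet> G x)"
  shows "\<not> \<phi> x - \<phi> (x + dt) \<le> 4/33 * mu P * tau_plus P * (1 / sqrt M) * min ((norm (G (x + dt)))\<^sup>2 / \<omega>) (\<omega> ^ 3)"
proof
  let ?g = "norm (G (x + dt))"
  let ?m = "min (?g\<^sup>2 / \<omega>) (\<omega> ^ 3)"
  assume le: "\<phi> x - \<phi> (x + dt) \<le> 4/33 * mu P * tau_plus P * (1 / sqrt M) * ?m"
  have sM: "sqrt M * sqrt M = M" and s0: "sqrt M > 0" using M by auto
  define D where "D = - (dt \<bullet> G x)"
  have m0: "0 \<le> ?m" using \<omega> by simp
  have "mu P * D \<le> 4/33 * mu P * tau_plus P * (1 / sqrt M) * ?m" using le dec by (simp add: D_def)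
  also have "\<dots> \<le> 4/33 * mu P * 1 * (1 / sqrt M) * ?m"
    using m0 s0 param_facts by (intro mult_right_mono mult_left_mono) auto
  finally have "mu P * D \<le> mu P * (4/33 * (?m / sqrt M))" by simp
  then have D: "D \<le> 4/33 * (?m / sqrt M)" using param_facts mult_le_cancel_left_pos[of "mu P"] by blast
  have "?m / sqrt M \<le> \<omega> ^ 3 / sqrt M" "?m / sqrt M \<le> ?g\<^sup>2 / \<omega> / sqrt M"
    using s0 by (intro divide_right_mono; simp)+
  with D have D1: "D \<le> 4/33 * (\<omega> ^ 3 / sqrt M)" and D2: "D \<le> 4/33 * (?g\<^sup>2 / \<omega> / sqrt M)"
    by linarith+
  \<comment> \<open>A longer step would decrease the objective by \<open>3/20 > 4/33\<close> times \<open>\<mu> * \<omega> ^ 3 / sqrt M\<close>.\<close>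
  have len: "norm dt \<le> 1/2 * (\<omega> / sqrt M)"
  proof (rule ccontr)
    assume "\<not> ?thesis"
    then have "1 * norm dt \<ge> (1/2) * (\<omega> / sqrt M)" by simp
    from descent_of_long[OF ty _ _ this] have "3/20 * (\<omega> ^ 3 / sqrt M) \<le> D"
      by (simp add: D_def power_divide)
    moreover have "0 < \<omega> ^ 3 / sqrt M" using \<omega> s0 by simp
    ultimately show False using D1 by linarith
  qed
  have short: "norm dt < \<delta>"
  proof -
    have "(1/2 * (\<omega> / sqrt M))\<^sup>2 = 1/4 * \<omega>\<^sup>2 / M" using M by (simp add: power_divide power_mult_distrib)
    also have "\<dots> < \<delta>\<^sup>2" using M_large(2)[OF big] \<omega>_sq U(1) M by (simp add: divide_less_eq mult.commute)
    finally have "1/2 * (\<omega> / sqrt M) < \<delta>" using \<delta>_pos power2_less_imp_less by fastforce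
    with len show ?thesis by linarith
  qed
  define a where "a = \<rho> * norm dt"
  define e where "e = \<rho> * (dt \<bullet> r)"
  define q where "q = norm (r - (2 * \<rho>) *\<^sub>R dt)"
  have a: "a > 0" using \<rho>_pos sol_nonzero[OF ty] by (simp add: a_def)
  have ra: "norm r \<le> 2/5 * a" using sol_residual[OF ty] by (simp add: a_def)
  have e: "\<bar>e\<bar> \<le> 2/5 * a\<^sup>2"
  proof -
    have "\<bar>e\<bar> = \<rho> * \<bar>dt \<bullet> r\<bar>" using \<rho>_pos by (simp add: e_def abs_mult)
    also have "\<dots> \<le> \<rho> * (2/5 * \<rho> * (norm dt)\<^sup>2)"
      using sol_inner_residual[OF ty] \<rho>_pos by (intro mult_left_mono) auto
    finally show ?thesis by (simp add: a_def power2_eq_square ac_simps)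
  qed
  have q2: "q\<^sup>2 = (norm r)\<^sup>2 - 4 * e + 4 * a\<^sup>2"
  proof -
    have "q\<^sup>2 = (norm r)\<^sup>2 - 2 * (r \<bullet> ((2 * \<rho>) *\<^sub>R dt)) + (norm ((2 * \<rho>) *\<^sub>R dt))\<^sup>2"
      unfolding q_def power2_norm_eq_inner by (simp add: inner_diff_left inner_diff_right inner_commute)
    then show ?thesis
      by (simp add: e_def a_def power_mult_distrib inner_commute[of r])
  qed
  have r2: "(norm r)\<^sup>2 \<le> 4/25 * a\<^sup>2"
    using power_mono[OF ra, of 2] by (simp add: power_mult_distrib power_divide)
  have qa: "q \<le> 12/5 * a"
  proof -
    have "q \<le> norm r + norm ((2 * \<rho>) *\<^sub>R dt)" unfolding q_def by (rule norm_triangle_ineq4)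
    then show ?thesis using ra \<rho>_pos by (simp add: a_def)
  qed
  \<comment> \<open>The summand \<open>50 * L\<close> of \<open>M_large\<close> makes the Taylor remainder one percent of \<open>a\<close>.\<close>
  have Ld: "L * (norm dt)\<^sup>2 \<le> a / 100"
  proof -
    have "L * (norm dt)\<^sup>2 \<le> L * ((1/2 * (\<omega> / sqrt M)) * norm dt)"
      unfolding power2_eq_square using len L_pos by (intro mult_left_mono mult_right_mono) auto
    also have "\<dots> = (50 * L) * (\<omega> / sqrt M * norm dt) / 100" by simp
    also have "\<dots> \<le> M * (\<omega> / sqrt M * norm dt) / 100"
      using M_large(3)[OF big] \<omega> s0 by (intro divide_right_mono mult_right_mono) auto
    also have "\<dots> = a / 100" using sM s0 by (simp add: a_def \<rho>_def field_simps)
    finally show ?thesis .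
  qed
  have "?g \<le> q + a / 100" using gradient_after_full_step[OF ty short] Ld by (simp add: q_def)
  then have "?g\<^sup>2 \<le> (q + a / 100)\<^sup>2" by (intro power_mono) auto
  also have "\<dots> = q\<^sup>2 + q * (a / 50) + a\<^sup>2 / 10000" by (simp add: power2_eq_square field_simps)
  also have "\<dots> \<le> q\<^sup>2 + (12/5 * a) * (a / 50) + a\<^sup>2 / 10000"
    using qa a by (intro add_mono mult_right_mono) auto
  also have "(12/5 * a) * (a / 50) = 6/125 * a\<^sup>2" by (simp add: power2_eq_square)
  finally have "?g\<^sup>2 \<le> q\<^sup>2 + 6/125 * a\<^sup>2 + a\<^sup>2 / 10000" .
  then have g2: "?g\<^sup>2 \<le> 421/100 * a\<^sup>2 - 4 * e"
    using r2 q2 zero_le_power2[of a] by argo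
  have "\<rho> * D \<le> \<rho> * (4/33 * (?g\<^sup>2 / \<omega> / sqrt M))" using D2 \<rho>_pos by (intro mult_left_mono) auto
  also have "\<dots> = 4/33 * ?g\<^sup>2" using \<omega> s0 by (simp add: \<rho>_def field_simps)
  finally have up: "\<rho> * D \<le> 4/33 * ?g\<^sup>2" .
  have "D \<ge> \<rho> * (norm dt)\<^sup>2 - dt \<bullet> r" using sol_curvature[OF ty] slope_eq by (simp add: D_def)
  then have "\<rho> * (\<rho> * (norm dt)\<^sup>2 - dt \<bullet> r) \<le> \<rho> * D" using \<rho>_pos by (intro mult_left_mono) auto
  then have "a\<^sup>2 - e \<le> \<rho> * D" by (simp add: a_def e_def power2_eq_square algebra_simps)
  then have "a\<^sup>2 - e \<le> 4/33 * (421/100 * a\<^sup>2 - 4 * e)" using up g2 by argo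
  moreover have "e \<le> 2/5 * a\<^sup>2" using e by (simp add: abs_le_iff)
  ultimately have "a\<^sup>2 \<le> 0" by argo
  with a show False by simp
qed

end

context newton_direction
begin

lemma sol_alpha_eq:
  assumes "dt \<noteq> 0" shows "sol_alpha dt \<omega> M = min 1 (sqrt (\<omega> / (sqrt M * norm dt)))"
proof -
  have "M powr (-1/4) = (M powr (1/2)) powr (-(1/2))" by (simp add: powr_powr)
  then have "M powr (-1/4) = 1 / sqrt (sqrt M)"
    using M powr_neg_half[of "sqrt M"] by (simp add: powr_half_sqrt)
  moreover have "norm dt powr (-1/2) = 1 / sqrt (norm dt)" using powr_neg_half assms by simp
  ultimately show ?thesis
    using \<omega> by (simp add: sol_alpha_def powr_half_sqrt real_sqrt_divide real_sqrt_mult)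
qed

lemma sol_alpha_range: "ty = SOL \<Longrightarrow> 0 < sol_alpha dt \<omega> M" "ty = SOL \<Longrightarrow> sol_alpha dt \<omega> M \<le> 1"
  using sol_alpha_eq[OF sol_nonzero] sol_nonzero \<omega> M by auto

text \<open>
  When the unit step is rejected, \<open>norm dt\<close> is at least \<open>4 * \<omega> / sqrt M\<close>. Hence the initial
  step size \<open>a\<close> of (LS2) is below one and satisfies \<open>a\<^sup>2 * norm dt = \<omega> / sqrt M\<close>, which is too
  short for any of the reasons for rejection in \<open>armijo_rejected\<close>.
\<close>

lemma short_step:
  assumes ty: "ty = SOL" and big: "M \<ge> M_large"
    and rej: "\<not> \<phi> (x + dt) \<le> \<phi> x + mu P * (dt \<bullet> G x)"
  shows "armijo P \<phi> G x dt (sol_alpha dt \<omega> M) 0"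
    and "sol_alpha dt \<omega> M * - (dt \<bullet> G x) \<ge> 12/5 * (\<omega> ^ 3 / sqrt M)"
proof -
  define a where "a = sol_alpha dt \<omega> M"
  have sM: "sqrt M * sqrt M = M" and s0: "sqrt M > 0" using M by auto
  have d0: "norm dt > 0" using sol_nonzero[OF ty] by simp
  have long: "norm dt \<ge> 4 * \<omega> / sqrt M" using armijo_rejected_long[OF ty, of 1] rej big by simp
  have "\<omega> / (sqrt M * norm dt) \<le> (1/2)\<^sup>2"
    using long s0 d0 by (simp add: divide_simps ac_simps power2_eq_square)
  then have half: "sqrt (\<omega> / (sqrt M * norm dt)) \<le> 1/2" by (rule real_le_lsqrt[rotated]) simp
  then have a_eq: "a = sqrt (\<omega> / (sqrt M * norm dt))" and a_half: "a \<le> 1/2"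
    unfolding a_def sol_alpha_eq[OF sol_nonzero[OF ty]] by linarith+
  have a: "0 < a" "a \<le> 1" using sol_alpha_range[OF ty] by (simp_all add: a_def)
  have "a\<^sup>2 = \<omega> / (sqrt M * norm dt)" using \<omega> s0 d0 by (simp add: a_eq)
  then have a2: "a\<^sup>2 * norm dt = \<omega> / sqrt M" using d0 s0 by (simp add: field_simps)
  have "a\<^sup>2 * norm dt \<le> (1/2) * (a * norm dt)"
    using a a_half d0 by (simp add: power2_eq_square mult_right_mono)
  then have "2 * (\<omega> / sqrt M) \<le> a * norm dt" using a2 by linarith
  from descent_of_long[OF ty _ a(2) this] show "sol_alpha dt \<omega> M * - (dt \<bullet> G x) \<ge> 12/5 * (\<omega> ^ 3 / sqrt M)"
    using a by (simp add: a_def)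
  show "armijo P \<phi> G x dt (sol_alpha dt \<omega> M) 0"
  proof (rule ccontr)
    assume "\<not> ?thesis"
    then have "\<not> \<phi> (x + a *\<^sub>R dt) \<le> \<phi> x + mu P * a * (dt \<bullet> G x)" by (simp add: armijo_def a_def)
    from armijo_rejected[OF ty a this] show False
    proof
      assume *: "\<delta> \<le> a * norm dt"
      have "\<delta>\<^sup>2 \<le> (a * norm dt)\<^sup>2" using * \<delta>_pos by (intro power_mono) auto
      also have "\<dots> = (a\<^sup>2 * norm dt) * norm dt" by (simp add: power2_eq_square)
      also have "\<dots> = \<omega> * norm dt / sqrt M" unfolding a2 by simp
      finally have "M * \<delta>\<^sup>2 \<le> M * (\<omega> * norm dt / sqrt M)" using M by (intro mult_left_mono) auto
      also have "\<dots> = \<rho> * norm dt" using sM s0 by (simp add: \<rho>_def field_simps)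
      finally have "3/5 * (M * \<delta>\<^sup>2) \<le> 3/5 * (\<rho> * norm dt)" by simp
      then have "3/5 * (M * \<delta>\<^sup>2) \<le> U" using sol_length[OF ty] U(2)[OF x] by simp
      then show False using M_large(2)[OF big] U(1) by simp
    next
      assume "armijo_const * \<rho> < L * (a\<^sup>2 * norm dt)"
      then have "armijo_const * \<rho> * sqrt M < L * \<omega>" using s0 by (simp add: a2 divide_simps)
      moreover have "armijo_const * \<rho> * sqrt M = (M * armijo_const) * \<omega>" using sM by (simp add: \<rho>_def ac_simps)
      ultimately have "(M * armijo_const) * \<omega> < L * \<omega>" by simp
      then show False using M_large(4)[OF big] \<omega> L_pos by simp
    qed
  qed
qed

abbreviation d where "d \<equiv> nc_direction G H x M dt"

text \<open>
  The length of the direction is the curvature divided by \<open>M\<close>, which makes the quadratic term of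
  the expansion equal to \<open>- M * norm d ^ 3 / 2\<close>; the sign is chosen so that the linear term
  does not increase the objective.
\<close>

lemma curvature_step:
  assumes ty: "ty = NC"
  shows "d \<in> Rn n" "norm d \<le> B / M" "G x \<bullet> d \<le> 0" "d \<bullet> blinfun_apply (H x) d = - M * norm d ^ 3"
    "norm d > \<omega> / sqrt M"
proof -
  define e where "e = dt /\<^sub>R norm dt"
  define c where "c = \<bar>e \<bullet> blinfun_apply (H x) e\<bar>"
  define \<sigma> :: real where "\<sigma> = (if e \<bullet> G x < 0 then -1 else 1)"
  have lc: "low_curv (H x) \<rho> dt"
    using capped_cg_NC cg ty unfolding newton_cg_def \<rho>_def by blast
  then have dt0: "dt \<noteq> 0" by (auto simp: low_curv_def cg_Hbar_zero)
  then have ne: "norm e = 1" by (simp add: e_def)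
  have eR: "e \<in> Rn n" unfolding e_def using dtR by (intro Rn_closed)
  have d_eq: "d = - ((c / M * \<sigma>) *\<^sub>R e)"
    by (simp add: nc_direction_def Let_def e_def[symmetric] c_def \<sigma>_def divide_inverse mult.commute)
  then show "d \<in> Rn n" using eR by (simp add: Rn_closed)
  have \<sigma>: "\<bar>\<sigma>\<bar> = 1" "\<sigma> * \<sigma> = 1" "\<sigma> * (e \<bullet> G x) \<ge> 0" by (auto simp: \<sigma>_def)
  have c0: "c \<ge> 0" by (simp add: c_def)
  then have nd: "norm d = c / M" using M ne \<sigma> by (simp add: d_eq abs_mult)
  have "c \<le> norm (blinfun_apply (H x) e)" using Cauchy_Schwarz_ineq2[of e "blinfun_apply (H x) e"] ne by (simp add: c_def)
  also have "\<dots> \<le> B" using norm_blinfun[of "H x" e] B(2)[OF x] ne by simp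
  finally show "norm d \<le> B / M" unfolding nd using M by (simp add: divide_right_mono)
  have "c / M * (\<sigma> * (e \<bullet> G x)) \<ge> 0" using c0 M \<sigma> by simp
  then show "G x \<bullet> d \<le> 0" by (simp add: d_eq inner_commute[of "G x"] mult.assoc)
  have "dt \<bullet> blinfun_apply (H x) dt < - \<rho> * (norm dt)\<^sup>2"
    using lc Hbar_eq by (simp add: low_curv_def)
  moreover have "e \<bullet> blinfun_apply (H x) e = (dt \<bullet> blinfun_apply (H x) dt) / (norm dt)\<^sup>2"
    by (simp add: e_def blinfun.scaleR_right divide_inverse power2_eq_square)
  ultimately have curv: "e \<bullet> blinfun_apply (H x) e < - \<rho>" using dt0 by (simp add: pos_divide_less_eq)
  then have c_eq: "e \<bullet> blinfun_apply (H x) e = - c" and c\<rho>: "c > \<rho>" using \<rho>_pos by (auto simp: c_def)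
  have "d \<bullet> blinfun_apply (H x) d = (c / M)\<^sup>2 * (\<sigma> * \<sigma>) * (e \<bullet> blinfun_apply (H x) e)"
    by (simp add: d_eq blinfun.scaleR_right blinfun.minus_right power2_eq_square)
  also have "\<dots> = - M * (c / M) ^ 3" using M \<sigma> by (simp add: c_eq power2_eq_square power3_eq_cube)
  finally show "d \<bullet> blinfun_apply (H x) d = - M * norm d ^ 3" by (simp add: nd)
  have "\<omega> / sqrt M = \<rho> / M" using M by (simp add: \<rho>_def divide_simps)
  then show "norm d > \<omega> / sqrt M" using c\<rho> M by (simp add: nd divide_strict_right_mono)
qed

lemma curvature_step_accepted:
  assumes ty: "ty = NC" and big: "M \<ge> M_large"
  shows "nc_decrease P \<phi> x d M 0"
proof -
  note c = curvature_step[OF ty]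
  have "B / M < \<delta>" using M_large(5)[OF big] M by (simp add: pos_divide_less_eq mult.commute)
  then have "norm d < \<delta>" using c(2) by linarith
  from objective_taylor[OF x c(1) this]
  have "\<phi> (x + d) \<le> \<phi> x - M/2 * norm d ^ 3 + L * norm d ^ 3" using c(3,4) by simp
  also have "\<dots> = \<phi> x - (M/2 - L) * norm d ^ 3" by (simp add: algebra_simps)
  also have "\<dots> \<le> \<phi> x - (M * mu P) * norm d ^ 3"
  proof -
    have "L \<le> M * armijo_const" using M_large(4)[OF big] L_pos by simp
    also have "\<dots> \<le> M * (1/2 - mu P)" using M param_facts by (intro mult_left_mono) (auto simp: armijo_const_def)
    finally have "M * mu P \<le> M/2 - L" by (simp add: algebra_simps)
    then have "M * mu P * norm d ^ 3 \<le> (M/2 - L) * norm d ^ 3" by (intro mult_right_mono) auto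
    then show ?thesis by simp
  qed
  finally show ?thesis by (simp add: nc_decrease_def)
qed

lemma curvature_step_decrease:
  assumes ty: "ty = NC" and acc: "nc_decrease P \<phi> x d M m"
  shows "\<phi> x - \<phi> (x + (beta P ^ m) *\<^sub>R d) \<ge> 0"
    and "m = 0 \<Longrightarrow> \<phi> x - \<phi> (x + (beta P ^ m) *\<^sub>R d) > mu P * (\<omega> ^ 3 / sqrt M)"
proof -
  have "0 \<le> M * mu P * beta P ^ (2 * m) * norm d ^ 3" using M param_facts by simp
  then show "\<phi> x - \<phi> (x + (beta P ^ m) *\<^sub>R d) \<ge> 0" using acc by (simp add: nc_decrease_def)
  assume m: "m = 0"
  have "(\<omega> / sqrt M) ^ 3 < norm d ^ 3"
    using curvature_step(5)[OF ty] \<omega> M by (intro power_strict_mono) auto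
  then have "mu P * (M * (\<omega> / sqrt M) ^ 3) < mu P * (M * norm d ^ 3)" using M param_facts by simp
  moreover have "M * (\<omega> / sqrt M) ^ 3 = \<omega> ^ 3 / sqrt M"
    using M by (simp add: power3_eq_cube divide_simps)
  ultimately show "\<phi> x - \<phi> (x + (beta P ^ m) *\<^sub>R d) > mu P * (\<omega> ^ 3 / sqrt M)"
    using acc m by (simp add: nc_decrease_def mult.assoc mult.left_commute)
qed

end

locale newton_step = newton_direction +
  fixes x' :: fsvec and M' :: real
  assumes res: "newton_result P \<phi> G H x \<omega> M \<omega>bar (ty, dt) = Some (x', M')"
begin

lemma objective_decreases: "\<phi> x' \<le> \<phi> x" and next_Rn: "x' \<in> Rn n"
proof -
  have slope: "a * (dt \<bullet> G x) \<le> 0" if "0 \<le> a" "ty = SOL" for a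
  proof -
    have "0 \<le> 3/5 * \<rho> * (norm dt)\<^sup>2" using \<rho>_pos by simp
    then have "dt \<bullet> G x \<le> 0" using sol_descent[OF that(2)] by linarith
    then show ?thesis using that by (simp add: mult_nonneg_nonpos)
  qed
  have "\<phi> x' \<le> \<phi> x \<and> x' \<in> Rn n"
    using res
  proof (cases rule: newton_resultE)
    case (armijo m)
    then show ?thesis using slope[of "mu P * beta P ^ m"] param_facts xR dtR
      by (auto simp: armijo_def intro!: Rn_closed)
  next
    case (short_armijo m)
    then show ?thesis using slope[of "mu P * (sol_alpha dt \<omega> M * beta P ^ m)"] param_facts xR dtR sol_alpha_range
      by (auto simp: armijo_def intro!: Rn_closed)
  next
    case (curvature m)
    then show ?thesis using curvature_step_decrease(1)[OF curvature(1,2)] curvature_step(1)[OF curvature(1)] xR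
      by (auto intro!: Rn_closed)
  qed (use xR in auto)
  then show "\<phi> x' \<le> \<phi> x" "x' \<in> Rn n" by auto
qed

lemma next_level: "x' \<in> S"
  using objective_decreases next_Rn x by (auto simp: level_set_def)

lemma estimate_cases:
  "M' = gam P * M \<or>
   M' = M / gam P \<and> \<phi> x - \<phi> x' \<ge> decrease_const P / sqrt M * \<omega>bar ^ 3 \<or>
   M' = M \<and> \<phi> x - \<phi> x' \<ge> decrease_const P / sqrt M * min ((norm (G x'))\<^sup>2 / \<omega>) (\<omega> ^ 3)"
  using res
proof (cases rule: newton_resultE)
  case (armijo m)
  then show ?thesis using new_M_cases[OF P M \<omega>(1)] \<omega> by auto
next
  case (short_armijo m)
  then show ?thesis using new_M_cases[OF P M \<omega>(1)] \<omega> by auto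
next
  case (curvature m)
  then show ?thesis using new_M_cases[OF P M \<omega>(1)] \<omega> by auto
qed simp_all

text \<open>
  Each way of ending a Newton step is either impossible for large \<open>M\<close> or comes with more decrease
  than the threshold for increasing \<open>M\<close>. After backtracking, the rejected step size that precedes the
  accepted one is long, and the accepted one is the factor \<open>\<beta>\<close> shorter; this is the reason for
  the factor \<open>\<beta>\<close> in the threshold.
\<close>

lemma estimate_not_increased:
  assumes big: "M \<ge> M_large" shows "M' \<le> M"
proof -
  have pw: "M powr (-1/2) = 1 / sqrt M" using powr_neg_half M by blast
  have gM: "inverse (gam P) * M \<le> M" using param_facts M by (simp add: field_simps)
  define W where "W = \<omega> ^ 3 / sqrt M"
  have w0: "0 < W" using \<omega> M by (simp add: W_def)
  have W: "1 / sqrt M * \<omega> ^ 3 = W" by (simp add: W_def)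
  have SOL_case: "new_M P SOL False D gp \<omega> M \<omega>bar \<le> M" if "D \<ge> mu P * beta P * (12/5 * W)" for D gp
  proof -
    have "tau_plus P * (beta P * mu P * W) \<le> 1 * (beta P * mu P * W)"
      using w0 param_facts by (intro mult_right_mono) auto
    also have "\<dots> < mu P * beta P * (12/5 * W)" using w0 param_facts by simp
    finally have "\<not> D \<le> tau_plus P * beta P * mu P * (1 / sqrt M) * \<omega> ^ 3"
      using that unfolding mult.assoc W by linarith
    then show ?thesis using gM by (simp only: new_M_def pw) simp
  qed
  have NC_case: "new_M P NC False D gp \<omega> M \<omega>bar \<le> M" if "D > mu P * W" for D gp
  proof -
    have "(1 - 2 * mu P)\<^sup>2 \<le> 1" "(beta P)\<^sup>2 \<le> 1" using param_facts by (auto intro!: power_le_one)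
    then have "tau_plus P * (1 - 2 * mu P)\<^sup>2 * (beta P)\<^sup>2 \<le> 1"
      using param_facts by (intro mult_le_one) auto
    then have "tau_plus P * (1 - 2 * mu P)\<^sup>2 * (beta P)\<^sup>2 * (mu P * W) \<le> 1 * (mu P * W)"
      using w0 param_facts by (intro mult_right_mono) auto
    then have "\<not> D \<le> tau_plus P * (1 - 2 * mu P)\<^sup>2 * (beta P)\<^sup>2 * mu P * (1 / sqrt M) * \<omega> ^ 3"
      using that unfolding mult.assoc W by linarith
    then show ?thesis using gM by (simp only: new_M_def pw) simp
  qed
  from res show ?thesis
  proof (cases rule: newton_resultE)
    case (armijo m)
    show ?thesis
    proof (cases m)
      case 0
      have "\<not> \<phi> x - \<phi> x' \<le> 4/33 * mu P * tau_plus P * (1 / sqrt M) * min ((norm (G x'))\<^sup>2 * inverse \<omega>) (\<omega> ^ 3)"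
      proof -
        have "x' = x + dt" using armijo(4) 0 by simp
        moreover have "\<phi> (x + dt) \<le> \<phi> x + mu P * (dt \<bullet> G x)" using armijo(2) 0 by (simp add: armijo_def)
        ultimately show ?thesis using full_step_decrease[OF armijo(1) big] unfolding divide_inverse by simp
      qed
      then show ?thesis using gM unfolding armijo(5) 0 by (simp only: new_M_def pw) simp
    next
      case (Suc j)
      let ?t = "beta P ^ j"
      have t: "0 < ?t" "?t \<le> 1" using param_facts by (auto simp: power_le_one)
      have "\<not> \<phi> (x + ?t *\<^sub>R dt) \<le> \<phi> x + mu P * ?t * (dt \<bullet> G x)"
        using armijo(3)[of j] Suc by (simp add: armijo_def)
      from armijo_rejected_long[OF armijo(1) t this big]
      have "?t * norm dt \<ge> 4 * (\<omega> / sqrt M)" by simp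
      from descent_of_long[OF armijo(1) _ t(2) this, folded W_def] t
      have "48/5 * W \<le> ?t * - (dt \<bullet> G x)" by simp
      then have "12/5 * W \<le> ?t * - (dt \<bullet> G x)" using w0 by linarith
      then have "mu P * beta P * (12/5 * W) \<le> mu P * beta P * (?t * - (dt \<bullet> G x))"
        using param_facts by (intro mult_left_mono) auto
      also have "\<dots> = - (mu P * beta P ^ m * (dt \<bullet> G x))" by (simp add: Suc)
      also have "\<dots> \<le> \<phi> x - \<phi> x'" using armijo(2) by (simp add: armijo_def armijo(4))
      finally show ?thesis unfolding armijo(5) using Suc SOL_case by simp
    qed
  next
    case (short_armijo m)
    have rej: "\<not> \<phi> (x + dt) \<le> \<phi> x + mu P * (dt \<bullet> G x)"
      using short_armijo(2)[of 0] param_facts by (simp add: armijo_def)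
    note s = short_step[OF short_armijo(1) big rej, folded W_def]
    have m: "m = 0" using short_armijo(4)[of 0] s(1) by (cases m) auto
    have "mu P * beta P * (12/5 * W) \<le> mu P * 1 * (12/5 * W)"
      using w0 param_facts by (intro mult_right_mono mult_left_mono) auto
    also have "\<dots> \<le> mu P * (sol_alpha dt \<omega> M * - (dt \<bullet> G x))"
      using s(2) param_facts by (simp only: mult_1_right) (intro mult_left_mono, auto)
    also have "\<dots> = - (mu P * sol_alpha dt \<omega> M * (dt \<bullet> G x))" by simp
    also have "\<dots> \<le> \<phi> x - \<phi> x'" using short_armijo(3) m by (simp add: armijo_def short_armijo(5))
    finally show ?thesis unfolding short_armijo(6) by (rule SOL_case)
  next
    case no_armijo
    have rej: "\<not> \<phi> (x + dt) \<le> \<phi> x + mu P * (dt \<bullet> G x)"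
      using no_armijo(2)[of 0] param_facts by (simp add: armijo_def)
    from short_step(1)[OF no_armijo(1) big rej] no_armijo(3)[of 0] param_facts show ?thesis by simp
  next
    case (curvature m)
    have m: "m = 0" using curvature(3)[of 0] curvature_step_accepted[OF curvature(1) big] by (cases m) auto
    from curvature_step_decrease(2)[OF curvature(1,2) m, folded W_def curvature(4)]
    show ?thesis unfolding curvature(5) by (rule NC_case)
  next
    case no_curvature
    from curvature_step_accepted[OF no_curvature(1) big] no_curvature(2)[of 0] param_facts
    show ?thesis by simp
  qed
qed

end

section \<open>Counting iterations\<close>

lemma card_filter_Suc: "card {k. k < Suc K \<and> Q k} = card {k. k < K \<and> Q k} + (if Q K then 1 else 0)"
proof -
  have "{k. k < Suc K \<and> Q k} = (if Q K then insert K {k. k < K \<and> Q k} else {k. k < K \<and> Q k})"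
    by (auto simp: less_Suc_eq)
  then show ?thesis by simp
qed

text \<open>
  \<open>M K\<close> is \<open>M 0\<close> times \<open>\<gamma>\<close> to the number of increases minus the number of decreases.
\<close>

lemma increases_le_decreases:
  fixes M :: "nat \<Rightarrow> real"
  assumes "\<gamma> > 1" "M 0 > 0" and bound: "\<And>k. M k \<le> Mhat"
    and steps: "\<And>k. M (Suc k) = \<gamma> * M k \<or> M (Suc k) = M k / \<gamma> \<or> M (Suc k) = M k"
  shows "\<exists>C. \<forall>K. card {k. k < K \<and> M (Suc k) = \<gamma> * M k} \<le> card {k. k < K \<and> M (Suc k) = M k / \<gamma>} + C"
proof -
  have pos: "M k > 0" for k
  proof (induction k)
    case (Suc k)
    then show ?case using steps[of k] assms(1) by auto
  qed (use assms in simp)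
  have inv: "M K * \<gamma> ^ card {k. k < K \<and> M (Suc k) = M k / \<gamma>} = M 0 * \<gamma> ^ card {k. k < K \<and> M (Suc k) = \<gamma> * M k}" for K
  proof (induction K)
    case (Suc K)
    have ne: "\<gamma> * M K \<noteq> M K / \<gamma>" "\<gamma> * M K \<noteq> M K" "M K / \<gamma> \<noteq> M K"
    proof -
      have "M K < \<gamma> * M K" "M K / \<gamma> < M K" using pos[of K] assms(1) by (simp_all add: divide_less_eq)
      then show "\<gamma> * M K \<noteq> M K / \<gamma>" "\<gamma> * M K \<noteq> M K" "M K / \<gamma> \<noteq> M K" by linarith+
    qed
    have "\<gamma> \<noteq> 0" using assms(1) by simp
    then show ?case using Suc steps[of K] ne unfolding card_filter_Suc by auto
  qed simp
  obtain C where C: "Mhat / M 0 < \<gamma> ^ C" using real_arch_pow[OF assms(1)] by blast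
  have "card {k. k < K \<and> M (Suc k) = \<gamma> * M k} \<le> card {k. k < K \<and> M (Suc k) = M k / \<gamma>} + C" for K
  proof -
    let ?u = "card {k. k < K \<and> M (Suc k) = \<gamma> * M k}" and ?d = "card {k. k < K \<and> M (Suc k) = M k / \<gamma>}"
    have "M 0 * \<gamma> ^ ?u \<le> Mhat * \<gamma> ^ ?d"
      unfolding inv[of K, symmetric] using bound[of K] assms(1) by (intro mult_right_mono) auto
    also have "\<dots> \<le> (M 0 * \<gamma> ^ C) * \<gamma> ^ ?d"
      using C assms by (intro mult_right_mono) (auto simp: divide_less_eq mult.commute)
    finally have "\<gamma> ^ ?u \<le> \<gamma> ^ (?d + C)" using assms(2) by (simp add: power_add ac_simps)
    then show ?thesis using assms(1) by simp
  qed
  then show ?thesis by blast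
qed

text \<open>
  Bounding the total decrease by \<open>\<eta>\<close> from some index on, instead of from the start, costs only the
  additive constant \<open>C\<close>. This is where a factor \<open>o(1)\<close> is gained.
\<close>

lemma card_large_decreases:
  fixes f :: "nat \<Rightarrow> real"
  assumes dec: "\<And>k. f (Suc k) \<le> f k" and bdd: "\<And>k. f k \<ge> b" and \<eta>: "\<eta> > 0"
  shows "\<exists>C. \<forall>t>0. \<forall>K. real (card {k. k < K \<and> t \<le> f k - f (Suc k)}) \<le> C + \<eta> / t"
proof -
  have "decseq f" using dec by (simp add: decseq_Suc_iff)
  then obtain l where l: "f \<longlonglongrightarrow> l" "\<forall>i. l \<le> f i"
    using decseq_convergent[of f b] bdd by blast
  then have "eventually (\<lambda>k. f k < l + \<eta>) sequentially" using \<eta> by (intro order_tendstoD(2)[OF l(1)]) auto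
  then obtain K0 where K0: "f K0 < l + \<eta>" by (auto simp: eventually_sequentially)
  have "real (card {k. k < K \<and> t \<le> f k - f (Suc k)}) \<le> real K0 + \<eta> / t" if t: "t > 0" for t K
  proof -
    let ?A = "{k. K0 \<le> k \<and> k < K \<and> t \<le> f k - f (Suc k)}"
    have "card {k. k < K \<and> t \<le> f k - f (Suc k)} \<le> card ({..<K0} \<union> ?A)"
      by (rule card_mono) auto
    also have "\<dots> \<le> K0 + card ?A" by (rule order_trans[OF card_Un_le]) simp
    finally have 1: "card {k. k < K \<and> t \<le> f k - f (Suc k)} \<le> K0 + card ?A" .
    have "t * card ?A \<le> (\<Sum>k\<in>?A. f k - f (Suc k))"
      using sum_bounded_below[of ?A t "\<lambda>k. f k - f (Suc k)"] by (simp add: mult.commute)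
    also have "\<dots> \<le> (\<Sum>k\<in>{K0..<K}. f k - f (Suc k))"
      using dec by (intro sum_mono2) auto
    also have "\<dots> \<le> \<eta>"
    proof (cases "K0 \<le> K")
      case True
      have "(\<Sum>k\<in>{K0..<K}. f k - f (Suc k)) = f K0 - f K"
        using sum_Suc_diff'[OF True, of f] by (simp add: sum_subtractf)
      then show ?thesis using K0 l(2)[rule_format, of K] by linarith
    qed (use \<eta> in simp)
    finally have "real (card ?A) \<le> \<eta> / t" using t by (simp add: pos_le_divide_eq mult.commute)
    with 1 show ?thesis by linarith
  qed
  then show ?thesis by blast
qed

text \<open>
  Think of \<open>z\<close> as the logarithm of the gradient norm relative to the target accuracy. The potential
  \<open>w\<close>, the sum of the logarithms of \<open>z k\<close> and \<open>max (z k) (z (k - 1))\<close> in units of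
  \<open>ln (1 / q)\<close>, lies between \<open>0\<close> and \<open>2 * F\<close> and drops by at least one in every bad step.
  Since a bad step is recognized by a drop at \<open>k\<close> or at \<open>k - 1\<close>, two consecutive values enter;
  the maximum handles a bad step right after an increase of \<open>z\<close>.
\<close>

lemma excursion_count:
  fixes z :: "nat \<Rightarrow> real" and F :: real
  assumes q: "0 < q" "q < 1" and z: "\<And>k. k \<le> K \<Longrightarrow> 1 \<le> z k \<and> z k \<le> Z"
    and bad: "\<And>k. k < K \<Longrightarrow> bad k \<Longrightarrow> z (Suc k) \<le> z k \<and> (z (Suc k) \<le> q * z k \<or> z k \<le> q * z (k - 1))"
  defines "F \<equiv> ln Z / ln (1 / q)"
  shows "real K \<le> real (card {k. k < K \<and> \<not> bad k}) * (2 * F + 1) + 2 * F"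
proof -
  define l where "l = ln (1 / q)"
  have l: "l > 0" using q by (simp add: l_def)
  define w where "w k = (ln (z k) + ln (max (z k) (z (k - 1)))) / l" for k
  have w: "0 \<le> w k" "w k \<le> 2 * F" if "k \<le> K" for k
  proof -
    have zk: "1 \<le> z k" "z k \<le> Z" "1 \<le> z (k - 1)" "z (k - 1) \<le> Z" using z[of k] z[of "k - 1"] that by auto
    then have b: "0 \<le> ln (z k)" "ln (z k) \<le> ln Z" "0 \<le> ln (max (z k) (z (k - 1)))" "ln (max (z k) (z (k - 1))) \<le> ln Z"
      by auto
    then show "0 \<le> w k" using l by (simp add: w_def)
    have "w k \<le> (ln Z + ln Z) / l" unfolding w_def using l b by (intro divide_right_mono add_mono) auto
    then show "w k \<le> 2 * F" by (simp add: F_def l_def)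
  qed
  have F: "F \<ge> 0" using w[of 0] by simp
  have "real k \<le> real (card {j. j < k \<and> \<not> bad j}) * (2 * F + 1) + (2 * F - w k)" if "k \<le> K" for k
    using that
  proof (induction k)
    case 0
    then show ?case using w[of 0] by simp
  next
    case (Suc k)
    then have IH: "real k \<le> real (card {j. j < k \<and> \<not> bad j}) * (2 * F + 1) + (2 * F - w k)" and k: "k < K" by auto
    show ?case
    proof (cases "bad k")
      case True
      have zp: "1 \<le> z k" "1 \<le> z (Suc k)" "1 \<le> z (k - 1)" using z[of k] z[of "Suc k"] z[of "k - 1"] k by auto
      let ?m = "max (z k) (z (k - 1))"
      have m: "z k \<le> ?m" "z (k - 1) \<le> ?m" by auto
      have "z (Suc k) \<le> q * ?m"
        using bad[OF k True] mult_left_mono[OF m(1), of q] mult_left_mono[OF m(2), of q] q by (metis less_imp_le order_trans)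
      then have "ln (z (Suc k)) \<le> ln (q * ?m)" using zp q by (subst ln_le_cancel_iff) auto
      also have "\<dots> = ln ?m - l" using zp q by (simp add: ln_mult l_def ln_div)
      finally have "l \<le> ln ?m - ln (z (Suc k))" by simp
      moreover have "max (z (Suc k)) (z k) = z k" using bad[OF k True] by simp
      ultimately have "1 \<le> w k - w (Suc k)" using l by (simp add: w_def diff_divide_distrib[symmetric] pos_le_divide_eq)
      then show ?thesis using IH True by (simp add: card_filter_Suc)
    next
      case False
      then show ?thesis using IH w[of k] w[of "Suc k"] k by (simp add: card_filter_Suc algebra_simps)
    qed
  qed
  from this[of K] show ?thesis using w(1)[of K] by simp
qed

text \<open>
  As in \<open>excursion_count\<close> two consecutive values enter the potential, here a product: the
  halving that marks a bad step may happen one step earlier.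
\<close>

lemma halving_count:
  fixes e :: "nat \<Rightarrow> real"
  assumes pos: "\<And>k. k \<le> K \<Longrightarrow> 0 < e k" and dec: "\<And>k. e (Suc k) \<le> e k"
    and bad: "\<And>k. k < K \<Longrightarrow> bad k \<Longrightarrow> e (Suc k) \<le> e k / 2 \<or> e k \<le> e (k - 1) / 2"
  shows "e K * e (K - 1) * 2 ^ card {k. k < K \<and> bad k} \<le> (e 0)\<^sup>2"
proof -
  have "e k * e (k - 1) * 2 ^ card {j. j < k \<and> bad j} \<le> (e 0)\<^sup>2" if "k \<le> K" for k
    using that
  proof (induction k)
    case (Suc k)
    have le: "e k \<le> e (k - 1)" using dec[of "k - 1"] by (cases k) auto
    have p: "0 < e k" "0 < e (Suc k)" using pos Suc.prems by auto
    have "e (Suc k) * 2 ^ (if bad k then 1 else 0) \<le> e (k - 1)"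
      using bad[of k] dec[of k] le Suc.prems p by (auto simp: field_simps)
    then have "e (Suc k) * 2 ^ (if bad k then 1 else 0) * (e k * 2 ^ card {j. j < k \<and> bad j})
        \<le> e (k - 1) * (e k * 2 ^ card {j. j < k \<and> bad j})"
      using p by (intro mult_right_mono) auto
    also have "\<dots> \<le> (e 0)\<^sup>2" using Suc by (simp add: ac_simps)
    finally show ?case unfolding card_filter_Suc power_add
      by (simp only: mult.assoc mult.left_commute mult.commute diff_Suc_1 split: if_splits)
  qed (simp add: power2_eq_square)
  then show ?thesis by simp
qed

text \<open>
  A bound for the length of every initial stretch without an \<open>\<epsilon>\<close>-stationary point both forces
  such a point to exist and bounds its first index.
\<close>

lemma hitting_time:
  fixes g :: "nat \<Rightarrow> real"
  assumes "\<And>K. (\<And>k. k \<le> K \<Longrightarrow> \<epsilon> < g k) \<Longrightarrow> real K \<le> R" "0 \<le> R"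
  shows "\<exists>k. g k \<le> \<epsilon> \<and> real k \<le> R + 1"
proof (cases "\<exists>k. g k \<le> \<epsilon>")
  case True
  define k where "k = (LEAST k. g k \<le> \<epsilon>)"
  have k: "g k \<le> \<epsilon>" "\<And>j. j < k \<Longrightarrow> \<epsilon> < g j"
    using True unfolding k_def by (auto intro: LeastI_ex dest: not_less_Least)
  show ?thesis
  proof (cases k)
    case (Suc K)
    have "real K \<le> R" using k(2) Suc by (intro assms(1)) auto
    with k(1) Suc show ?thesis by (intro exI[of _ k]) simp
  qed (use k(1) assms(2) in \<open>auto intro!: exI[of _ 0]\<close>)
next
  case False
  obtain K where "R < real K" using reals_Archimedean2 by blast
  moreover have "real K \<le> R" using False by (intro assms(1)) (auto simp: not_le)
  ultimately show ?thesis by simp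
qed

section \<open>Runs of the algorithm\<close>

lemma arncg_run_nonzero_before:
  assumes run: "arncg_run P \<phi> G H \<omega>t \<omega>f x0 x M tr fb" and "G (x k) \<noteq> 0" "j \<le> k"
  shows "G (x j) \<noteq> 0"
proof
  assume z: "G (x j) = 0"
  have "x (j + i) = x j" for i
  proof (induction i)
    case (Suc i)
    have "G (x (j + i)) = 0 \<Longrightarrow> x (Suc (j + i)) = x (j + i)" using run unfolding arncg_run_def by metis
    with Suc z show ?case by simp
  qed simp
  from this[of "k - j"] assms z show False by simp
qed

locale arncg_sequence = arncg_problem +
  fixes \<omega>t \<omega>f :: "nat \<Rightarrow> real" and x :: "nat \<Rightarrow> fsvec" and M :: "nat \<Rightarrow> real"
    and tr fb :: "nat \<Rightarrow> cg_type \<times> fsvec"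
  assumes run: "arncg_run P \<phi> G H \<omega>t \<omega>f x0 x M tr fb"
    and regularizers: "\<And>k. G (x k) \<noteq> 0 \<Longrightarrow> 0 < \<omega>t k \<and> \<omega>t k \<le> \<omega>f k \<and> \<omega>f k \<le> sqrt (norm (G (x k)))"
begin

definition g where "g k = norm (G (x k))"
definition f where "f k = \<phi> (x k)"

lemma start: "x 0 = x0" "M 0 = M_init P"
  using run by (auto simp: arncg_run_def)

lemma stationary: "G (x k) = 0 \<Longrightarrow> x (Suc k) = x k \<and> M (Suc k) = M k"
  using run unfolding arncg_run_def by metis

text \<open>
  The alternative for \<open>\<omega>t\<close> records why no fallback step was taken: the gradient norm did not
  increase, or it had just increased.
\<close>

lemma iteration:
  assumes "G (x k) \<noteq> 0" "x k \<in> S" "M k > 0"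
  obtains \<omega> ty dt where "\<omega> = \<omega>f k \<or> \<omega> = \<omega>t k \<and> (g (Suc k) \<le> g k \<or> g (k - 1) < g k)"
    "newton_step n \<phi> G H x0 L N P (x k) \<omega> (M k) (\<omega>f k) ty dt (x (Suc k)) (M (Suc k))"
proof -
  have reg: "0 < \<omega>t k" "\<omega>t k \<le> \<omega>f k" "\<omega>f k \<le> sqrt (norm (G (x k)))" using regularizers assms by auto
  have st: "newton_cg P G H (x k) (\<omega>t k) (M k) (\<omega>f k) (tr k)"
    "if needs_fallback P \<phi> G H \<omega>t \<omega>f x M tr k then
       newton_cg P G H (x k) (\<omega>f k) (M k) (\<omega>f k) (fb k) \<and>
       newton_result P \<phi> G H (x k) (\<omega>f k) (M k) (\<omega>f k) (fb k) = Some (x (Suc k), M (Suc k))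
     else trial_result P \<phi> G H \<omega>t \<omega>f x M tr k = Some (x (Suc k), M (Suc k))"
    using run assms(1) unfolding arncg_run_def by meson+
  show thesis
  proof (cases "needs_fallback P \<phi> G H \<omega>t \<omega>f x M tr k")
    case True
    obtain ty dt where fb: "fb k = (ty, dt)" by (cases "fb k")
    have "newton_step n \<phi> G H x0 L N P (x k) (\<omega>f k) (M k) (\<omega>f k) ty dt (x (Suc k)) (M (Suc k))"
      using st True reg assms fb by unfold_locales auto
    then show thesis using that by blast
  next
    case False
    obtain ty dt where tr: "tr k = (ty, dt)" by (cases "tr k")
    have res: "trial_result P \<phi> G H \<omega>t \<omega>f x M tr k = Some (x (Suc k), M (Suc k))" using st False by simp
    then have "newton_step n \<phi> G H x0 L N P (x k) (\<omega>t k) (M k) (\<omega>f k) ty dt (x (Suc k)) (M (Suc k))"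
      using st reg assms tr by unfold_locales (auto simp: trial_result_def)
    moreover have "g (Suc k) \<le> g k \<or> g (k - 1) < g k"
      using False res by (auto simp: needs_fallback_def g_def)
    ultimately show thesis using that by blast
  qed
qed

lemma iterate_level: "x k \<in> S" and estimate_pos: "M k > 0"
proof -
  have "x k \<in> S \<and> M k > 0"
  proof (induction k)
    case 0
    then show ?case using start x0_S param_facts by simp
  next
    case (Suc k)
    show ?case
    proof (cases "G (x k) = 0")
      case True
      then show ?thesis using stationary[OF True] Suc by simp
    next
      case False
      obtain \<omega> ty dt where "newton_step n \<phi> G H x0 L N P (x k) \<omega> (M k) (\<omega>f k) ty dt (x (Suc k)) (M (Suc k))"
        using iteration[OF False] Suc by metis
      then interpret newton_step n \<phi> G H x0 L N P "x k" \<omega> "M k" "\<omega>f k" ty dt "x (Suc k)" "M (Suc k)" .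
      show ?thesis using next_level estimate_cases Suc param_facts by auto
    qed
  qed
  then show "x k \<in> S" "M k > 0" by auto
qed

lemma iterate_Rn: "x k \<in> Rn n" using iterate_level S_Rn by blast

lemma objective_decseq: "f (Suc k) \<le> f k"
proof (cases "G (x k) = 0")
  case True
  then show ?thesis using stationary[OF True] by (simp add: f_def)
next
  case False
  obtain \<omega> ty dt where "newton_step n \<phi> G H x0 L N P (x k) \<omega> (M k) (\<omega>f k) ty dt (x (Suc k)) (M (Suc k))"
    using iteration[OF False iterate_level estimate_pos] by metis
  then interpret newton_step n \<phi> G H x0 L N P "x k" \<omega> "M k" "\<omega>f k" ty dt "x (Suc k)" "M (Suc k)" .
  show ?thesis using objective_decreases by (simp add: f_def)
qed

lemma objective_bounded: "\<exists>b. \<forall>k. b \<le> f k"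
proof -
  have "continuous_on S \<phi>" using S_Rn by (intro continuous_on_subset[OF continuous_phi]) auto
  from continuous_attains_inf[OF compact_level _ this] x0_S
  obtain y where "\<forall>z\<in>S. \<phi> y \<le> \<phi> z" by auto
  then show ?thesis using iterate_level unfolding f_def by blast
qed

lemma estimate_step: "M (Suc k) = gam P * M k \<or> M (Suc k) = M k / gam P \<or> M (Suc k) = M k"
  and estimate_decrease: "M k \<ge> M_large \<Longrightarrow> M (Suc k) \<le> M k"
proof -
  have "(M (Suc k) = gam P * M k \<or> M (Suc k) = M k / gam P \<or> M (Suc k) = M k) \<and> (M k \<ge> M_large \<longrightarrow> M (Suc k) \<le> M k)"
  proof (cases "G (x k) = 0")
    case True
    then show ?thesis using stationary[OF True] by simp
  next
    case False
    obtain \<omega> ty dt where "newton_step n \<phi> G H x0 L N P (x k) \<omega> (M k) (\<omega>f k) ty dt (x (Suc k)) (M (Suc k))"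
      using iteration[OF False iterate_level estimate_pos] by metis
    then interpret newton_step n \<phi> G H x0 L N P "x k" \<omega> "M k" "\<omega>f k" ty dt "x (Suc k)" "M (Suc k)" .
    show ?thesis using estimate_cases estimate_not_increased by blast
  qed
  then show "M (Suc k) = gam P * M k \<or> M (Suc k) = M k / gam P \<or> M (Suc k) = M k"
    "M k \<ge> M_large \<Longrightarrow> M (Suc k) \<le> M k" by auto
qed

definition M_max where "M_max = max (M_init P) (gam P * M_large)"

lemma M_max_pos: "M_max > 0" using param_facts by (simp add: M_max_def less_max_iff_disj)

lemma estimate_bounded: "M k \<le> M_max"
proof (induction k)
  case 0
  then show ?case using start by (simp add: M_max_def)
next
  case (Suc k)
  show ?case
  proof (cases "M k \<ge> M_large")
    case True
    then show ?thesis using estimate_decrease[OF True] Suc by simp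
  next
    case False
    have "M k * 1 \<le> M k * gam P" using param_facts estimate_pos[of k] by (intro mult_left_mono) auto
    moreover have "M k / gam P \<le> M k / 1"
      using param_facts estimate_pos[of k] by (intro divide_left_mono) auto
    ultimately have "M k / gam P \<le> gam P * M k" "M k \<le> gam P * M k" by (auto simp: mult.commute)
    then have "M (Suc k) \<le> gam P * M k" using estimate_step[of k] by auto
    also have "\<dots> \<le> gam P * M_large" using False param_facts by (intro mult_left_mono) auto
    finally show ?thesis by (simp add: M_max_def)
  qed
qed

definition drop_const where "drop_const = decrease_const P / sqrt M_max"

lemma drop_const_pos: "drop_const > 0"
  using decrease_const_pos[OF P] M_max_pos by (simp add: drop_const_def)

lemma drop_const_le:
  assumes "0 \<le> t" shows "drop_const * t \<le> decrease_const P / sqrt (M k) * t"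
  unfolding drop_const_def
  using estimate_bounded[of k] estimate_pos[of k] decrease_const_pos[OF P] assms
  by (intro mult_right_mono divide_left_mono) auto

lemma iteration_cases:
  assumes "G (x k) \<noteq> 0"
  obtains (up) "M (Suc k) = gam P * M k"
  | (down) "M (Suc k) = M k / gam P" "drop_const * \<omega>f k ^ 3 \<le> f k - f (Suc k)"
  | (same) \<omega> where "M (Suc k) = M k" "\<omega> = \<omega>f k \<or> \<omega> = \<omega>t k \<and> (g (Suc k) \<le> g k \<or> g (k - 1) < g k)"
      "drop_const * min ((g (Suc k))\<^sup>2 / \<omega>) (\<omega> ^ 3) \<le> f k - f (Suc k)"
proof -
  obtain \<omega> ty dt where w: "\<omega> = \<omega>f k \<or> \<omega> = \<omega>t k \<and> (g (Suc k) \<le> g k \<or> g (k - 1) < g k)"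
    and "newton_step n \<phi> G H x0 L N P (x k) \<omega> (M k) (\<omega>f k) ty dt (x (Suc k)) (M (Suc k))"
    using iteration[OF assms iterate_level estimate_pos] by metis
  then interpret newton_step n \<phi> G H x0 L N P "x k" \<omega> "M k" "\<omega>f k" ty dt "x (Suc k)" "M (Suc k)" by simp
  have "0 \<le> \<omega>f k ^ 3" "0 \<le> min ((g (Suc k))\<^sup>2 / \<omega>) (\<omega> ^ 3)" using \<omega> by auto
  note le = this[THEN drop_const_le, of k]
  from estimate_cases show thesis
  proof (elim disjE conjE)
    assume "M (Suc k) = gam P * M k"
    then show thesis by (rule up)
  next
    assume "M (Suc k) = M k / gam P" "decrease_const P / sqrt (M k) * \<omega>f k ^ 3 \<le> \<phi> (x k) - \<phi> (x (Suc k))"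
    then show thesis using le(1) by (intro down) (auto simp: f_def)
  next
    assume "M (Suc k) = M k"
      "decrease_const P / sqrt (M k) * min ((norm (G (x (Suc k))))\<^sup>2 / \<omega>) (\<omega> ^ 3) \<le> \<phi> (x k) - \<phi> (x (Suc k))"
    then show thesis using le(2) w by (intro same[of \<omega>]) (auto simp: f_def g_def)
  qed
qed

text \<open>
  Call an iteration bad if it keeps the estimate and decreases the objective by less than \<open>t\<close>. The
  others decrease the objective by \<open>t\<close> or increase the estimate, and the increases are paid for by
  decreases of the estimate, which by assumption also decrease the objective by \<open>t\<close>.
\<close>

lemma nonbad_count:
  assumes "\<eta> > 0"
  shows "\<exists>C. \<forall>t>0. \<forall>K. (\<forall>k<K. M (Suc k) = M k / gam P \<longrightarrow> t \<le> f k - f (Suc k)) \<longrightarrow>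
    real (card {k. k < K \<and> \<not> (M (Suc k) = M k \<and> f k - f (Suc k) < t)}) \<le> C + \<eta> / t"
proof -
  obtain b where b: "\<And>k. b \<le> f k" using objective_bounded by blast
  obtain C1 where C1: "\<And>t K. t > 0 \<Longrightarrow> real (card {k. k < K \<and> t \<le> f k - f (Suc k)}) \<le> C1 + (\<eta> / 2) / t"
    using card_large_decreases[where f = f and b = b and \<eta> = "\<eta> / 2", OF objective_decseq b half_gt_zero[OF assms]]
    by blast
  obtain C2 where C2: "\<And>K. card {k. k < K \<and> M (Suc k) = gam P * M k} \<le> card {k. k < K \<and> M (Suc k) = M k / gam P} + C2"
    using increases_le_decreases[of "gam P" M M_max] estimate_step estimate_bounded estimate_pos param_facts by auto
  have "real (card {k. k < K \<and> \<not> (M (Suc k) = M k \<and> f k - f (Suc k) < t)}) \<le> (2 * C1 + C2) + \<eta> / t"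
    if t: "t > 0" and down: "\<forall>k<K. M (Suc k) = M k / gam P \<longrightarrow> t \<le> f k - f (Suc k)" for t K
  proof -
    let ?D = "{k. k < K \<and> t \<le> f k - f (Suc k)}" and ?u = "{k. k < K \<and> M (Suc k) = gam P * M k}"
    have "card {k. k < K \<and> \<not> (M (Suc k) = M k \<and> f k - f (Suc k) < t)} \<le> card (?u \<union> ?D)"
      using estimate_step down by (intro card_mono) (auto simp: not_less)
    also have "\<dots> \<le> card ?u + card ?D" by (rule card_Un_le)
    also have "card ?u \<le> card {k. k < K \<and> M (Suc k) = M k / gam P} + C2" by (rule C2)
    also have "card {k. k < K \<and> M (Suc k) = M k / gam P} \<le> card ?D" using down by (intro card_mono) auto
    finally have "card {k. k < K \<and> \<not> (M (Suc k) = M k \<and> f k - f (Suc k) < t)} \<le> 2 * card ?D + C2" by simp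
    then show ?thesis using C1[OF t, of K] by simp
  qed
  then show ?thesis by blast
qed

end

section \<open>Iteration bounds\<close>

lemma log_log_at_top: assumes "(U::real) > 0" shows "filterlim (\<lambda>\<epsilon>. ln (ln (U / \<epsilon>))) at_top (at_right 0)"
  using assms by real_asymp

lemma log_at_top: assumes "(U::real) > 0" shows "filterlim (\<lambda>\<epsilon>. ln (U / \<epsilon>)) at_top (at_right 0)"
  using assms by real_asymp

lemma excursion_length_bound:
  fixes l U :: real assumes "U > 0" "l > 0"
  shows "eventually (\<lambda>\<epsilon>. 2 * (ln (1 + ln (U / \<epsilon>)) / l) + 1 \<le> 3 / l * ln (ln (U / \<epsilon>))) (at_right 0)"
proof -
  have "eventually (\<lambda>y. 2 * ln (1 + y) + l \<le> 3 * ln y) at_top"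
    using assms(2) by real_asymp
  then have "eventually (\<lambda>\<epsilon>. 2 * ln (1 + ln (U / \<epsilon>)) + l \<le> 3 * ln (ln (U / \<epsilon>))) (at_right 0)"
    by (rule eventually_compose_filterlim[OF _ log_at_top[OF assms(1)]])
  then show ?thesis
  proof eventually_elim
    case (elim \<epsilon>)
    show ?case using divide_right_mono[OF elim, of l] assms(2) by (simp add: add_divide_distrib)
  qed
qed

lemma log_dominated:
  fixes A B C U :: real assumes "U > 0" "A > 0"
  shows "eventually (\<lambda>\<epsilon>. C + B * ln (U / \<epsilon>) \<le> A * \<epsilon> powr (-3/2)) (at_right 0)"
  using assms by real_asymp

lemma eps_seq_Suc: "eps_seq g (Suc k) = min (eps_seq g k) (g (Suc k))"
proof -
  have "g ` {0..Suc k} = insert (g (Suc k)) (g ` {0..k})" by (simp add: atLeast0_atMost_Suc)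
  then show ?thesis by (simp add: eps_seq_def min.commute)
qed

lemma eps_seq_0 [simp]: "eps_seq g 0 = g 0"
  by (simp add: eps_seq_def)

lemma eps_seq_le: "i \<le> k \<Longrightarrow> eps_seq g k \<le> g i"
  by (simp add: eps_seq_def)

lemma eps_seq_attained: "\<exists>i\<le>k. eps_seq g k = g i"
proof -
  have "eps_seq g k \<in> g ` {0..k}" unfolding eps_seq_def by (intro Min_in) auto
  then show ?thesis by auto
qed

lemma eps_seq_antimono: "eps_seq g k \<le> eps_seq g (k - 1)"
  by (cases k) (simp_all add: eps_seq_Suc)

lemma powr_three_halves: "x \<ge> 0 \<Longrightarrow> sqrt x ^ 3 = x powr (3/2)"
proof -
  assume "x \<ge> 0"
  then have "sqrt x ^ 3 = (x powr (1/2)) powr 3" by (simp add: powr_half_sqrt)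
  then show ?thesis by (simp only: powr_powr) simp
qed

context arncg_sequence
begin

lemma estimate_factors: "M k < gam P * M k" "M k / gam P < M k"
  using estimate_pos[of k] param_facts by (simp_all add: divide_less_eq)

lemma estimate_reduced:
  assumes "G (x k) \<noteq> 0" "M (Suc k) = M k / gam P"
  shows "drop_const * \<omega>f k ^ 3 \<le> f k - f (Suc k)"
  using assms(1) by (cases rule: iteration_cases) (use assms(2) estimate_factors[of k] in auto)

lemma estimate_kept:
  assumes "G (x k) \<noteq> 0" "M (Suc k) = M k"
  obtains \<omega> where "\<omega> = \<omega>f k \<or> \<omega> = \<omega>t k \<and> (g (Suc k) \<le> g k \<or> g (k - 1) < g k)"
    "drop_const * min ((g (Suc k))\<^sup>2 / \<omega>) (\<omega> ^ 3) \<le> f k - f (Suc k)"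
  using assms(1) by (cases rule: iteration_cases) (use assms(2) estimate_factors[of k] that in auto)

lemma g_pos: "g k \<ge> 0" by (simp add: g_def)

text \<open>
  In a bad iteration the threshold that keeps the estimate gives
  \<open>min ((g (Suc k))\<^sup>2 / \<omega>) (\<omega> ^ 3) < sqrt e' ^ 3\<close>, with \<open>e'\<close> proportional to \<open>\<epsilon>\<close>.
  If the first term of the minimum is the small one, then \<open>z = ln (g / e')\<close> drops to a quarter in
  the next step. Otherwise \<open>\<omega> < sqrt e'\<close>, hence \<open>\<omega> < sqrt (g k)\<close>, which is only possible for the
  trial regularizer after a drop of the gradient norm, and then \<open>z k\<close> is at most
  \<open>2 * \<theta> / (1 + 2 * \<theta>)\<close> times \<open>z (k - 1)\<close>; in this case the gradient norm does not increase, as otherwise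
  the fallback step would have been taken. So \<open>excursion_count\<close> applies to \<open>z\<close>.
\<close>

theorem bound_choice1:
  assumes c1: "reg_choice1 \<theta> g \<omega>t \<omega>f" and \<theta>: "\<theta> \<ge> 0" and A: "A > 0"
    and V: "V > 0" "\<And>k. g k \<le> V"
  shows "\<forall>\<^sub>F \<epsilon> in at_right 0. \<exists>k. g k \<le> \<epsilon> \<and> real k \<le> A * \<epsilon> powr (-3/2) * ln (ln (V / \<epsilon>))"
proof -
  define q where "q = max (1/4) (2 * \<theta> / (1 + 2 * \<theta>))"
  have q: "0 < q" "q < 1" "1/4 \<le> q" "2 * \<theta> / (1 + 2 * \<theta>) \<le> q" using \<theta> by (auto simp: q_def)
  define l where "l = ln (1 / q)"
  have l: "l > 0" using q by (simp add: l_def)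
  define c2 where "c2 = drop_const * exp (-3/2)"
  have c2: "c2 > 0" using drop_const_pos by (simp add: c2_def)
  \<comment> \<open>With the excursion length \<open>3 / l * ln (ln (V / \<epsilon>))\<close> this \<open>\<eta>\<close> uses up half of \<open>A\<close>.\<close>
  define \<eta> where "\<eta> = A * c2 * l / 6"
  have \<eta>: "\<eta> > 0" using A c2 l by (simp add: \<eta>_def)
  from nonbad_count[OF \<eta>] obtain C where
    "\<forall>t>0. \<forall>K. (\<forall>k<K. M (Suc k) = M k / gam P \<longrightarrow> t \<le> f k - f (Suc k)) \<longrightarrow>
      real (card {k. k < K \<and> \<not> (M (Suc k) = M k \<and> f k - f (Suc k) < t)}) \<le> C + \<eta> / t" ..
  note C = this[THEN spec, THEN mp, THEN spec, THEN mp]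
  define F where "F \<epsilon> = ln (1 + ln (V / \<epsilon>)) / l" for \<epsilon>
  have wf: "\<omega>f k = sqrt (g k)" and wt: "\<omega>t k = \<omega>f k * min 1 (g k * inverse (g (k - 1))) powr \<theta>" for k
    using c1 by (auto simp: reg_choice1_def)
  have main: "real K \<le> (C + \<eta> / (c2 * \<epsilon> powr (3/2))) * (2 * F \<epsilon> + 1) + 2 * F \<epsilon>"
    if \<epsilon>: "0 < \<epsilon>" and K: "\<And>k. k \<le> K \<Longrightarrow> \<epsilon> < g k" for \<epsilon> K
  proof -
    \<comment> \<open>Measured against \<open>e'\<close> instead of \<open>\<epsilon>\<close>, the logarithms \<open>z\<close> are at least one.\<close>
    define e' where "e' = \<epsilon> / exp 1"
    have e': "0 < e'" "e' < \<epsilon>" using \<epsilon> by (auto simp: e'_def divide_less_eq)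
    have lne: "ln e' = ln \<epsilon> - 1" using \<epsilon> by (simp add: e'_def ln_div)
    define t where "t = c2 * \<epsilon> powr (3/2)"
    have t: "t = drop_const * sqrt e' ^ 3"
    proof -
      have exp1: "exp 1 powr (3/2) = exp (3/2::real)" by (simp add: powr_def)
      have expm: "exp (- (3/2)) = 1 / exp (3/2::real)" using exp_minus[of "3/2::real"] by (simp only: inverse_eq_divide)
      have "sqrt e' ^ 3 = e' powr (3/2)" using e' by (simp add: powr_three_halves)
      also have "\<dots> = \<epsilon> powr (3/2) * exp (-3/2)"
        using \<epsilon> by (simp add: e'_def powr_divide exp1 expm)
      finally show ?thesis by (simp add: t_def c2_def)
    qed
    have t0: "t > 0" using c2 \<epsilon> by (simp add: t_def)
    have gk: "g k > \<epsilon>" "g k > e'" "g k > 0" if "k \<le> K" for k using K[OF that] e' \<epsilon> by auto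
    have Gne: "G (x k) \<noteq> 0" if "k \<le> K" for k using gk(3)[OF that] by (simp add: g_def)
    have down: "\<forall>k<K. M (Suc k) = M k / gam P \<longrightarrow> t \<le> f k - f (Suc k)"
    proof (intro allI impI)
      fix k assume k: "k < K" and dn: "M (Suc k) = M k / gam P"
      have "drop_const * \<omega>f k ^ 3 \<le> f k - f (Suc k)"
        using estimate_reduced[OF Gne[of k] dn] k by simp
      moreover have "sqrt e' ^ 3 \<le> \<omega>f k ^ 3" using gk[of k] k e' by (auto simp: wf intro!: power_mono)
      then have "t \<le> drop_const * \<omega>f k ^ 3" unfolding t using drop_const_pos by (intro mult_left_mono) auto
      ultimately show "t \<le> f k - f (Suc k)" by simp
    qed
    define z where "z k = 1 + ln (g k / \<epsilon>)" for k
    have z_eq: "z k = ln (g k) - ln e'" if "k \<le> K" for k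
      using gk[OF that] \<epsilon> by (simp add: z_def lne ln_div)
    have z: "1 \<le> z k \<and> z k \<le> 1 + ln (V / \<epsilon>)" if "k \<le> K" for k
      using gk[OF that] \<epsilon> V by (auto simp: z_def divide_right_mono)
    have bad: "z (Suc k) \<le> z k \<and> (z (Suc k) \<le> q * z k \<or> z k \<le> q * z (k - 1))"
      if k: "k < K" and b: "M (Suc k) = M k \<and> f k - f (Suc k) < t" for k
    proof -
      have km: "k - 1 \<le> K" using k by simp
      have zk: "z k \<ge> 1" "z (Suc k) \<ge> 1" using z k by auto
      have gp: "g k > e'" "g (Suc k) > e'" "g (k - 1) > e'" "g k > 0" "g (Suc k) > 0" "g (k - 1) > 0"
        using gk k by auto
      have Gk: "G (x k) \<noteq> 0" using Gne k by simp
      show ?thesis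
        using Gk conjunct1[OF b]
      proof (cases rule: estimate_kept)
        case (1 \<omega>)
        note same = 1
        have wpos: "0 < \<omega>" "\<omega> \<le> sqrt (g k)"
          using same(1) regularizers[OF Gne[of k]] k by (auto simp: g_def)
        have "drop_const * min ((g (Suc k))\<^sup>2 / \<omega>) (\<omega> ^ 3) < drop_const * sqrt e' ^ 3"
          using same(2) b t by linarith
        then have "min ((g (Suc k))\<^sup>2 / \<omega>) (\<omega> ^ 3) < sqrt e' ^ 3" using drop_const_pos by simp
        then consider "(g (Suc k))\<^sup>2 / \<omega> < sqrt e' ^ 3" | "\<omega> ^ 3 < sqrt e' ^ 3" by linarith
        then show ?thesis
        proof cases
          case 1
          then have "(g (Suc k))\<^sup>2 < sqrt e' ^ 3 * \<omega>" using wpos by (simp add: divide_less_eq)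
          also have "\<dots> \<le> sqrt e' ^ 3 * sqrt (g k)" using wpos e' by (intro mult_left_mono) auto
          finally have "ln ((g (Suc k))\<^sup>2) < ln (sqrt e' ^ 3 * sqrt (g k))" using gp e' by simp
          then have "2 * ln (g (Suc k)) < 3/2 * ln e' + 1/2 * ln (g k)"
            using gp e' by (simp add: ln_mult ln_realpow ln_sqrt)
          then have "z (Suc k) \<le> 1/4 * z k" using z_eq[of k] z_eq[of "Suc k"] k by simp
          moreover have "1/4 * z k \<le> q * z k" "1/4 * z k \<le> z k" using q zk by (auto intro: mult_right_mono)
          ultimately show ?thesis by linarith
        next
          case 2
          then have w: "\<omega> < sqrt e'" using power_less_imp_less_base[of \<omega> 3 "sqrt e'"] e' by simp
          have "sqrt e' < \<omega>f k" using gp by (simp add: wf)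
          then have \<omega>: "\<omega> = \<omega>t k" and alt: "g (Suc k) \<le> g k \<or> g (k - 1) < g k" using same(1) w by auto
          have less: "g k < g (k - 1)"
          proof (rule ccontr)
            assume "\<not> ?thesis"
            then have "min 1 (g k * inverse (g (k - 1))) = 1" using gp by (simp add: min_def field_simps)
            then have "\<omega>t k = \<omega>f k" using wt[of k] by simp
            then show False using w \<omega> \<open>sqrt e' < \<omega>f k\<close> by simp
          qed
          then have le: "z (Suc k) \<le> z k" using alt gp k by (simp add: z_eq)
          have "\<omega>t k = sqrt (g k) * (g k / g (k - 1)) powr \<theta>"
          proof -
            have "g k * inverse (g (k - 1)) = g k / g (k - 1)" by (simp only: divide_inverse)
            moreover have "g k / g (k - 1) \<le> 1" using less gp by simp
            ultimately have "min 1 (g k * inverse (g (k - 1))) = g k / g (k - 1)" by linarith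
            then show ?thesis using wt[of k] wf[of k] by simp
          qed
          then have "ln (sqrt (g k) * (g k / g (k - 1)) powr \<theta>) < ln (sqrt e')"
            using w \<omega> wpos e' by simp
          then have "1/2 * ln (g k) + \<theta> * (ln (g k) - ln (g (k - 1))) < 1/2 * ln e'"
            using gp e' by (simp add: ln_mult ln_sqrt ln_powr ln_div)
          moreover have "ln (g k) = z k + ln e'" "ln (g (k - 1)) = z (k - 1) + ln e'"
            using z_eq[of k] z_eq[OF km] k by simp_all
          ultimately have *: "1/2 * (z k + ln e') + \<theta> * (z k - z (k - 1)) < 1/2 * ln e'" by simp
          define a b where "a = \<theta> * z k" and "b = \<theta> * z (k - 1)"
          have "\<theta> * (z k - z (k - 1)) = a - b" by (simp only: right_diff_distrib a_def b_def)
          then have "z k + 2 * a \<le> 2 * b" using * by argo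
          then have "(1 + 2 * \<theta>) * z k \<le> 2 * \<theta> * z (k - 1)" by (simp add: distrib_right a_def b_def)
          then have "z k \<le> 2 * \<theta> / (1 + 2 * \<theta>) * z (k - 1)" using \<theta> by (simp add: field_simps)
          also have "\<dots> \<le> q * z (k - 1)" using q z[OF km] by (intro mult_right_mono) linarith+
          finally show ?thesis using le by simp
        qed
      qed
    qed
    have "real K \<le> real (card {k. k < K \<and> \<not> (M (Suc k) = M k \<and> f k - f (Suc k) < t)}) * (2 * F \<epsilon> + 1) + 2 * F \<epsilon>"
      using excursion_count[where K = K and z = z and Z = "1 + ln (V / \<epsilon>)" and bad = "\<lambda>k. M (Suc k) = M k \<and> f k - f (Suc k) < t", OF q(1,2) z bad]
      unfolding F_def l_def .
    also have "\<dots> \<le> (C + \<eta> / t) * (2 * F \<epsilon> + 1) + 2 * F \<epsilon>"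
    proof -
      have "F \<epsilon> \<ge> 0" using z[of 0] l by (simp add: F_def)
      then show ?thesis using C[OF t0 down] by (intro add_right_mono mult_right_mono) auto
    qed
    finally show ?thesis by (simp add: t_def)
  qed
  have ev1: "eventually (\<lambda>\<epsilon>. 2 * F \<epsilon> + 1 \<le> 3 / l * ln (ln (V / \<epsilon>))) (at_right 0)"
    unfolding F_def using excursion_length_bound[OF V(1) l] .
  have ev2: "eventually (\<lambda>\<epsilon>. ln (ln (V / \<epsilon>)) \<ge> 1) (at_right 0)" "eventually (\<lambda>\<epsilon>. ln (V / \<epsilon>) \<ge> 1) (at_right 0)"
    using log_log_at_top[OF V(1)] log_at_top[OF V(1)] by (auto simp: filterlim_at_top)
  have ev3: "eventually (\<lambda>\<epsilon>. (\<bar>C\<bar> + 1) * (3 / l) + 1 \<le> A / 2 * \<epsilon> powr (-3/2)) (at_right 0)"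
    using log_dominated[OF V(1), of "A / 2" "(\<bar>C\<bar> + 1) * (3 / l) + 1" 0] A by simp
  show ?thesis
    using ev1 ev2 ev3 eventually_at_right_less[of "0::real"]
  proof eventually_elim
    case (elim \<epsilon>)
    define Q where "Q = ln (ln (V / \<epsilon>))"
    define p where "p = \<epsilon> powr (-3/2)"
    have Q: "Q \<ge> 1" using elim by (simp add: Q_def)
    have pinv: "1 / \<epsilon> powr (3/2) = p" using elim by (simp add: p_def powr_minus_divide)
    have F0: "F \<epsilon> \<ge> 0" using elim l by (simp add: F_def)
    have p0: "p \<ge> 0" by (simp add: p_def)
    define N0 where "N0 = \<bar>C\<bar> + \<eta> / (c2 * \<epsilon> powr (3/2))"
    have N0: "N0 \<ge> 0" using \<eta> c2 by (simp add: N0_def)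
    have "\<exists>k. g k \<le> \<epsilon> \<and> real k \<le> (N0 * (2 * F \<epsilon> + 1) + 2 * F \<epsilon>) + 1"
    proof (rule hitting_time[where R = "N0 * (2 * F \<epsilon> + 1) + 2 * F \<epsilon>"])
      show "0 \<le> N0 * (2 * F \<epsilon> + 1) + 2 * F \<epsilon>" using N0 F0 by simp
      fix K assume K: "\<And>k. k \<le> K \<Longrightarrow> \<epsilon> < g k"
      have "real K \<le> (C + \<eta> / (c2 * \<epsilon> powr (3/2))) * (2 * F \<epsilon> + 1) + 2 * F \<epsilon>" by (rule main[OF elim(5) K])
      also have "\<dots> \<le> N0 * (2 * F \<epsilon> + 1) + 2 * F \<epsilon>"
        unfolding N0_def using F0 by (intro add_right_mono mult_right_mono) auto
      finally show "real K \<le> N0 * (2 * F \<epsilon> + 1) + 2 * F \<epsilon>" .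
    qed
    moreover have "(N0 * (2 * F \<epsilon> + 1) + 2 * F \<epsilon>) + 1 \<le> A * p * Q"
    proof -
      have N0_eq: "N0 = \<bar>C\<bar> + A * l / 6 * p"
        using c2 unfolding N0_def \<eta>_def pinv[symmetric] by (simp add: field_simps)
      have "(N0 * (2 * F \<epsilon> + 1) + 2 * F \<epsilon>) + 1 = (N0 + 1) * (2 * F \<epsilon> + 1)" by (simp add: algebra_simps)
      also have "\<dots> \<le> (N0 + 1) * (3 / l * Q)" using elim N0 by (intro mult_left_mono) (auto simp: Q_def)
      also have "\<dots> = ((\<bar>C\<bar> + 1) * (3 / l) + A / 2 * p) * Q"
        using l by (simp add: N0_eq field_simps)
      also have "\<dots> \<le> (A * p) * Q"
        using elim(4) Q unfolding p_def by (intro mult_right_mono) linarith+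
      finally show ?thesis .
    qed
    ultimately show ?case unfolding p_def Q_def by (meson order_trans)
  qed
qed

text \<open>
  Here \<open>\<omega>f\<close> is the square root of the smallest gradient norm \<open>e k\<close> so far. If neither of two
  consecutive steps halves \<open>e\<close>, then both terms of the minimum in the threshold are at least a fixed
  multiple of \<open>\<epsilon> powr (3/2)\<close>. So every bad iteration is next to a halving of \<open>e\<close>.
\<close>

theorem bound_choice2:
  assumes c2: "reg_choice2 \<theta> g \<omega>t \<omega>f" and \<theta>: "\<theta> \<ge> 0" and A: "A > 0"
    and V: "V > 0" "\<And>k. g k \<le> V"
  shows "\<forall>\<^sub>F \<epsilon> in at_right 0. \<exists>k. g k \<le> \<epsilon> \<and> real k \<le> A * \<epsilon> powr (-3/2)"
proof -
  define \<kappa> where "\<kappa> = min (1/4) (((1/2) powr \<theta>) ^ 3)"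
  have \<kappa>: "0 < \<kappa>" "\<kappa> \<le> 1/4" "\<kappa> \<le> ((1/2) powr \<theta>) ^ 3" "\<kappa> \<le> 1" by (auto simp: \<kappa>_def)
  define c where "c = drop_const * \<kappa>"
  have c: "c > 0" using drop_const_pos \<kappa> by (simp add: c_def)
  \<comment> \<open>This \<open>\<eta>\<close> uses up half of \<open>A\<close>; the logarithm takes the other half.\<close>
  define \<eta> where "\<eta> = A * c / 2"
  have \<eta>: "\<eta> > 0" using A c by (simp add: \<eta>_def)
  from nonbad_count[OF \<eta>] obtain C where
    "\<forall>t>0. \<forall>K. (\<forall>k<K. M (Suc k) = M k / gam P \<longrightarrow> t \<le> f k - f (Suc k)) \<longrightarrow>
      real (card {k. k < K \<and> \<not> (M (Suc k) = M k \<and> f k - f (Suc k) < t)}) \<le> C + \<eta> / t" ..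
  note C = this[THEN spec, THEN mp, THEN spec, THEN mp]
  define e where "e = eps_seq g"
  have wf: "\<omega>f k = sqrt (e k)" and wt: "\<omega>t k = \<omega>f k * (e k * inverse (e (k - 1))) powr \<theta>" for k
    using c2 by (auto simp: reg_choice2_def e_def)
  have main: "real K \<le> C + \<eta> / (c * \<epsilon> powr (3/2)) + 2 / ln 2 * ln (V / \<epsilon>)"
    if \<epsilon>: "0 < \<epsilon>" and K: "\<And>k. k \<le> K \<Longrightarrow> \<epsilon> < g k" for \<epsilon> K
  proof -
    have e: "\<epsilon> < e k" if k: "k \<le> K" for k
    proof -
      obtain i where "i \<le> k" "e k = g i" using eps_seq_attained unfolding e_def by blast
      then show ?thesis using K[of i] k by simp
    qed
    define t where "t = c * \<epsilon> powr (3/2)"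
    have t: "t = drop_const * (\<kappa> * sqrt \<epsilon> ^ 3)" using \<epsilon> by (simp add: t_def c_def powr_three_halves)
    have t0: "t > 0" using c \<epsilon> by (simp add: t_def)
    have Gne: "G (x k) \<noteq> 0" if "k \<le> K" for k using K[OF that] \<epsilon> by (auto simp: g_def)
    have down: "\<forall>k<K. M (Suc k) = M k / gam P \<longrightarrow> t \<le> f k - f (Suc k)"
    proof (intro allI impI)
      fix k assume k: "k < K" and dn: "M (Suc k) = M k / gam P"
      have "drop_const * \<omega>f k ^ 3 \<le> f k - f (Suc k)"
        using estimate_reduced[OF Gne[of k] dn] k by simp
      moreover have "sqrt \<epsilon> ^ 3 \<le> \<omega>f k ^ 3" using e[of k] k \<epsilon> by (auto simp: wf intro!: power_mono)
      then have "\<kappa> * sqrt \<epsilon> ^ 3 \<le> 1 * \<omega>f k ^ 3" using \<kappa> \<epsilon> by (intro mult_mono) auto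
      then have "t \<le> drop_const * (1 * \<omega>f k ^ 3)" unfolding t using drop_const_pos by (intro mult_left_mono) auto
      ultimately show "t \<le> f k - f (Suc k)" by simp
    qed
    have bad: "e (Suc k) \<le> e k / 2 \<or> e k \<le> e (k - 1) / 2"
      if k: "k < K" and b: "M (Suc k) = M k \<and> f k - f (Suc k) < t" for k
    proof (rule ccontr)
      assume neg: "\<not> ?thesis"
      have km: "k - 1 \<le> K" using k by simp
      have ep: "e k > \<epsilon>" "e k > 0" "e (k - 1) > 0" using e[of k] e[OF km] k \<epsilon> by auto
      have big: "sqrt \<epsilon> ^ 3 \<le> sqrt (e k) ^ 3" using ep \<epsilon> by (intro power_mono) auto
      have Gk: "G (x k) \<noteq> 0" using Gne k by simp
      show False
        using Gk conjunct1[OF b]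
      proof (cases rule: estimate_kept)
        case (1 \<omega>)
        note same = 1
        have wle: "\<omega> \<le> sqrt (e k)" "0 < \<omega>" using same(1) regularizers[OF Gk] wf[of k] ep by auto
        have "drop_const * min ((g (Suc k))\<^sup>2 / \<omega>) (\<omega> ^ 3) < drop_const * (\<kappa> * sqrt \<epsilon> ^ 3)"
          using same(2) b t by linarith
        then have "min ((g (Suc k))\<^sup>2 / \<omega>) (\<omega> ^ 3) < \<kappa> * sqrt \<epsilon> ^ 3" using drop_const_pos by simp
        moreover have "\<kappa> * sqrt \<epsilon> ^ 3 \<le> (g (Suc k))\<^sup>2 / \<omega>"
        proof -
          have "e k / 2 \<le> g (Suc k)" using neg eps_seq_le[of "Suc k" "Suc k" g] by (simp add: e_def)
          then have "(e k / 2)\<^sup>2 \<le> (g (Suc k))\<^sup>2" using ep by (intro power_mono) auto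
          then have "(e k / 2)\<^sup>2 / sqrt (e k) \<le> (g (Suc k))\<^sup>2 / \<omega>" using wle ep by (intro frac_le) auto
          moreover have "(e k / 2)\<^sup>2 / sqrt (e k) = 1/4 * sqrt (e k) ^ 3"
          proof -
            define s where "s = sqrt (e k)"
            have s: "e k = s * s" "s > 0" using ep by (simp_all add: s_def)
            then show ?thesis
              unfolding s_def[symmetric] by (simp add: power2_eq_square power3_eq_cube)
          qed
          moreover have "\<kappa> * sqrt \<epsilon> ^ 3 \<le> 1/4 * sqrt (e k) ^ 3" using big \<kappa> \<epsilon> by (intro mult_mono) auto
          ultimately show ?thesis by linarith
        qed
        moreover have "\<kappa> * sqrt \<epsilon> ^ 3 \<le> \<omega> ^ 3"
        proof -
          have "(1/2) powr \<theta> \<le> (e k * inverse (e (k - 1))) powr \<theta>"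
            using neg ep \<theta> by (intro powr_mono2) (auto simp: field_simps)
          then have "sqrt (e k) * (1/2) powr \<theta> \<le> \<omega>t k" unfolding wt wf using ep by (intro mult_left_mono) auto
          also have "\<omega>t k \<le> \<omega>" using same(1) regularizers[OF Gne[of k]] k by auto
          finally have "(sqrt (e k) * (1/2) powr \<theta>) ^ 3 \<le> \<omega> ^ 3" using ep by (intro power_mono) auto
          moreover have "\<kappa> * sqrt \<epsilon> ^ 3 \<le> ((1/2) powr \<theta>) ^ 3 * sqrt (e k) ^ 3" using big \<kappa> \<epsilon> by (intro mult_mono) auto
          ultimately show ?thesis by (simp add: power_mult_distrib mult.commute)
        qed
        ultimately show False by simp
      qed
    qed
    define m where "m = card {k. k < K \<and> M (Suc k) = M k \<and> f k - f (Suc k) < t}"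
    have "e K * e (K - 1) * 2 ^ m \<le> (e 0)\<^sup>2"
      unfolding m_def
    proof (rule halving_count[where e = e and K = K and bad = "\<lambda>k. M (Suc k) = M k \<and> f k - f (Suc k) < t"])
      show "0 < e k" if "k \<le> K" for k using e[OF that] \<epsilon> by simp
      show "e (Suc k) \<le> e k" for k by (simp add: e_def eps_seq_Suc)
    qed (rule bad)
    moreover have "\<epsilon> * \<epsilon> \<le> e K * e (K - 1)" using e[of K] e[of "K - 1"] \<epsilon> by (intro mult_mono) auto
    then have "\<epsilon> * \<epsilon> * 2 ^ m \<le> e K * e (K - 1) * 2 ^ m" by (intro mult_right_mono) auto
    moreover have "(e 0)\<^sup>2 \<le> V\<^sup>2" using V(2)[of 0] g_pos[of 0] by (intro power_mono) (auto simp: e_def)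
    ultimately have "\<epsilon> * \<epsilon> * 2 ^ m \<le> V\<^sup>2" by linarith
    then have "\<epsilon>\<^sup>2 * 2 ^ m \<le> V\<^sup>2" by (simp add: power2_eq_square)
    then have "2 ^ m \<le> (V / \<epsilon>)\<^sup>2" using \<epsilon> by (simp add: power_divide pos_le_divide_eq mult.commute)
    then have "ln (2 ^ m) \<le> ln ((V / \<epsilon>)\<^sup>2)" using \<epsilon> V by (subst ln_le_cancel_iff) auto
    then have "m * ln 2 \<le> 2 * ln (V / \<epsilon>)" using \<epsilon> V by (simp add: ln_realpow)
    then have m: "real m \<le> 2 / ln 2 * ln (V / \<epsilon>)" by (simp add: pos_le_divide_eq)
    have "{..<K} = {k. k < K \<and> \<not> (M (Suc k) = M k \<and> f k - f (Suc k) < t)} \<union> {k. k < K \<and> M (Suc k) = M k \<and> f k - f (Suc k) < t}"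
      by auto
    then have "card {..<K} \<le> card {k. k < K \<and> \<not> (M (Suc k) = M k \<and> f k - f (Suc k) < t)} + m"
      unfolding m_def by (simp only: card_Un_le)
    then have "K \<le> card {k. k < K \<and> \<not> (M (Suc k) = M k \<and> f k - f (Suc k) < t)} + m" by simp
    then show ?thesis using C[OF t0 down] m unfolding t_def by linarith
  qed
  have ev1: "eventually (\<lambda>\<epsilon>. ln (V / \<epsilon>) \<ge> 1) (at_right 0)"
    using log_at_top[OF V(1)] by (auto simp: filterlim_at_top)
  have ev2: "eventually (\<lambda>\<epsilon>. \<bar>C\<bar> + 1 + 2 / ln 2 * ln (V / \<epsilon>) \<le> A / 2 * \<epsilon> powr (-3/2)) (at_right 0)"
    using log_dominated[OF V(1), of "A / 2" "\<bar>C\<bar> + 1" "2 / ln 2"] A by simp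
  show ?thesis
    using ev1 ev2 eventually_at_right_less[of "0::real"]
  proof eventually_elim
    case (elim \<epsilon>)
    have eq: "\<eta> / (c * \<epsilon> powr (3/2)) = A / 2 * \<epsilon> powr (-3/2)"
      using c elim by (simp add: \<eta>_def powr_minus_divide)
    define R where "R = \<bar>C\<bar> + \<eta> / (c * \<epsilon> powr (3/2)) + 2 / ln 2 * ln (V / \<epsilon>)"
    have "\<exists>k. g k \<le> \<epsilon> \<and> real k \<le> R + 1"
    proof (rule hitting_time[where R = R])
      show "0 \<le> R" using \<eta> c elim by (simp add: R_def)
      fix K assume K: "\<And>k. k \<le> K \<Longrightarrow> \<epsilon> < g k"
      have "real K \<le> C + \<eta> / (c * \<epsilon> powr (3/2)) + 2 / ln 2 * ln (V / \<epsilon>)" by (rule main[OF elim(3) K])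
      then show "real K \<le> R" unfolding R_def by linarith
    qed
    moreover have "R + 1 \<le> A * \<epsilon> powr (-3/2)" unfolding R_def eq using elim by simp
    ultimately show ?case by (meson order_trans)
  qed
qed

end

section \<open>Conjugate gradients on positive definite systems\<close>

locale convex_cg =
  fixes n :: nat and A :: "fsvec \<Rightarrow>\<^sub>L fsvec" and g :: fsvec and \<rho> m \<Lambda> :: real
  assumes g_Rn: "g \<in> Rn n" and A_Rn: "v \<in> Rn n \<Longrightarrow> blinfun_apply A v \<in> Rn n"
    and A_sym: "u \<in> Rn n \<Longrightarrow> v \<in> Rn n \<Longrightarrow> blinfun_apply A u \<bullet> v = u \<bullet> blinfun_apply A v"
    and A_pos: "v \<in> Rn n \<Longrightarrow> m * (norm v)\<^sup>2 \<le> v \<bullet> blinfun_apply A v"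
    and A_norm: "norm A + 2 * \<rho> \<le> \<Lambda>" and m_pos: "m > 0" and \<rho>_pos: "\<rho> > 0" and g_nonzero: "g \<noteq> 0"
begin

abbreviation Hb where "Hb \<equiv> cg_Hbar A \<rho>"
abbreviation y where "y \<equiv> cg_y A g \<rho>"
abbreviation r where "r \<equiv> cg_r A g \<rho>"
abbreviation p where "p \<equiv> cg_p A g \<rho>"

lemma iterates_Rn: "y k \<in> Rn n" "r k \<in> Rn n" "p k \<in> Rn n"
  by (rule cg_Rn; fact g_Rn A_Rn)+

lemma Hb_Rn: "v \<in> Rn n \<Longrightarrow> Hb v \<in> Rn n"
  unfolding cg_Hbar_def by (intro Rn_closed A_Rn)

lemma Hb_sym: "u \<in> Rn n \<Longrightarrow> v \<in> Rn n \<Longrightarrow> Hb u \<bullet> v = u \<bullet> Hb v"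
  by (simp add: cg_Hbar_def inner_add_left inner_add_right A_sym)

lemma Hb_pos: "v \<in> Rn n \<Longrightarrow> m * (norm v)\<^sup>2 \<le> v \<bullet> Hb v"
  and Hb_not_low: "v \<in> Rn n \<Longrightarrow> \<not> low_curv A \<rho> v"
proof -
  assume v: "v \<in> Rn n"
  have "v \<bullet> Hb v = v \<bullet> blinfun_apply A v + 2 * \<rho> * (norm v)\<^sup>2"
    by (simp add: cg_Hbar_def inner_add_right power2_norm_eq_inner)
  moreover have "0 \<le> m * (norm v)\<^sup>2" "0 \<le> \<rho> * (norm v)\<^sup>2" using m_pos \<rho>_pos by auto
  ultimately show "m * (norm v)\<^sup>2 \<le> v \<bullet> Hb v" "\<not> low_curv A \<rho> v"
    using A_pos[OF v] by (auto simp: low_curv_def)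
qed

lemma Hb_le: "v \<bullet> Hb v \<le> \<Lambda> * (norm v)\<^sup>2"
proof -
  have "v \<bullet> blinfun_apply A v \<le> norm v * norm (blinfun_apply A v)" by (rule norm_cauchy_schwarz)
  also have "\<dots> \<le> norm v * (norm A * norm v)" by (intro mult_left_mono norm_blinfun) auto
  also have "\<dots> = norm A * (norm v)\<^sup>2" by (simp add: power2_eq_square)
  finally have "v \<bullet> Hb v \<le> (norm A + 2 * \<rho>) * (norm v)\<^sup>2"
    by (simp add: cg_Hbar_def inner_add_right dot_square_norm distrib_right)
  also have "\<dots> \<le> \<Lambda> * (norm v)\<^sup>2" using A_norm by (intro mult_right_mono) auto
  finally show ?thesis .
qed

lemma m_le: "m \<le> \<Lambda>"
proof -
  have "m * (norm g)\<^sup>2 \<le> \<Lambda> * (norm g)\<^sup>2" using Hb_pos[OF g_Rn] Hb_le[of g] by linarith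
  then show ?thesis using g_nonzero mult_le_cancel_right_pos[of "(norm g)\<^sup>2" m \<Lambda>] by simp
qed

lemma \<Lambda>_pos: "\<Lambda> > 0" using m_le m_pos by simp

text \<open>
  Only relations between consecutive iterates are needed: \<open>r (Suc k)\<close> is orthogonal to \<open>p k\<close> and
  \<open>r k\<close>, and \<open>p (Suc k)\<close> is conjugate to \<open>p k\<close>. The last claim says that the CG direction has
  no more curvature than the residual, so that a CG step decreases the energy at least as much as a
  steepest descent step.
\<close>

lemma recurrence:
  assumes "\<And>j. j < k \<Longrightarrow> r j \<noteq> 0"
  shows "p k \<bullet> r k = - (norm (r k))\<^sup>2" "r k \<bullet> Hb (p k) = - (p k \<bullet> Hb (p k))"
    "p k \<bullet> Hb (p k) \<le> r k \<bullet> Hb (r k)"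
proof -
  have "p k \<bullet> r k = - (norm (r k))\<^sup>2 \<and> r k \<bullet> Hb (p k) = - (p k \<bullet> Hb (p k)) \<and>
    p k \<bullet> Hb (p k) \<le> r k \<bullet> Hb (r k)"
    using assms
  proof (induction k)
    case 0
    then show ?case by (simp add: power2_norm_eq_inner cg_Hbar_minus)
  next
    case (Suc k)
    define a where "a = (norm (r k))\<^sup>2 / (p k \<bullet> Hb (p k))"
    define b where "b = (norm (r (Suc k)))\<^sup>2 / (norm (r k))\<^sup>2"
    have IH: "p k \<bullet> r k = - (norm (r k))\<^sup>2" "r k \<bullet> Hb (p k) = - (p k \<bullet> Hb (p k))"
      using Suc by auto
    have rk: "r k \<noteq> 0" using Suc by auto
    have pk: "p k \<noteq> 0" using IH(1) rk by auto
    have "0 < m * (norm (p k))\<^sup>2" using pk m_pos by simp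
    then have pHp: "0 < p k \<bullet> Hb (p k)" using Hb_pos[OF iterates_Rn(3)[of k]] by linarith
    have a0: "a > 0" using rk pHp by (simp add: a_def)
    have aH: "a * (p k \<bullet> Hb (p k)) = (norm (r k))\<^sup>2" using pHp by (simp add: a_def)
    have r': "r (Suc k) = r k + a *\<^sub>R Hb (p k)" and p': "p (Suc k) = - r (Suc k) + b *\<^sub>R p k"
      by (simp_all add: cg_step(2,3) a_def b_def)
    have bn: "b * (norm (r k))\<^sup>2 = (norm (r (Suc k)))\<^sup>2" using rk by (simp add: b_def)
    have 1: "p k \<bullet> r (Suc k) = 0" by (simp add: r' inner_add_right IH aH)
    have 2: "r k \<bullet> r (Suc k) = 0"
      using aH by (simp add: r' inner_add_right IH power2_norm_eq_inner)
    have "a * (r (Suc k) \<bullet> Hb (p k)) = r (Suc k) \<bullet> (r (Suc k) - r k)"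
      by (simp add: r' inner_add_right)
    then have 3: "a * (r (Suc k) \<bullet> Hb (p k)) = (norm (r (Suc k)))\<^sup>2"
      using 2 by (simp add: inner_diff_right power2_norm_eq_inner inner_commute)
    have "a * (p (Suc k) \<bullet> Hb (p k)) = - (a * (r (Suc k) \<bullet> Hb (p k))) + b * (a * (p k \<bullet> Hb (p k)))"
      by (simp add: p' inner_add_left algebra_simps)
    then have "a * (p (Suc k) \<bullet> Hb (p k)) = 0" by (simp only: 3 aH bn)
    then have 4: "p (Suc k) \<bullet> Hb (p k) = 0" using a0 by simp
    then have 5: "p k \<bullet> Hb (p (Suc k)) = 0"
      using Hb_sym[OF iterates_Rn(3)[of k] iterates_Rn(3)[of "Suc k"]] by (simp add: inner_commute)
    have rp: "r (Suc k) = b *\<^sub>R p k - p (Suc k)" by (simp add: p')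
    have A1: "p (Suc k) \<bullet> r (Suc k) = - (norm (r (Suc k)))\<^sup>2"
      using 1 by (simp add: p' inner_diff_left inner_add_left power2_norm_eq_inner)
    have A2: "r (Suc k) \<bullet> Hb (p (Suc k)) = - (p (Suc k) \<bullet> Hb (p (Suc k)))"
      using 5 by (subst (1) rp) (simp add: inner_diff_left)
    have "r (Suc k) \<bullet> Hb (r (Suc k)) = b\<^sup>2 * (p k \<bullet> Hb (p k)) + p (Suc k) \<bullet> Hb (p (Suc k))"
      using 4 5 unfolding rp by (simp add: cg_Hbar_diff cg_Hbar_scaleR inner_diff_left inner_diff_right power2_eq_square)
    moreover have "0 \<le> b\<^sup>2 * (p k \<bullet> Hb (p k))" using pHp by simp
    ultimately show ?case using A1 A2 by linarith
  qed
  then show "p k \<bullet> r k = - (norm (r k))\<^sup>2" "r k \<bullet> Hb (p k) = - (p k \<bullet> Hb (p k))"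
    "p k \<bullet> Hb (p k) \<le> r k \<bullet> Hb (r k)" by auto
qed

definition energy where "energy v = 1/2 * (v \<bullet> Hb v) + g \<bullet> v"

lemma energy_add:
  assumes "v \<in> Rn n" "h \<in> Rn n"
  shows "energy (v + h) = energy v + (g + Hb v) \<bullet> h + 1/2 * (h \<bullet> Hb h)"
  using Hb_sym[OF assms]
  by (simp add: energy_def cg_Hbar_add inner_add_left inner_add_right inner_commute[of h "Hb v"] algebra_simps)

lemma energy_lower:
  assumes "v \<in> Rn n" "w \<in> Rn n"
  shows "energy v - (norm (g + Hb v))\<^sup>2 / (2 * m) \<le> energy w"
proof -
  let ?h = "w - v" and ?r = "g + Hb v"
  have h: "?h \<in> Rn n" using assms by (intro Rn_closed)
  \<comment> \<open>Minimizing \<open>m / 2 * s\<^sup>2 - norm ?r * s\<close> over \<open>s\<close>, by completing the square.\<close>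
  have "0 \<le> (norm ?r - m * norm ?h)\<^sup>2 / (2 * m)" using m_pos by simp
  also have "\<dots> = (norm ?r)\<^sup>2 / (2 * m) - norm ?r * norm ?h + m / 2 * (norm ?h)\<^sup>2"
    using m_pos by (simp add: power2_diff field_simps power2_eq_square)
  finally have "- (norm ?r)\<^sup>2 / (2 * m) \<le> - (norm ?r * norm ?h) + m / 2 * (norm ?h)\<^sup>2" by simp
  also have "\<dots> \<le> ?r \<bullet> ?h + 1/2 * (?h \<bullet> Hb ?h)"
    using Cauchy_Schwarz_ineq2[of ?r ?h] Hb_pos[OF h] by (simp add: abs_le_iff)
  also have "\<dots> = energy w - energy v" using energy_add[OF assms(1) h] by simp
  finally show ?thesis by simp
qed

text \<open>
  Using the infimum, which is bounded from both sides by squared residuals, avoids constructing the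
  solution of the linear system.
\<close>

definition energy_inf where "energy_inf = (INF v\<in>Rn n. energy v)"

lemma energy_inf_le: "v \<in> Rn n \<Longrightarrow> energy_inf \<le> energy v"
  unfolding energy_inf_def
proof -
  assume "v \<in> Rn n"
  have "bdd_below (energy ` Rn n)"
    using energy_lower[OF Rn_closed(1)] by (rule bdd_belowI2)
  then show "(INF v\<in>Rn n. energy v) \<le> energy v" using \<open>v \<in> Rn n\<close> by (rule cINF_lower)
qed

lemma energy_gap_upper: "v \<in> Rn n \<Longrightarrow> energy v - energy_inf \<le> (norm (g + Hb v))\<^sup>2 / (2 * m)"
proof -
  assume v: "v \<in> Rn n"
  have "energy v - (norm (g + Hb v))\<^sup>2 / (2 * m) \<le> energy_inf"
    unfolding energy_inf_def using energy_lower[OF v] v by (intro cINF_greatest) auto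
  then show ?thesis by simp
qed

text \<open>
  Compare with the point reached by a gradient step of length \<open>1 / \<Lambda>\<close>.
\<close>

lemma energy_gap_lower: "v \<in> Rn n \<Longrightarrow> (norm (g + Hb v))\<^sup>2 / (2 * \<Lambda>) \<le> energy v - energy_inf"
proof -
  assume v: "v \<in> Rn n"
  let ?r = "g + Hb v"
  have rR: "?r \<in> Rn n" using g_Rn Hb_Rn[OF v] by (intro Rn_closed)
  let ?h = "(- 1 / \<Lambda>) *\<^sub>R ?r"
  have h: "?h \<in> Rn n" using rR by (rule Rn_closed(4))
  have "energy_inf \<le> energy (v + ?h)" using v h by (intro energy_inf_le Rn_closed(2))
  also have "\<dots> = energy v - (norm ?r)\<^sup>2 / \<Lambda> + (1 / (2 * \<Lambda>\<^sup>2)) * (?r \<bullet> Hb ?r)"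
    unfolding energy_add[OF v h] cg_Hbar_scaleR
    by (simp add: dot_square_norm power2_eq_square)
  also have "\<dots> \<le> energy v - (norm ?r)\<^sup>2 / \<Lambda> + (1 / (2 * \<Lambda>\<^sup>2)) * (\<Lambda> * (norm ?r)\<^sup>2)"
    using Hb_le[of ?r] by (intro add_left_mono mult_left_mono) auto
  also have "\<dots> = energy v - (norm ?r)\<^sup>2 / (2 * \<Lambda>)"
    using \<Lambda>_pos by (simp add: power2_eq_square field_simps)
  finally show ?thesis by simp
qed

lemma energy_step:
  assumes "\<And>j. j < k \<Longrightarrow> r j \<noteq> 0" "r k \<noteq> 0"
  shows "energy (y (Suc k)) \<le> energy (y k) - (norm (r k))\<^sup>2 / (2 * \<Lambda>)"
proof -
  have R: "p k \<bullet> r k = - (norm (r k))\<^sup>2" "p k \<bullet> Hb (p k) \<le> r k \<bullet> Hb (r k)"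
    by (rule recurrence; fact assms(1))+
  have pk: "p k \<noteq> 0" using R(1) assms(2) by auto
  have "0 < m * (norm (p k))\<^sup>2" using pk m_pos by simp
  then have pHp: "0 < p k \<bullet> Hb (p k)" using Hb_pos[OF iterates_Rn(3)[of k]] by linarith
  define a where "a = (norm (r k))\<^sup>2 / (p k \<bullet> Hb (p k))"
  have a0: "a \<ge> 0" using pHp by (simp add: a_def)
  have y': "y (Suc k) = y k + a *\<^sub>R p k" by (simp add: cg_step(1) a_def)
  have ap: "a *\<^sub>R p k \<in> Rn n" using iterates_Rn(3) by (intro Rn_closed)
  have "energy (y (Suc k)) = energy (y k) + r k \<bullet> (a *\<^sub>R p k) + 1/2 * ((a *\<^sub>R p k) \<bullet> Hb (a *\<^sub>R p k))"
    using energy_add[OF iterates_Rn(1)[of k] ap] unfolding y' cg_residual[symmetric] .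
  also have "\<dots> = energy (y k) - a * (norm (r k))\<^sup>2 + 1/2 * (a * (a * (p k \<bullet> Hb (p k))))"
    using R(1) by (simp add: cg_Hbar_scaleR inner_commute[of "r k"])
  also have "a * (p k \<bullet> Hb (p k)) = (norm (r k))\<^sup>2" using pHp by (simp add: a_def)
  finally have "energy (y (Suc k)) = energy (y k) - (norm (r k))\<^sup>2 / 2 * a" by simp
  moreover have "(norm (r k))\<^sup>2 / 2 * (1 / \<Lambda>) \<le> (norm (r k))\<^sup>2 / 2 * a"
  proof (intro mult_left_mono)
    have "p k \<bullet> Hb (p k) \<le> \<Lambda> * (norm (r k))\<^sup>2" using R(2) Hb_le[of "r k"] by linarith
    then show "1 / \<Lambda> \<le> a" using pHp \<Lambda>_pos by (simp add: a_def field_simps)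
  qed simp
  ultimately show ?thesis by simp
qed

text \<open>
  Linear convergence with the rate of steepest descent, slower than the optimal CG rate but with a
  logarithm of the accuracy that the iteration cap dominates.
\<close>

lemma residual_bound:
  assumes "\<And>j. j < k \<Longrightarrow> r j \<noteq> 0"
  shows "(norm (r k))\<^sup>2 \<le> \<Lambda> / m * exp (- (real k * (m / \<Lambda>))) * (norm g)\<^sup>2"
proof -
  define e where "e k = energy (y k) - energy_inf" for k
  have gap: "(norm (r k))\<^sup>2 / (2 * \<Lambda>) \<le> e k" "e k \<le> (norm (r k))\<^sup>2 / (2 * m)" for k
    unfolding e_def cg_residual using energy_gap_lower energy_gap_upper iterates_Rn(1) by auto
  have q: "0 \<le> 1 - m / \<Lambda>" using m_le \<Lambda>_pos by simp
  have "e k \<le> (1 - m / \<Lambda>) ^ k * e 0"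
    using assms
  proof (induction k)
    case (Suc k)
    have "e (Suc k) \<le> e k - (norm (r k))\<^sup>2 / (2 * \<Lambda>)"
      using energy_step[of k] Suc.prems by (simp add: e_def)
    moreover have "m / \<Lambda> * e k \<le> (norm (r k))\<^sup>2 / (2 * \<Lambda>)"
    proof -
      have "m / \<Lambda> * e k \<le> m / \<Lambda> * ((norm (r k))\<^sup>2 / (2 * m))"
        using gap(2)[of k] m_pos \<Lambda>_pos by (intro mult_left_mono) auto
      then show ?thesis using m_pos by simp
    qed
    ultimately have "e (Suc k) \<le> e k - m / \<Lambda> * e k" by linarith
    also have "\<dots> = (1 - m / \<Lambda>) * e k" by (simp add: algebra_simps)
    also have "\<dots> \<le> (1 - m / \<Lambda>) * ((1 - m / \<Lambda>) ^ k * e 0)"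
      using Suc q by (intro mult_left_mono) auto
    finally show ?case by simp
  qed simp
  also have "\<dots> \<le> exp (- (m / \<Lambda>)) ^ k * ((norm g)\<^sup>2 / (2 * m))"
  proof (intro mult_mono power_mono)
    show "1 - m / \<Lambda> \<le> exp (- (m / \<Lambda>))" using exp_ge_add_one_self[of "- (m / \<Lambda>)"] by simp
    show "e 0 \<le> (norm g)\<^sup>2 / (2 * m)" using gap(2)[of 0] by simp
    have "0 \<le> (norm (r 0))\<^sup>2 / (2 * \<Lambda>)" using \<Lambda>_pos by simp
    then show "0 \<le> e 0" using gap(1)[of 0] by linarith
  qed (use q in auto)
  also have "exp (- (m / \<Lambda>)) ^ k = exp (- (real k * (m / \<Lambda>)))"
    by (simp add: exp_of_nat_mult[symmetric])
  finally have "(norm (r k))\<^sup>2 / (2 * \<Lambda>) \<le> exp (- (real k * (m / \<Lambda>))) * ((norm g)\<^sup>2 / (2 * m))"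
    using gap(1)[of k] by linarith
  then have "2 * \<Lambda> * ((norm (r k))\<^sup>2 / (2 * \<Lambda>)) \<le> 2 * \<Lambda> * (exp (- (real k * (m / \<Lambda>))) * ((norm g)\<^sup>2 / (2 * m)))"
    using \<Lambda>_pos by (intro mult_left_mono) auto
  then show ?thesis using \<Lambda>_pos by simp
qed

text \<open>
  The number of steps that leave the system unsolved is at most a constant plus a constant times
  \<open>l = ln (1 / \<xi>\<^sup>2)\<close>, and the cap is at least \<open>sqrt \<kappa>' * (1 + l)\<close>. The assumption
  \<open>cap\<close> says that \<open>\<rho>bar\<close> is small, hence \<open>\<kappa>'\<close> large, compared to these constants.
\<close>

lemma not_capped:
  assumes \<xi>: "0 \<le> \<xi>" "\<xi> \<le> 1" "\<xi> \<le> \<rho>" and \<rho>bar: "\<rho>bar > 0"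
    and cap: "max 2 (ln (9 * \<Lambda> ^ 3 / m)) \<le> sqrt (m / \<rho>bar) * (m / \<Lambda>)"
    and nz: "\<And>j. j < k \<Longrightarrow> r j \<noteq> 0" and unsolved: "\<not> cg_solved A g \<rho> \<xi> k"
  shows "\<not> cg_capped A g \<rho> \<xi> \<rho>bar k"
proof
  assume capped: "cg_capped A g \<rho> \<xi> \<rho>bar k"
  define \<kappa>' where "\<kappa>' = (cg_N A g \<rho> k + \<rho>bar) / \<rho>bar"
  define \<kappa> where "\<kappa> = cg_kappa A g \<rho> k"
  have \<xi>0: "\<xi> > 0"
  proof (rule ccontr)
    assume "\<not> \<xi> > 0"
    then have "\<xi> = 0" using \<xi> by simp
    then show False using capped by (simp add: cg_capped_def cg_J_def Let_def)
  qed
  define l where "l = ln (1 / \<xi>\<^sup>2)"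
  have "1 \<le> 1 / \<xi>\<^sup>2" using \<xi> \<xi>0 by (simp add: power_le_one)
  then have l: "l \<ge> 0" by (simp add: l_def)
  have Ng: "m \<le> cg_N A g \<rho> k"
  proof -
    have "m * (norm g)\<^sup>2 \<le> norm g * norm (blinfun_apply A g)"
      using A_pos[OF g_Rn] norm_cauchy_schwarz[of g "blinfun_apply A g"] by linarith
    then have "norm g * (m * norm g) \<le> norm g * norm (blinfun_apply A g)" by (simp add: power2_eq_square ac_simps)
    then have "m * norm g \<le> norm (blinfun_apply A g)" using g_nonzero by simp
    then have "m \<le> cg_ratio A g" using g_nonzero by (simp add: cg_ratio_def pos_le_divide_eq)
    then show ?thesis using cg_N_bounds(1) order_trans by blast
  qed
  have \<kappa>'1: "1 \<le> \<kappa>'" using Ng m_pos \<rho>bar by (auto simp: \<kappa>'_def)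
  have \<kappa>'2: "m / \<rho>bar \<le> \<kappa>'" unfolding \<kappa>'_def using Ng \<rho>bar by (intro divide_right_mono) auto
  define D where "D = max 2 (ln (9 * \<Lambda> ^ 3 / m))"
  have "sqrt (m / \<rho>bar) * (m / \<Lambda>) \<le> sqrt \<kappa>' * (m / \<Lambda>)"
    using \<kappa>'2 m_pos \<Lambda>_pos by (intro mult_right_mono) auto
  then have D: "D \<le> sqrt \<kappa>' * (m / \<Lambda>)" using cap by (simp add: D_def)
  have "ln (144 * (sqrt \<kappa>' + 1)\<^sup>2 * \<kappa>' ^ 6 / \<xi>\<^sup>2) \<ge> 1 + l"
  proof -
    have "(1::real) \<le> (sqrt \<kappa>' + 1)\<^sup>2" "1 \<le> \<kappa>' ^ 6" using \<kappa>'1 by (auto intro!: one_le_power)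
    then have "144 * 1 * 1 \<le> 144 * (sqrt \<kappa>' + 1)\<^sup>2 * \<kappa>' ^ 6" by (intro mult_mono) auto
    then have "144 / \<xi>\<^sup>2 \<le> 144 * (sqrt \<kappa>' + 1)\<^sup>2 * \<kappa>' ^ 6 / \<xi>\<^sup>2" by (intro divide_right_mono) auto
    then have "ln (144 / \<xi>\<^sup>2) \<le> ln (144 * (sqrt \<kappa>' + 1)\<^sup>2 * \<kappa>' ^ 6 / \<xi>\<^sup>2)"
      using \<xi>0 by (intro ln_mono) auto
    moreover have "ln (144 / \<xi>\<^sup>2) = ln 144 + l" using \<xi>0 by (simp add: l_def ln_div)
    moreover have "ln (144::real) \<ge> 1" using exp_le by (simp add: ln_ge_iff)
    ultimately show ?thesis by linarith
  qed
  then have "sqrt \<kappa>' * (1 + l) \<le> (sqrt \<kappa>' + 1/2) * ln (144 * (sqrt \<kappa>' + 1)\<^sup>2 * \<kappa>' ^ 6 / \<xi>\<^sup>2)"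
    using l \<kappa>'1 by (intro mult_mono) auto
  moreover have "1 + (sqrt \<kappa>' + 1/2) * ln (144 * (sqrt \<kappa>' + 1)\<^sup>2 * \<kappa>' ^ 6 / \<xi>\<^sup>2) + 1 \<le> real k"
    using capped \<xi>0 by (simp add: cg_capped_def cg_J_def Let_def \<kappa>'_def)
  ultimately have k: "sqrt \<kappa>' * (1 + l) \<le> real k" by linarith
  have "D * (1 + l) \<le> (sqrt \<kappa>' * (m / \<Lambda>)) * (1 + l)" using D l by (intro mult_right_mono) auto
  also have "\<dots> = (sqrt \<kappa>' * (1 + l)) * (m / \<Lambda>)" by simp
  also have "\<dots> \<le> real k * (m / \<Lambda>)" using k m_pos \<Lambda>_pos by (intro mult_right_mono) auto
  finally have low: "D * (1 + l) \<le> real k * (m / \<Lambda>)" .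
  have \<kappa>: "0 < \<kappa>" "\<kappa> \<le> \<Lambda> / \<xi>"
  proof -
    have N: "0 \<le> cg_N A g \<rho> k" "cg_N A g \<rho> k + 2 * \<rho> \<le> \<Lambda>" using cg_N_nonneg cg_N_bounds(2)[of A g \<rho> k] A_norm by auto
    then show "0 < \<kappa>" using \<rho>_pos by (simp add: \<kappa>_def cg_kappa_def)
    have "\<kappa> \<le> \<Lambda> / \<rho>" unfolding \<kappa>_def cg_kappa_def using N \<rho>_pos by (intro divide_right_mono) auto
    also have "\<dots> \<le> \<Lambda> / \<xi>" using \<xi> \<xi>0 \<Lambda>_pos by (intro divide_left_mono) auto
    finally show "\<kappa> \<le> \<Lambda> / \<xi>" .
  qed
  have "\<xi> / (3 * \<kappa>) * norm g < norm (r k)" using unsolved by (simp add: cg_solved_def \<kappa>_def)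
  then have "(\<xi> / (3 * \<kappa>) * norm g)\<^sup>2 < (norm (r k))\<^sup>2" using \<xi>0 \<kappa> by (intro power_strict_mono) auto
  also have "\<dots> \<le> \<Lambda> / m * exp (- (real k * (m / \<Lambda>))) * (norm g)\<^sup>2" by (rule residual_bound[OF nz])
  finally have "(\<xi> / (3 * \<kappa>))\<^sup>2 * (norm g)\<^sup>2 < \<Lambda> / m * exp (- (real k * (m / \<Lambda>))) * (norm g)\<^sup>2"
    by (simp only: power_mult_distrib)
  then have 1: "(\<xi> / (3 * \<kappa>))\<^sup>2 < \<Lambda> / m * exp (- (real k * (m / \<Lambda>)))"
    by (rule mult_less_cancel_right_pos[THEN iffD1, rotated]) (use g_nonzero in simp)
  have "\<xi> / (3 * (\<Lambda> / \<xi>)) \<le> \<xi> / (3 * \<kappa>)" using \<kappa> \<xi>0 \<Lambda>_pos by (intro divide_left_mono mult_pos_pos divide_pos_pos) auto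
  then have "(\<xi> / (3 * (\<Lambda> / \<xi>)))\<^sup>2 \<le> (\<xi> / (3 * \<kappa>))\<^sup>2" using \<xi>0 \<Lambda>_pos by (intro power_mono) auto
  then have "(\<xi> / (3 * (\<Lambda> / \<xi>)))\<^sup>2 < \<Lambda> / m * exp (- (real k * (m / \<Lambda>)))" using 1 by linarith
  moreover have "(\<xi> / (3 * (\<Lambda> / \<xi>)))\<^sup>2 = (\<xi>\<^sup>2)\<^sup>2 / (9 * \<Lambda>\<^sup>2)"
    using \<xi>0 by (simp add: power2_eq_square)
  ultimately have "(\<xi>\<^sup>2)\<^sup>2 / (9 * \<Lambda>\<^sup>2) < \<Lambda> / m * exp (- (real k * (m / \<Lambda>)))" by simp
  then have "(\<xi>\<^sup>2)\<^sup>2 / (9 * \<Lambda>\<^sup>2) * exp (real k * (m / \<Lambda>)) < \<Lambda> / m * exp (- (real k * (m / \<Lambda>))) * exp (real k * (m / \<Lambda>))"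
    by (intro mult_strict_right_mono) auto
  also have "\<dots> = \<Lambda> / m" by (simp add: exp_minus)
  finally have "exp (real k * (m / \<Lambda>)) < 9 * \<Lambda> ^ 3 / m * (1 / \<xi>\<^sup>2)\<^sup>2"
    using \<xi>0 \<Lambda>_pos m_pos by (simp add: field_simps power2_eq_square power3_eq_cube)
  then have "ln (exp (real k * (m / \<Lambda>))) < ln (9 * \<Lambda> ^ 3 / m * (1 / \<xi>\<^sup>2)\<^sup>2)"
    using \<xi>0 \<Lambda>_pos m_pos by (subst ln_less_cancel_iff) auto
  also have "\<dots> = ln (9 * \<Lambda> ^ 3 / m) + ln ((1 / \<xi>\<^sup>2)\<^sup>2)"
    using \<xi>0 \<Lambda>_pos m_pos by (intro ln_mult_pos) auto
  also have "ln ((1 / \<xi>\<^sup>2)\<^sup>2) = 2 * l" using \<xi>0 by (simp add: l_def ln_realpow[of "1 / \<xi>\<^sup>2"])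
  finally have "real k * (m / \<Lambda>) < ln (9 * \<Lambda> ^ 3 / m) + 2 * l" by simp
  also have "\<dots> \<le> D + D * l" using l by (intro add_mono mult_right_mono) (auto simp: D_def)
  finally show False using low by (simp add: distrib_left)
qed

text \<open>
  On a positive definite system no test for low curvature can succeed, in particular not the search for
  the index \<open>i\<close> after slow progress; and \<open>not_capped\<close> rules out the iteration cap.
\<close>

lemma capped_cg_solves:
  assumes \<xi>: "0 \<le> \<xi>" "\<xi> \<le> 1" "\<xi> \<le> \<rho>" and \<rho>bar: "\<rho>bar > 0"
    and cap: "max 2 (ln (9 * \<Lambda> ^ 3 / m)) \<le> sqrt (m / \<rho>bar) * (m / \<Lambda>)"
    and cg: "capped_cg A g \<rho> \<xi> \<rho>bar (ty, d)"
  shows "ty = SOL"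
proof -
  have "\<not> low_curv A \<rho> (p 0)" using iterates_Rn(3) by (rule Hb_not_low)
  then obtain k where k: "k \<ge> 1" "\<And>j. 1 \<le> j \<Longrightarrow> j < k \<Longrightarrow> \<not> cg_stops A g \<rho> \<xi> \<rho>bar j"
    and ret: "cg_returns A g \<rho> \<xi> \<rho>bar k (ty, d)"
    using cg unfolding capped_cg_def by (auto simp del: cg_start)
  have nz: "r j \<noteq> 0" if "j < k" for j
  proof (cases "j = 0")
    case False
    then have "\<not> cg_solved A g \<rho> \<xi> j" using k(2)[of j] that by (simp add: cg_stops_def)
    moreover have "0 \<le> \<xi> / (3 * cg_kappa A g \<rho> j) * norm (r 0)"
      using \<xi> \<rho>_pos cg_N_nonneg[of A g \<rho> j] by (auto simp: cg_kappa_def)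
    ultimately show ?thesis by (auto simp: cg_solved_def)
  qed (use g_nonzero in simp)
  have low: "\<not> low_curv A \<rho> (y k)" "\<not> low_curv A \<rho> (p k)" "\<not> low_curv A \<rho> (y (Suc k) - y i)" for i
    using iterates_Rn Rn_closed(3) by (auto intro!: Hb_not_low simp del: cg_start)
  show ?thesis
  proof (cases "cg_solved A g \<rho> \<xi> k")
    case True
    then show ?thesis using ret low by (simp add: cg_returns_def)
  next
    case False
    from not_capped[OF \<xi> \<rho>bar cap nz False] show ?thesis
      using ret low False by (auto simp: cg_returns_def split: if_splits)
  qed
qed

end

section \<open>From superlinear to quadratic convergence\<close>

text \<open>
  A rate of order \<open>\<nu>\<close> bounds \<open>g (Suc k) / g k\<close> by a power \<open>1 - 1 / \<nu>\<close> of
  \<open>g (Suc k)\<close>, which raises the exponent of the first summand of the recursion.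
\<close>

lemma superlinear_improves:
  fixes g :: "nat \<Rightarrow> real"
  assumes pos: "\<And>k. 0 < g k"
    and rec: "eventually (\<lambda>k. g (Suc (Suc k)) \<le> K * g (Suc k) * (sqrt (g (Suc k)) * (g (Suc k) / g k) powr \<theta> + g (Suc k))) sequentially"
    and small: "eventually (\<lambda>k. g k \<le> 1) sequentially" and K: "K > 0" and \<theta>: "\<theta> > 0"
    and \<nu>: "\<nu> > 0" "\<nu>' \<le> 2" "\<nu>' \<le> 3/2 + \<theta> * (1 - 1 / \<nu>)"
    and rate: "\<exists>C. eventually (\<lambda>k. g (Suc k) \<le> C * g k powr \<nu>) sequentially"
  shows "\<exists>C. eventually (\<lambda>k. g (Suc k) \<le> C * g k powr \<nu>') sequentially"
proof -
  obtain C0 where C0: "eventually (\<lambda>k. g (Suc k) \<le> C0 * g k powr \<nu>) sequentially" using rate by blast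
  define C where "C = max C0 1"
  have C: "C \<ge> 1" by (simp add: C_def)
  define D where "D = K * ((C powr (1 / \<nu>)) powr \<theta> + 1)"
  have small': "eventually (\<lambda>k. g (Suc k) \<le> 1) sequentially"
    by (rule eventually_sequentially_Suc[of "\<lambda>k. g k \<le> 1", THEN iffD2, OF small])
  have "eventually (\<lambda>k. g (Suc (Suc k)) \<le> D * g (Suc k) powr \<nu>') sequentially"
    using C0 rec small'
  proof eventually_elim
    case (elim k)
    define a where "a = g (Suc k)"
    have a: "0 < a" "a \<le> 1" using pos elim by (auto simp: a_def)
    have "a \<le> C * g k powr \<nu>"
      using elim(1) mult_right_mono[of C0 C "g k powr \<nu>"] by (simp add: a_def C_def)
    then have "(a / C) powr (1 / \<nu>) \<le> (g k powr \<nu>) powr (1 / \<nu>)"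
      using a C \<nu> by (intro powr_mono2) (auto simp: field_simps)
    then have "(a / C) powr (1 / \<nu>) \<le> g k" using \<nu> pos[of k] by (simp add: powr_powr)
    moreover have "(a / C) powr (1 / \<nu>) = a powr (1 / \<nu>) / C powr (1 / \<nu>)"
      using a C by (simp add: powr_divide)
    ultimately have "a powr (1 / \<nu>) \<le> C powr (1 / \<nu>) * g k" using C by (simp add: field_simps)
    then have "a / g k \<le> a * (C powr (1 / \<nu>) / a powr (1 / \<nu>))"
      using a pos[of k] by (simp add: field_simps)
    also have "\<dots> = C powr (1 / \<nu>) * a powr (1 - 1 / \<nu>)" using a by (simp add: powr_diff)
    finally have "(a / g k) powr \<theta> \<le> (C powr (1 / \<nu>) * a powr (1 - 1 / \<nu>)) powr \<theta>"
      using a pos[of k] \<theta> by (intro powr_mono2) (auto simp: less_imp_le)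
    also have "\<dots> = (C powr (1 / \<nu>)) powr \<theta> * a powr (\<theta> * (1 - 1 / \<nu>))"
      by (simp add: powr_mult powr_powr mult.commute)
    finally have "sqrt a * (a / g k) powr \<theta> \<le> a powr (1/2) * ((C powr (1 / \<nu>)) powr \<theta> * a powr (\<theta> * (1 - 1 / \<nu>)))"
      using a by (simp add: powr_half_sqrt mult_left_mono)
    also have "\<dots> = (C powr (1 / \<nu>)) powr \<theta> * a powr (1/2 + \<theta> * (1 - 1 / \<nu>))" by (simp add: powr_add)
    finally have "K * a * (sqrt a * (a / g k) powr \<theta> + a)
        \<le> K * a * ((C powr (1 / \<nu>)) powr \<theta> * a powr (1/2 + \<theta> * (1 - 1 / \<nu>)) + a)"
      using K a by (intro mult_left_mono add_right_mono) auto
    also have "\<dots> = K * ((C powr (1 / \<nu>)) powr \<theta> * (a powr 1 * a powr (1/2 + \<theta> * (1 - 1 / \<nu>))) + a powr 2)"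
      using a by (simp add: algebra_simps power2_eq_square)
    also have "a powr 1 * a powr (1/2 + \<theta> * (1 - 1 / \<nu>)) = a powr (1 + (1/2 + \<theta> * (1 - 1 / \<nu>)))"
      by (simp only: powr_add)
    also have "1 + (1/2 + \<theta> * (1 - 1 / \<nu>)) = 3/2 + \<theta> * (1 - 1 / \<nu>)" by simp
    also have "K * ((C powr (1 / \<nu>)) powr \<theta> * a powr (3/2 + \<theta> * (1 - 1 / \<nu>)) + a powr 2)
        \<le> K * ((C powr (1 / \<nu>)) powr \<theta> * a powr \<nu>' + a powr \<nu>')"
      using a \<nu> K by (intro mult_left_mono add_mono powr_mono') auto
    also have "\<dots> = D * a powr \<nu>'" by (simp add: D_def algebra_simps)
    finally show ?case using elim(2) by (simp add: a_def)
  qed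
  then have "eventually (\<lambda>k. g (Suc k) \<le> D * g k powr \<nu>') sequentially"
    using eventually_sequentially_Suc[of "\<lambda>k. g (Suc k) \<le> D * g k powr \<nu>'"] by blast
  then show ?thesis by blast
qed

text \<open>
  The map \<open>\<nu> \<mapsto> 3/2 + \<theta> * (1 - 1 / \<nu>)\<close> exceeds the identity on \<open>[3/2, 2]\<close> by at least
  \<open>h = (\<theta> - 1) / 3\<close>: for \<open>\<theta> = 1\<close> the difference is nonnegative, as
  \<open>(\<nu> - 2) * (\<nu> - 1/2) \<le> 0\<close>. So finitely many improvements lead from \<open>3/2\<close> to \<open>2\<close>.
\<close>

lemma quadratic_rate:
  fixes g :: "nat \<Rightarrow> real"
  assumes pos: "\<And>k. 0 < g k"
    and rec: "eventually (\<lambda>k. g (Suc (Suc k)) \<le> K * g (Suc k) * (sqrt (g (Suc k)) * (g (Suc k) / g k) powr \<theta> + g (Suc k))) sequentially"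
    and small: "eventually (\<lambda>k. g k \<le> 1) sequentially" and K: "K > 0" and \<theta>: "\<theta> > 1"
    and base: "\<exists>C. eventually (\<lambda>k. g (Suc k) \<le> C * g k powr (3/2)) sequentially"
  shows "\<exists>C. eventually (\<lambda>k. g (Suc k) \<le> C * (g k)\<^sup>2) sequentially"
proof -
  define h where "h = (\<theta> - 1) / 3"
  have h: "h > 0" "\<theta> = 1 + 3 * h" using \<theta> by (simp_all add: h_def field_simps)
  have step: "min 2 (\<nu> + h) \<le> 3/2 + \<theta> * (1 - 1 / \<nu>)" if "3/2 \<le> \<nu>" "\<nu> \<le> 2" for \<nu>
  proof -
    have "1/3 \<le> 1 - 1 / \<nu>" using that by (simp add: field_simps)
    then have "3 * h * (1/3) \<le> 3 * h * (1 - 1 / \<nu>)" using h by (intro mult_left_mono) auto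
    moreover have "\<nu> \<le> 5/2 - 1 / \<nu>"
    proof -
      have "(\<nu> - 2) * (\<nu> - 1/2) \<le> 0" using that by (intro mult_nonpos_nonneg) auto
      moreover have "(\<nu> - 2) * (\<nu> - 1/2) = \<nu> * \<nu> - 5/2 * \<nu> + 1" by (simp add: field_simps)
      ultimately have "\<nu> * \<nu> + 1 \<le> 5/2 * \<nu>" by linarith
      then show ?thesis using that by (simp add: field_simps)
    qed
    moreover have "\<theta> * (1 - 1 / \<nu>) = (1 - 1 / \<nu>) + 3 * h * (1 - 1 / \<nu>)" unfolding h(2) by (simp add: algebra_simps)
    ultimately show ?thesis by linarith
  qed
  have "\<exists>C. eventually (\<lambda>k. g (Suc k) \<le> C * g k powr (min 2 (3/2 + real j * h))) sequentially" for j
  proof (induction j)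
    case 0
    then show ?case using base by simp
  next
    case (Suc j)
    let ?\<nu> = "min 2 (3/2 + real j * h)"
    have nu: "3/2 \<le> ?\<nu>" "?\<nu> \<le> 2" using h by auto
    have "min 2 (3/2 + real (Suc j) * h) = min 2 (?\<nu> + h)" using h by (auto simp: min_def algebra_simps)
    then show ?case
      using superlinear_improves[OF pos rec small K _ _ _ _ Suc, of "min 2 (?\<nu> + h)"] step[OF nu] nu \<theta>
      by simp
  qed
  moreover obtain j where "1 / (2 * h) \<le> real j" using real_arch_simple by blast
  then have "min 2 (3/2 + real j * h) = 2" using h by (simp add: field_simps min_def)
  ultimately have "\<exists>C. eventually (\<lambda>k. g (Suc k) \<le> C * g k powr 2) sequentially" by metis
  then show ?thesis using pos by (simp add: less_imp_le)
qed

section \<open>Behaviour near a nondegenerate minimizer\<close>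

context newton_direction
begin

context
  fixes m :: real
  assumes m_pos: "m > 0" and pos: "\<And>v. v \<in> Rn n \<Longrightarrow> m * (norm v)\<^sup>2 \<le> v \<bullet> blinfun_apply (H x) v"
begin

lemma local_cg_solves:
  assumes "\<rho> \<le> 1"
    and cap: "max 2 (ln (9 * (B + 2) ^ 3 / m)) \<le> sqrt (m / (tau P * sqrt M * \<omega>bar)) * (m / (B + 2))"
  shows "ty = SOL"
proof -
  interpret cc: convex_cg n "H x" "G x" \<rho> m "B + 2"
    using B(2)[OF x] assms(1) m_pos \<rho>_pos gx pos G_Rn[OF xR] H_Rn[OF xR] Hessian_symmetric[OF x]
    by unfold_locales auto
  have "0 < tau P * sqrt M * \<omega>bar" using param_facts M \<omega> by simp
  from cc.capped_cg_solves[OF cg_args _ this cap cg[unfolded newton_cg_def \<rho>_def[symmetric]]]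
  show ?thesis by simp
qed

lemma local_step_length:
  assumes ty: "ty = SOL" shows "m * norm dt \<le> norm (G x)"
proof -
  have "m * (norm dt)\<^sup>2 + 2 * \<rho> * (norm dt)\<^sup>2 \<le> dt \<bullet> r - dt \<bullet> G x"
    using pos[OF dtR] Hbar_eq slope_eq by simp
  moreover have "- (dt \<bullet> G x) \<le> norm dt * norm (G x)"
    using Cauchy_Schwarz_ineq2[of dt "G x"] by (simp add: abs_le_iff)
  moreover have "dt \<bullet> r \<le> 2/5 * \<rho> * (norm dt)\<^sup>2" using sol_inner_residual[OF ty] by (simp add: abs_le_iff)
  moreover have "0 \<le> \<rho> * (norm dt)\<^sup>2" using \<rho>_pos by simp
  ultimately have "m * (norm dt)\<^sup>2 \<le> norm dt * norm (G x)" by linarith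
  then have "norm dt * (m * norm dt) \<le> norm dt * norm (G x)" by (simp add: power2_eq_square ac_simps)
  then show ?thesis using sol_nonzero[OF ty] by simp
qed

text \<open>
  Near a nondegenerate minimizer the step is a perturbed Newton step of length \<open>O(norm (G x))\<close>. The
  expansion then satisfies the sufficient decrease condition with the margin \<open>1/2 - \<mu>\<close>, and the new
  gradient consists of the residual, the regularization and the Taylor remainder.
\<close>

lemma local_full_step:
  assumes ty: "ty = SOL" and small: "norm (G x) < m * \<delta>" "L * norm (G x) \<le> (1/2 - mu P) * m\<^sup>2"
  shows "armijo P \<phi> G x dt 1 0"
    and "norm (G (x + dt)) \<le> norm (G x) / m * (12/5 * \<rho> + L / m * norm (G x))"
proof -
  define a where "a = norm (G x) / m"
  have a: "norm dt \<le> a" using local_step_length[OF ty] m_pos by (simp add: a_def field_simps)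
  have "m * norm dt < m * \<delta>" using local_step_length[OF ty] small(1) by linarith
  then have short: "norm dt < \<delta>" using m_pos mult_less_cancel_left_pos by blast
  have Ldt: "L * norm dt \<le> (1/2 - mu P) * m"
  proof -
    have "L * norm dt \<le> L * a" using a L_pos by (intro mult_left_mono) auto
    also have "\<dots> \<le> (1/2 - mu P) * m" using small(2) m_pos by (simp add: a_def field_simps power2_eq_square)
    finally show ?thesis .
  qed
  have slope: "dt \<bullet> G x \<le> - (dt \<bullet> blinfun_apply (H x) dt)" using sol_curvature_slope[OF ty] by simp
  have "m * (norm dt)\<^sup>2 \<le> - (dt \<bullet> G x)" using slope pos[OF dtR] by linarith
  then have "(1/2 - mu P) * (m * (norm dt)\<^sup>2) \<le> (1/2 - mu P) * - (dt \<bullet> G x)"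
    using param_facts by (intro mult_left_mono) auto
  moreover have "L * norm dt * (norm dt)\<^sup>2 \<le> (1/2 - mu P) * m * (norm dt)\<^sup>2"
    using Ldt by (intro mult_right_mono) auto
  ultimately have "L * norm dt ^ 3 \<le> (1/2 - mu P) * - (dt \<bullet> G x)"
    by (simp add: power2_eq_square power3_eq_cube mult.assoc)
  then have "L * norm dt ^ 3 \<le> 1/2 * - (dt \<bullet> G x) + mu P * (dt \<bullet> G x)"
    by (simp add: algebra_simps)
  then show "armijo P \<phi> G x dt 1 0"
    using objective_taylor[OF x dtR short] slope by (simp add: armijo_def inner_commute)
  have "norm (r - (2 * \<rho>) *\<^sub>R dt) \<le> norm r + norm ((2 * \<rho>) *\<^sub>R dt)" by (rule norm_triangle_ineq4)
  also have "norm ((2 * \<rho>) *\<^sub>R dt) = 2 * \<rho> * norm dt" using \<rho>_pos by simp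
  also have "norm r + 2 * \<rho> * norm dt \<le> 12/5 * \<rho> * norm dt" using sol_residual[OF ty] by linarith
  finally have "norm (G (x + dt)) \<le> 12/5 * \<rho> * norm dt + L * (norm dt)\<^sup>2"
    using gradient_after_full_step[OF ty short] by linarith
  also have "\<dots> \<le> 12/5 * \<rho> * a + L * a\<^sup>2"
    using a \<rho>_pos L_pos by (intro add_mono mult_left_mono power_mono) auto
  also have "\<dots> = a * (12/5 * \<rho> + L * a)" by (simp add: power2_eq_square algebra_simps)
  finally show "norm (G (x + dt)) \<le> norm (G x) / m * (12/5 * \<rho> + L / m * norm (G x))"
    by (simp add: a_def)
qed

end

end

context arncg_sequence
begin

text \<open>
  As the gradient norm is at least halved, no fallback step is taken, so the trial step determines the
  next iterate. The assumptions \<open>s1\<close> to \<open>s4\<close> all hold for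
  small \<open>g k\<close>; see \<open>local_regime\<close>.
\<close>

lemma local_iteration:
  assumes m: "m > 0" and Gne: "G (x k) \<noteq> 0"
    and pos: "\<And>v. v \<in> Rn n \<Longrightarrow> m * (norm v)\<^sup>2 \<le> v \<bullet> blinfun_apply (H (x k)) v"
    and s1: "sqrt M_max * sqrt (g k) \<le> 1"
    and s2: "max 2 (ln (9 * (B + 2) ^ 3 / m)) \<le> sqrt (m / (sqrt M_max * sqrt (g k))) * (m / (B + 2))"
    and s3: "g k < m * \<delta>" "L * g k \<le> (1/2 - mu P) * m\<^sup>2"
    and K: "K = (12/5 * sqrt M_max + L / m) / m" and s4: "K * (2 * sqrt (g k)) \<le> 1/2" "g k \<le> 1"
  shows "norm (x (Suc k) - x k) \<le> g k / m" "g (Suc k) \<le> g k / 2" "g (Suc k) \<le> K * g k * (\<omega>t k + g k)"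
proof -
  have reg: "0 < \<omega>t k" "\<omega>t k \<le> \<omega>f k" "\<omega>f k \<le> sqrt (g k)" using regularizers[OF Gne] by (auto simp: g_def)
  obtain ty dt where tr: "tr k = (ty, dt)" by (cases "tr k")
  have "newton_cg P G H (x k) (\<omega>t k) (M k) (\<omega>f k) (ty, dt)"
    using run Gne tr unfolding arncg_run_def by metis
  then interpret nd: newton_direction n \<phi> G H x0 L N P "x k" "\<omega>t k" "M k" "\<omega>f k" ty dt
    using iterate_level estimate_pos Gne reg by unfold_locales (auto simp: g_def)
  have gp: "g k > 0" using Gne by (simp add: g_def)
  have sM: "sqrt (M k) \<le> sqrt M_max" using estimate_bounded by simp
  have \<rho>_le: "nd.\<rho> \<le> sqrt M_max * \<omega>t k" unfolding nd.\<rho>_def using sM reg by (intro mult_right_mono) auto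
  have "sqrt M_max * \<omega>t k \<le> sqrt M_max * sqrt (g k)" using reg M_max_pos by (intro mult_left_mono) auto
  then have \<rho>1: "nd.\<rho> \<le> 1" using \<rho>_le s1 by linarith
  have "tau P * sqrt (M k) * \<omega>f k \<le> 1 * sqrt M_max * sqrt (g k)"
    using sM reg param_facts estimate_pos[of k] M_max_pos by (intro mult_mono) auto
  then have "m / (sqrt M_max * sqrt (g k)) \<le> m / (tau P * sqrt (M k) * \<omega>f k)"
    using m reg param_facts estimate_pos[of k] M_max_pos gp by (intro divide_left_mono) auto
  then have "sqrt (m / (sqrt M_max * sqrt (g k))) * (m / (B + 2)) \<le> sqrt (m / (tau P * sqrt (M k) * \<omega>f k)) * (m / (B + 2))"
    using m B(1) by (intro mult_right_mono) auto
  then have ty: "ty = SOL"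
    using s2 by (intro nd.local_cg_solves[OF m pos \<rho>1]) auto
  note step = nd.local_full_step[OF m pos ty s3[unfolded g_def]]
  have len: "norm dt \<le> g k / m" using nd.local_step_length[OF m pos ty] m by (simp add: g_def field_simps)
  have Kp: "K > 0" using m M_max_pos L_pos unfolding K by (intro divide_pos_pos add_pos_pos) auto
  have new: "norm (G (x k + dt)) \<le> K * g k * (\<omega>t k + g k)"
  proof -
    have "12/5 * nd.\<rho> + L / m * g k \<le> 12/5 * sqrt M_max * \<omega>t k + L / m * g k" using \<rho>_le by simp
    also have "\<dots> \<le> (12/5 * sqrt M_max + L / m) * \<omega>t k + (12/5 * sqrt M_max + L / m) * g k"
      using m M_max_pos L_pos reg gp by (intro add_mono mult_right_mono) auto
    finally have "12/5 * nd.\<rho> + L / m * g k \<le> (12/5 * sqrt M_max + L / m) * (\<omega>t k + g k)"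
      by (simp only: distrib_left)
    then have "g k / m * (12/5 * nd.\<rho> + L / m * g k) \<le> g k / m * ((12/5 * sqrt M_max + L / m) * (\<omega>t k + g k))"
      using gp m by (intro mult_left_mono) auto
    also have "\<dots> = K * g k * (\<omega>t k + g k)" unfolding K by simp
    finally show ?thesis using step(2) by (simp add: g_def)
  qed
  have half: "norm (G (x k + dt)) \<le> g k / 2"
  proof -
    have "g k \<le> sqrt (g k)" using gp s4(2) by (simp add: real_le_rsqrt power2_eq_square mult_left_le)
    then have "\<omega>t k + g k \<le> 2 * sqrt (g k)" using reg by linarith
    then have "K * (\<omega>t k + g k) \<le> K * (2 * sqrt (g k))" using Kp by (intro mult_left_mono) auto
    then have "K * (\<omega>t k + g k) \<le> 1/2" using s4(1) by linarith
    then have "g k * (K * (\<omega>t k + g k)) \<le> g k * (1/2)" using gp by (intro mult_left_mono) auto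
    then show ?thesis using new by (simp add: mult.commute mult.left_commute)
  qed
  have f0: "first_upto (m_max P) (armijo P \<phi> G (x k) dt 1) = Some 0"
    using step(1) param_facts unfolding first_upto_def
    by (auto intro!: exI[of _ 0] Least_equality)
  then obtain M' where tres: "trial_result P \<phi> G H \<omega>t \<omega>f x M tr k = Some (x k + dt, M')"
    by (simp add: trial_result_def newton_result_def tr ty accept_step_def Let_def)
  have "\<not> needs_fallback P \<phi> G H \<omega>t \<omega>f x M tr k"
  proof -
    have "norm (G (x k + dt)) \<le> norm (G (x k))" using half gp unfolding g_def by linarith
    then show ?thesis by (simp add: needs_fallback_def tres)
  qed
  then have "trial_result P \<phi> G H \<omega>t \<omega>f x M tr k = Some (x (Suc k), M (Suc k))"
    using run Gne unfolding arncg_run_def by metis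
  then have x': "x (Suc k) = x k + dt" using tres by simp
  show "norm (x (Suc k) - x k) \<le> g k / m" using len by (simp add: x')
  show "g (Suc k) \<le> g k / 2" using half by (simp add: x' g_def)
  show "g (Suc k) \<le> K * g k * (\<omega>t k + g k)" using new by (simp add: x' g_def)
qed

lemma local_regime:
  assumes m: "m > 0"
    and near: "\<And>y v. y \<in> Rn n \<Longrightarrow> dist y xs < rad \<Longrightarrow> v \<in> Rn n \<Longrightarrow> m * (norm v)\<^sup>2 \<le> v \<bullet> blinfun_apply (H y) v"
  shows "\<exists>\<gamma> K. 0 < \<gamma> \<and> \<gamma> \<le> 1 \<and> 0 < K \<and> (\<forall>k. dist (x k) xs < rad \<and> g k \<le> \<gamma> \<longrightarrow>
       norm (x (Suc k) - x k) \<le> g k / m \<and> g (Suc k) \<le> g k / 2 \<and> (g k > 0 \<longrightarrow> g (Suc k) \<le> K * g k * (\<omega>t k + g k)))"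
proof -
  define K where "K = (12/5 * sqrt M_max + L / m) / m"
  have Kp: "K > 0" using m M_max_pos L_pos unfolding K_def by (intro divide_pos_pos add_pos_pos) auto
  define D where "D = max 2 (ln (9 * (B + 2) ^ 3 / m))"
  \<comment> \<open>Regularizers up to \<open>m / Q\<^sup>2\<close> make the iteration cap of CG large enough.\<close>
  define Q where "Q = D * (B + 2) / m"
  have D: "D \<ge> 2" by (simp add: D_def)
  have Q: "Q > 0" using D B(1) m by (simp add: Q_def)
  have lim: "((\<lambda>y. c * sqrt y) \<longlongrightarrow> 0) (at_right 0)" "((\<lambda>y. c * y) \<longlongrightarrow> 0) (at_right 0)" for c :: real
    by (auto intro!: tendsto_eq_intros)
  have "\<forall>\<^sub>F y in at_right 0. sqrt M_max * sqrt y < 1 \<and> sqrt M_max * sqrt y < m / Q\<^sup>2 \<and> 1 * y < m * \<delta> \<and>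
      L * y < (1/2 - mu P) * m\<^sup>2 \<and> (2 * K) * sqrt y < 1/2 \<and> 1 * y < 1"
    using m Q \<delta>_pos param_facts
    by (intro eventually_conj order_tendstoD(2)[OF lim(1)] order_tendstoD(2)[OF lim(2)]) auto
  then obtain b where b: "b > 0" and small: "\<And>y. 0 < y \<Longrightarrow> y < b \<Longrightarrow> sqrt M_max * sqrt y < 1 \<and> sqrt M_max * sqrt y < m / Q\<^sup>2 \<and>
      y < m * \<delta> \<and> L * y < (1/2 - mu P) * m\<^sup>2 \<and> 2 * K * sqrt y < 1/2 \<and> y < 1"
    by (auto simp: eventually_at_right_field)
  have "norm (x (Suc k) - x k) \<le> g k / m \<and> g (Suc k) \<le> g k / 2 \<and> (g k > 0 \<longrightarrow> g (Suc k) \<le> K * g k * (\<omega>t k + g k))"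
    if "dist (x k) xs < rad \<and> g k \<le> min 1 (b / 2)" for k
  proof -
    have d: "dist (x k) xs < rad" and gk: "g k \<le> min 1 (b / 2)" using that by auto
    show "norm (x (Suc k) - x k) \<le> g k / m \<and> g (Suc k) \<le> g k / 2 \<and> (g k > 0 \<longrightarrow> g (Suc k) \<le> K * g k * (\<omega>t k + g k))"
    proof (cases "G (x k) = 0")
      case True
      then show ?thesis using stationary[OF True] by (simp add: g_def)
    next
      case False
      then have gp: "g k > 0" "g k < b" using gk b by (auto simp: g_def)
      note s = small[OF gp]
      have sp: "0 < sqrt M_max * sqrt (g k)" using gp M_max_pos by simp
      have "Q\<^sup>2 \<le> m / (sqrt M_max * sqrt (g k))"
      proof -
        have "(sqrt M_max * sqrt (g k)) * Q\<^sup>2 \<le> m" using s Q by (simp add: pos_less_divide_eq less_imp_le)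
        then show ?thesis using sp by (simp add: pos_le_divide_eq mult.commute)
      qed
      then have "Q \<le> sqrt (m / (sqrt M_max * sqrt (g k)))" using Q by (simp add: real_le_rsqrt)
      then have "Q * (m / (B + 2)) \<le> sqrt (m / (sqrt M_max * sqrt (g k))) * (m / (B + 2))"
        using m B(1) by (intro mult_right_mono) auto
      moreover have "Q * (m / (B + 2)) = D" using m B(1) by (simp add: Q_def)
      ultimately have s2: "D \<le> sqrt (m / (sqrt M_max * sqrt (g k))) * (m / (B + 2))" by simp
      have "norm (x (Suc k) - x k) \<le> g k / m" "g (Suc k) \<le> g k / 2" "g (Suc k) \<le> K * g k * (\<omega>t k + g k)"
        using local_iteration[OF m False near[OF iterate_Rn d] _ s2[unfolded D_def] _ _ K_def] s by auto
      then show ?thesis by simp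
    qed
  qed
  moreover have "0 < min 1 (b / 2)" "min 1 (b / 2) \<le> 1" using b by auto
  ultimately show ?thesis using Kp by (intro exI[of _ "min 1 (b / 2)"] exI[of _ K]) simp
qed

text \<open>
  The step lengths are at most \<open>g / m\<close> and \<open>g\<close> is halved each time, so the iterates move at most
  \<open>2 / m * g k\<close> away from \<open>x k\<close>; the induction carries the telescoped form of this bound.
\<close>

lemma local_stay:
  assumes m: "m > 0"
    and reg: "\<And>k. dist (x k) xs < rad \<Longrightarrow> g k \<le> \<gamma> \<Longrightarrow> norm (x (Suc k) - x k) \<le> g k / m \<and> g (Suc k) \<le> g k / 2"
    and start: "dist (x k) xs < r / 2" "2 / m * g k < r / 2" "g k \<le> \<gamma>" and r: "r \<le> rad"
  shows "dist (x (k + i)) xs < r \<and> g (k + i) \<le> \<gamma>"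
proof -
  have "norm (x (k + i) - x k) \<le> 2 / m * (g k - g (k + i)) \<and> dist (x (k + i)) xs < r \<and> g (k + i) \<le> \<gamma>"
  proof (induction i)
    case 0
    have "dist (x k) xs < r" using start(1) zero_le_dist[of "x k" xs] by linarith
    then show ?case using start(3) by simp
  next
    case (Suc i)
    then have s: "norm (x (Suc (k + i)) - x (k + i)) \<le> g (k + i) / m" "g (Suc (k + i)) \<le> g (k + i) / 2"
      using reg[of "k + i"] r by auto
    have "norm (x (Suc (k + i)) - x k) \<le> norm (x (Suc (k + i)) - x (k + i)) + norm (x (k + i) - x k)"
      using norm_triangle_ineq[of "x (Suc (k + i)) - x (k + i)" "x (k + i) - x k"] by simp
    also have "\<dots> \<le> g (k + i) / m + 2 / m * (g k - g (k + i))" using s Suc by linarith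
    also have "g (k + i) / m \<le> 2 / m * (g (k + i) - g (Suc (k + i)))"
      using s(2) m by (simp add: field_simps)
    finally have 1: "norm (x (Suc (k + i)) - x k) \<le> 2 / m * (g k - g (Suc (k + i)))"
      by (simp add: right_diff_distrib)
    also have "\<dots> \<le> 2 / m * g k" using m g_pos by (intro mult_left_mono) auto
    finally have "dist (x (Suc (k + i))) (x k) < r / 2" using start(2) by (simp add: dist_norm)
    then have "dist (x (Suc (k + i))) xs < r"
      using dist_triangle[of "x (Suc (k + i))" xs "x k"] start(1) by linarith
    moreover have "g (Suc (k + i)) \<le> \<gamma>" using s(2) Suc g_pos[of "k + i"] by linarith
    ultimately show ?case using 1 by simp
  qed
  then show ?thesis by simp
qed

end

text \<open>
  Eventually \<open>g\<close> is decreasing and below all its early values. Thus the two choices of the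
  regularizers eventually coincide.
\<close>

lemma eps_seq_eventually:
  fixes g :: "nat \<Rightarrow> real"
  assumes pos: "\<And>k. 0 < g k" and lim: "g \<longlonglongrightarrow> 0" and dec: "eventually (\<lambda>k. g (Suc k) \<le> g k) sequentially"
  shows "eventually (\<lambda>k. eps_seq g k = g k) sequentially"
proof -
  obtain N where N: "\<And>k. k \<ge> N \<Longrightarrow> g (Suc k) \<le> g k" using dec by (auto simp: eventually_sequentially)
  have anti: "g k \<le> g i" if "N \<le> i" "i \<le> k" for i k
    using that(2)
  proof (induction rule: dec_induct)
    case (step j)
    then show ?case using N[of j] that by linarith
  qed simp
  obtain j where "eps_seq g N = g j" using eps_seq_attained by blast
  then have "0 < eps_seq g N" using pos by simp
  then have "eventually (\<lambda>k. g k < eps_seq g N) sequentially" by (intro order_tendstoD(2)[OF lim]) auto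
  then show ?thesis using eventually_ge_at_top[of N]
  proof eventually_elim
    case (elim k)
    obtain i where i: "i \<le> k" "eps_seq g k = g i" using eps_seq_attained by blast
    have le: "eps_seq g k \<le> g k" by (rule eps_seq_le) simp
    have "N \<le> i"
    proof (rule ccontr)
      assume "\<not> N \<le> i"
      then have "eps_seq g N \<le> g i" by (intro eps_seq_le) simp
      then show False using elim le i by simp
    qed
    then show ?case using anti[of i k] i le by simp
  qed
qed

context arncg_sequence
begin

lemma gradient_limit:
  assumes "xs \<in> Rn n" "G xs = 0" "(x \<circ> s) \<longlonglongrightarrow> xs"
  shows "(g \<circ> s) \<longlonglongrightarrow> 0"
proof -
  have "(\<lambda>j. G ((x \<circ> s) j)) \<longlonglongrightarrow> G xs"
    by (rule continuous_on_tendsto_compose[OF continuous_G assms(3,1)]) (simp add: iterate_Rn)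
  then have "(\<lambda>j. norm (G ((x \<circ> s) j))) \<longlonglongrightarrow> norm (G xs)" by (rule tendsto_norm)
  then show ?thesis using assms(2) by (simp add: g_def comp_def)
qed

theorem local_convergence:
  assumes s: "strict_mono s" "(x \<circ> s) \<longlonglongrightarrow> xs" and xs: "xs \<in> Rn n" "G xs = 0"
    and m: "m > 0" and rad: "rad > 0"
    and near: "\<And>y v. y \<in> Rn n \<Longrightarrow> dist y xs < rad \<Longrightarrow> v \<in> Rn n \<Longrightarrow> m * (norm v)\<^sup>2 \<le> v \<bullet> blinfun_apply (H y) v"
    and choice: "reg_choice1 \<theta> g \<omega>t \<omega>f \<or> reg_choice2 \<theta> g \<omega>t \<omega>f" and \<theta>: "\<theta> > 1"
  shows "x \<longlonglongrightarrow> xs" "\<exists>C. \<forall>\<^sub>F k in sequentially. g (Suc k) \<le> C * (g k)\<^sup>2"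
proof -
  have "\<exists>\<gamma> K. 0 < \<gamma> \<and> \<gamma> \<le> 1 \<and> 0 < K \<and> (\<forall>k. dist (x k) xs < rad \<and> g k \<le> \<gamma> \<longrightarrow>
       norm (x (Suc k) - x k) \<le> g k / m \<and> g (Suc k) \<le> g k / 2 \<and> (g k > 0 \<longrightarrow> g (Suc k) \<le> K * g k * (\<omega>t k + g k)))"
    by (rule local_regime; fact m near)
  then obtain \<gamma> K where R: "0 < \<gamma> \<and> \<gamma> \<le> 1 \<and> 0 < K \<and> (\<forall>k. dist (x k) xs < rad \<and> g k \<le> \<gamma> \<longrightarrow>
       norm (x (Suc k) - x k) \<le> g k / m \<and> g (Suc k) \<le> g k / 2 \<and> (g k > 0 \<longrightarrow> g (Suc k) \<le> K * g k * (\<omega>t k + g k)))"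
    by (elim exE)
  have \<gamma>: "0 < \<gamma>" "\<gamma> \<le> 1" and K: "0 < K" using R by auto
  have regime: "norm (x (Suc k) - x k) \<le> g k / m \<and> g (Suc k) \<le> g k / 2 \<and> (g k > 0 \<longrightarrow> g (Suc k) \<le> K * g k * (\<omega>t k + g k))"
    if "dist (x k) xs < rad" "g k \<le> \<gamma>" for k
    using R that by simp
  have gs: "(g \<circ> s) \<longlonglongrightarrow> 0" by (rule gradient_limit[OF xs s(2)])
  have gs': "(\<lambda>j. 2 / m * (g \<circ> s) j) \<longlonglongrightarrow> 0" using tendsto_mult_left[OF gs, of "2 / m"] by simp
  have stay: "\<exists>k0. \<forall>k\<ge>k0. dist (x k) xs < r \<and> g k \<le> \<gamma>" if r: "0 < r" "r \<le> rad" for r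
  proof -
    have "eventually (\<lambda>j. dist ((x \<circ> s) j) xs < r / 2 \<and> 2 / m * (g \<circ> s) j < r / 2 \<and> (g \<circ> s) j < \<gamma>) sequentially"
      using r \<gamma> by (intro eventually_conj tendstoD[OF s(2)] order_tendstoD(2)[OF gs'] order_tendstoD(2)[OF gs]) auto
    then obtain j where j: "dist (x (s j)) xs < r / 2" "2 / m * g (s j) < r / 2" "g (s j) < \<gamma>"
      by (auto simp: eventually_sequentially)
    have "dist (x (s j + i)) xs < r \<and> g (s j + i) \<le> \<gamma>" for i
      by (rule local_stay[where r = r and rad = rad and \<gamma> = \<gamma> and k = "s j", OF m _ j(1,2) less_imp_le[OF j(3)] r(2)])
         (use regime in auto)
    then show ?thesis by (metis le_add_diff_inverse)
  qed
  show conv: "x \<longlonglongrightarrow> xs"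
  proof (rule metric_LIMSEQ_I)
    fix r :: real assume "0 < r"
    then show "\<exists>no. \<forall>n\<ge>no. dist (x n) xs < r" using stay[of "min r rad"] rad by auto
  qed
  obtain k0 where k0: "\<And>k. k \<ge> k0 \<Longrightarrow> dist (x k) xs < rad \<and> g k \<le> \<gamma>" using stay[OF rad] by auto
  have g0: "g \<longlonglongrightarrow> 0" using gradient_limit[OF xs, of id] conv by simp
  show "\<exists>C. \<forall>\<^sub>F k in sequentially. g (Suc k) \<le> C * (g k)\<^sup>2"
  proof (cases "\<exists>k. G (x k) = 0")
    case True
    then obtain k where k: "G (x k) = 0" by blast
    have "G (x (k + i)) = 0" for i by (induction i) (use k stationary in auto)
    then have "g (Suc j) \<le> 0 * (g j)\<^sup>2" if "j \<ge> k" for j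
      using that by (metis add_Suc_right g_def le_add_diff_inverse mult_zero_left norm_zero order_refl)
    then show ?thesis unfolding eventually_sequentially by blast
  next
    case False
    then have gp: "g k > 0" for k by (simp add: g_def)
    have ev: "eventually (\<lambda>k. g (Suc k) \<le> g k / 2 \<and> g (Suc k) \<le> K * g k * (\<omega>t k + g k) \<and> g k \<le> 1) sequentially"
      unfolding eventually_sequentially using regime k0 gp \<gamma> by (intro exI[of _ k0]) force
    have dec: "eventually (\<lambda>k. g (Suc k) \<le> g k) sequentially"
      using ev
    proof eventually_elim
      case (elim k)
      then show ?case using gp[of k] by linarith
    qed
    have wt: "eventually (\<lambda>k. \<omega>t (Suc k) \<le> sqrt (g (Suc k)) * (g (Suc k) / g k) powr \<theta>) sequentially"
      using choice
    proof
      assume c: "reg_choice1 \<theta> g \<omega>t \<omega>f"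
      show ?thesis using dec
      proof eventually_elim
        case (elim k)
        have "\<omega>t (Suc k) = sqrt (g (Suc k)) * min 1 (g (Suc k) / g k) powr \<theta>"
          using c by (simp add: reg_choice1_def divide_inverse)
        moreover have "min 1 (g (Suc k) / g k) = g (Suc k) / g k" using elim gp[of k] by simp
        ultimately show ?case by simp
      qed
    next
      assume c: "reg_choice2 \<theta> g \<omega>t \<omega>f"
      have e: "eventually (\<lambda>k. eps_seq g k = g k) sequentially" by (rule eps_seq_eventually[OF gp g0 dec])
      then have e': "eventually (\<lambda>k. eps_seq g (Suc k) = g (Suc k)) sequentially"
        by (rule eventually_sequentially_Suc[of "\<lambda>k. eps_seq g k = g k", THEN iffD2])
      show ?thesis using e e'
      proof eventually_elim
        case (elim k)
        have "\<omega>t (Suc k) = sqrt (eps_seq g (Suc k)) * (eps_seq g (Suc k) / eps_seq g k) powr \<theta>"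
          using c by (simp add: reg_choice2_def divide_inverse)
        then show ?case by (simp add: elim)
      qed
    qed
    have ev': "eventually (\<lambda>k. g (Suc (Suc k)) \<le> K * g (Suc k) * (\<omega>t (Suc k) + g (Suc k))) sequentially"
      using ev eventually_sequentially_Suc[of "\<lambda>k. g (Suc k) \<le> K * g k * (\<omega>t k + g k)"]
      by (auto elim: eventually_mono)
    show ?thesis
    proof (rule quadratic_rate[OF gp _ _ K \<theta>])
      show "eventually (\<lambda>k. g (Suc (Suc k)) \<le> K * g (Suc k) * (sqrt (g (Suc k)) * (g (Suc k) / g k) powr \<theta> + g (Suc k))) sequentially"
        using ev' wt
      proof eventually_elim
        case (elim k)
        have "K * g (Suc k) * (\<omega>t (Suc k) + g (Suc k)) \<le> K * g (Suc k) * (sqrt (g (Suc k)) * (g (Suc k) / g k) powr \<theta> + g (Suc k))"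
          using elim K gp[of "Suc k"] by (intro mult_left_mono add_right_mono) auto
        with elim show ?case by linarith
      qed
      show "eventually (\<lambda>k. g k \<le> 1) sequentially" using ev by eventually_elim simp
      have "eventually (\<lambda>k. g (Suc k) \<le> (2 * K) * g k powr (3/2)) sequentially"
        using ev
      proof eventually_elim
        case (elim k)
        have "\<omega>t k \<le> sqrt (g k)" using regularizers[of k] gp[of k] by (force simp: g_def)
        moreover have "g k \<le> sqrt (g k)" using gp[of k] elim by (simp add: real_le_rsqrt power2_eq_square mult_left_le)
        ultimately have "K * g k * (\<omega>t k + g k) \<le> K * g k * (2 * sqrt (g k))"
          using K gp[of k] by (intro mult_left_mono) auto
        also have "\<dots> = (2 * K) * sqrt (g k) ^ 3" using gp[of k] by (simp add: power3_eq_cube)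
        also have "sqrt (g k) ^ 3 = g k powr (3/2)" using gp[of k] by (simp add: powr_three_halves)
        finally show ?case using elim by linarith
      qed
      then show "\<exists>C. eventually (\<lambda>k. g (Suc k) \<le> C * g k powr (3/2)) sequentially" by blast
    qed
  qed
qed

text \<open>
  If no gradient vanishes, then gradient norms below the minimum of the first \<open>N\<close> ones occur after
  \<open>N\<close> only, which gives a subsequence of iterates with gradients tending to zero; compactness of the
  level set refines it to a convergent one.
\<close>

theorem stationary_limit_point:
  assumes hit: "\<And>\<epsilon>. \<epsilon> > 0 \<Longrightarrow> \<exists>k. g k \<le> \<epsilon>"
  shows "\<exists>s xs. strict_mono s \<and> (x \<circ> s) \<longlonglongrightarrow> xs \<and> xs \<in> Rn n \<and> G xs = 0"
proof (cases "\<exists>k. G (x k) = 0")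
  case True
  then obtain k where k: "G (x k) = 0" by blast
  have c: "x (k + i) = x k" for i by (induction i) (use k stationary in auto)
  have "strict_mono (\<lambda>i. k + i)" by (simp add: strict_mono_def)
  moreover have "(x \<circ> (\<lambda>i. k + i)) \<longlonglongrightarrow> x k" by (simp add: comp_def c)
  ultimately show ?thesis using k iterate_Rn by blast
next
  case False
  then have gp: "g k > 0" for k by (simp add: g_def)
  have later: "\<exists>k>N. g k \<le> \<epsilon>" if \<epsilon>: "\<epsilon> > 0" for N \<epsilon>
  proof -
    obtain j where "eps_seq g N = g j" using eps_seq_attained by blast
    then have e: "0 < eps_seq g N" using gp by simp
    then have "0 < min \<epsilon> (eps_seq g N / 2)" using \<epsilon> by simp
    then obtain k where k: "g k \<le> min \<epsilon> (eps_seq g N / 2)" using hit by blast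
    have "k > N"
    proof (rule ccontr)
      assume "\<not> k > N"
      then have "eps_seq g N \<le> g k" by (intro eps_seq_le) simp
      then show False using k e by simp
    qed
    with k show ?thesis by auto
  qed
  obtain t where t: "\<And>j. g (t j) \<le> 1 / real (Suc j) \<and> t j < t (Suc j)"
  proof -
    have "\<exists>t. \<forall>j. g (t j) \<le> 1 / real (Suc j) \<and> t j < t (Suc j)"
    proof (rule dependent_nat_choice)
      show "\<exists>k. g k \<le> 1 / real (Suc 0)" using hit[of 1] by simp
      show "\<exists>k. g k \<le> 1 / real (Suc (Suc j)) \<and> i < k" for i j
        using later[of "1 / real (Suc (Suc j))" i] by auto
    qed
    then show thesis using that by blast
  qed
  have "strict_mono t" using t by (simp add: strict_mono_Suc_iff)
  obtain l r where l: "l \<in> S" "strict_mono r" "((x \<circ> t) \<circ> r) \<longlonglongrightarrow> l"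
    using compact_level[unfolded compact_eq_seq_compact_metric seq_compact_def] iterate_level
    by (metis comp_apply)
  have "(\<lambda>j. G (((x \<circ> t) \<circ> r) j)) \<longlonglongrightarrow> G l"
    by (rule continuous_on_tendsto_compose[OF continuous_G l(3) S_Rn[OF l(1)]]) (simp add: iterate_Rn)
  then have 1: "(\<lambda>j. norm (G (((x \<circ> t) \<circ> r) j))) \<longlonglongrightarrow> norm (G l)" by (rule tendsto_norm)
  have "(\<lambda>j. g (t j)) \<longlonglongrightarrow> 0"
    by (rule tendsto_sandwich[OF _ _ tendsto_const LIMSEQ_Suc[OF lim_1_over_n]])
       (use t gp in \<open>auto intro!: always_eventually less_imp_le\<close>)
  then have "((\<lambda>j. g (t j)) \<circ> r) \<longlonglongrightarrow> 0" by (rule LIMSEQ_subseq_LIMSEQ) (rule l(2))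
  then have "norm (G l) = 0" using LIMSEQ_unique[OF 1] by (simp add: g_def comp_def)
  then show ?thesis
    using l S_Rn \<open>strict_mono t\<close> strict_mono_o[of t r] by (metis comp_assoc norm_eq_zero)
qed

end

context smooth_problem
begin

lemma uniformly_convex_near:
  assumes xs: "xs \<in> Rn n" and pd: "\<forall>v\<in>Rn n - {0}. v \<bullet> blinfun_apply (H xs) v > 0"
  shows "\<exists>m>0. \<exists>rad>0. \<forall>y\<in>Rn n. dist y xs < rad \<longrightarrow>
    (\<forall>v\<in>Rn n. m * (norm v)\<^sup>2 \<le> v \<bullet> blinfun_apply (H y) v)"
proof -
  obtain m where m: "m > 0" "\<And>v. v \<in> Rn n \<Longrightarrow> m * (norm v)\<^sup>2 \<le> v \<bullet> blinfun_apply (H xs) v"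
    using pos_def_uniform_Rn[OF pd] by blast
  obtain rad where rad: "rad > 0" "\<And>y. y \<in> Rn n \<Longrightarrow> dist y xs < rad \<Longrightarrow> dist (H y) (H xs) < m / 2"
    using continuous_H xs m(1) unfolding continuous_on_iff by (meson half_gt_zero)
  have "m / 2 * (norm v)\<^sup>2 \<le> v \<bullet> blinfun_apply (H y) v"
    if y: "y \<in> Rn n" "dist y xs < rad" and v: "v \<in> Rn n" for y v
  proof -
    have "v \<bullet> blinfun_apply (H xs) v - v \<bullet> blinfun_apply (H y) v = v \<bullet> blinfun_apply (H xs - H y) v"
      by (simp add: blinfun.diff_left inner_diff_right)
    also have "\<dots> \<le> norm v * norm (blinfun_apply (H xs - H y) v)" by (rule norm_cauchy_schwarz)
    also have "\<dots> \<le> norm v * (m / 2 * norm v)"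
    proof (intro mult_left_mono)
      have "norm (blinfun_apply (H xs - H y) v) \<le> norm (H xs - H y) * norm v" by (rule norm_blinfun)
      also have "\<dots> \<le> m / 2 * norm v"
        using rad(2)[OF y] by (intro mult_right_mono) (auto simp: dist_norm norm_minus_commute)
      finally show "norm (blinfun_apply (H xs - H y) v) \<le> m / 2 * norm v" .
    qed simp
    also have "\<dots> = m / 2 * (norm v)\<^sup>2" by (simp add: power2_eq_square)
    finally show ?thesis using m(2)[OF v] by linarith
  qed
  then show ?thesis using m(1) rad(1) by (intro exI[of _ "m / 2"] exI[of _ rad] conjI) auto
qed

text \<open>
  Along every ray from \<open>xs\<close> the slope of the objective starts at zero and increases.
\<close>

lemma strict_second_order_minimum:
  assumes xs: "xs \<in> Rn n" "G xs = 0" and m: "m > 0"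
    and near: "\<And>y v. y \<in> Rn n \<Longrightarrow> dist y xs < rad \<Longrightarrow> v \<in> Rn n \<Longrightarrow> m * (norm v)\<^sup>2 \<le> v \<bullet> blinfun_apply (H y) v"
    and y: "y \<in> Rn n" "dist y xs < rad"
  shows "\<phi> xs \<le> \<phi> y"
proof -
  define h where "h = y - xs"
  have h: "h \<in> Rn n" unfolding h_def using xs y by (intro Rn_closed)
  have in_ball: "xs + t *\<^sub>R h \<in> Rn n" "dist (xs + t *\<^sub>R h) xs < rad" if "0 \<le> t" "t \<le> 1" for t
  proof -
    show "xs + t *\<^sub>R h \<in> Rn n" by (rule line_Rn[OF xs(1) h])
    have "norm (t *\<^sub>R h) \<le> norm h" using that by (simp add: mult_left_le_one_le)
    then show "dist (xs + t *\<^sub>R h) xs < rad" using y(2) by (simp add: dist_norm h_def)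
  qed
  have slope: "0 \<le> G (xs + t *\<^sub>R h) \<bullet> h" if t: "0 \<le> t" "t \<le> 1" for t
  proof -
    have "G (xs + 0 *\<^sub>R h) \<bullet> h \<le> G (xs + t *\<^sub>R h) \<bullet> h"
    proof (rule DERIV_nonneg_imp_nondecreasing[OF t(1), of "\<lambda>t. G (xs + t *\<^sub>R h) \<bullet> h"])
      fix u assume u: "0 \<le> u" "u \<le> t"
      have "0 \<le> m * (norm h)\<^sup>2" using m by simp
      also have "\<dots> \<le> h \<bullet> blinfun_apply (H (xs + u *\<^sub>R h)) h" using in_ball[of u] u t h by (intro near) auto
      finally show "\<exists>z. ((\<lambda>t. G (xs + t *\<^sub>R h) \<bullet> h) has_real_derivative z) (at u) \<and> 0 \<le> z"
        using G_along_line[OF xs(1) h, of h u] by (auto simp: inner_commute)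
    qed
    then show ?thesis using xs(2) by simp
  qed
  have "\<phi> (xs + 0 *\<^sub>R h) \<le> \<phi> (xs + 1 *\<^sub>R h)"
  proof (rule DERIV_nonneg_imp_nondecreasing[of 0 1 "\<lambda>t. \<phi> (xs + t *\<^sub>R h)"])
    fix t :: real assume "0 \<le> t" "t \<le> 1"
    then show "\<exists>z. ((\<lambda>t. \<phi> (xs + t *\<^sub>R h)) has_real_derivative z) (at t) \<and> 0 \<le> z"
      using phi_along_line[OF xs(1) h, of t] slope by blast
  qed simp
  then show ?thesis by (simp add: h_def)
qed

lemma objective_bdd_below: "bdd_below (\<phi> ` Rn n)"
proof -
  have "continuous_on S \<phi>" using S_Rn by (intro continuous_on_subset[OF continuous_phi]) auto
  from continuous_attains_inf[OF compact_level _ this] x0_S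
  obtain y where y: "y \<in> S" "\<And>z. z \<in> S \<Longrightarrow> \<phi> y \<le> \<phi> z" by auto
  have "\<phi> y \<le> \<phi> z" if "z \<in> Rn n" for z
    using y that by (cases "\<phi> z \<le> \<phi> x0") (auto simp: level_set_def)
  then show ?thesis by (rule bdd_belowI2)
qed

lemma objective_gap_nonneg: "0 \<le> \<phi> x0 - (INF y\<in>Rn n. \<phi> y)"
  using cINF_lower[OF objective_bdd_below x0] by simp

text \<open>
  The scale of the bounds vanishes only in the trivial case: away from stationary points a gradient step
  decreases the objective.
\<close>

lemma objective_gap_pos:
  assumes "G x0 \<noteq> 0" shows "0 < \<phi> x0 - (INF y\<in>Rn n. \<phi> y)"
proof -
  have d: "- G x0 \<in> Rn n" using x0 by (intro Rn_closed G_Rn)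
  have "((\<lambda>t. \<phi> (x0 + t *\<^sub>R (- G x0))) has_real_derivative G (x0 + 0 *\<^sub>R (- G x0)) \<bullet> (- G x0)) (at 0)"
    by (rule phi_along_line[OF x0 d])
  moreover have "G (x0 + 0 *\<^sub>R (- G x0)) \<bullet> (- G x0) < 0" using assms by simp
  ultimately obtain e where e: "e > 0"
    "\<forall>h>0. h < e \<longrightarrow> \<phi> (x0 + (0 + h) *\<^sub>R (- G x0)) < \<phi> (x0 + 0 *\<^sub>R (- G x0))"
    using DERIV_neg_dec_right[of "\<lambda>t. \<phi> (x0 + t *\<^sub>R (- G x0))"] by blast
  define h where "h = e / 2"
  have "\<phi> (x0 + h *\<^sub>R (- G x0)) < \<phi> x0" using e(1) e(2)[rule_format, of h] by (simp add: h_def)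
  moreover have "(INF y\<in>Rn n. \<phi> y) \<le> \<phi> (x0 + h *\<^sub>R (- G x0))"
    using line_Rn[OF x0 d] by (rule cINF_lower[OF objective_bdd_below])
  ultimately show ?thesis by simp
qed

end

section \<open>Complexity and convergence\<close>

context smooth_problem
begin

lemma gradient_sup: "y \<in> S \<Longrightarrow> norm (G y) \<le> (SUP y\<in>S. norm (G y))"
proof -
  assume y: "y \<in> S"
  have "compact ((\<lambda>y. norm (G y)) ` S)"
    using compact_level S_Rn
    by (intro compact_continuous_image continuous_on_norm continuous_on_subset[OF continuous_G]) auto
  then have "bdd_above ((\<lambda>y. norm (G y)) ` S)"
    by (intro bounded_imp_bdd_above compact_imp_bounded)
  with y show ?thesis by (rule cSUP_upper)
qed

end

text \<open>
  Both choices satisfy \<open>0 < \<omega>t k \<le> \<omega>f k \<le> sqrt (norm (G (x k)))\<close>, which is all that the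
  analysis of single steps uses.
\<close>

lemma arncg_sequence_choice:
  assumes "arncg_problem n \<phi> G H x0 L N P" and \<theta>: "\<theta> \<ge> 0"
    and run: "arncg_run P \<phi> G H \<omega>t \<omega>f x0 x M tr fb"
    and choice: "reg_choice1 \<theta> (\<lambda>k. norm (G (x k))) \<omega>t \<omega>f \<or> reg_choice2 \<theta> (\<lambda>k. norm (G (x k))) \<omega>t \<omega>f"
  shows "arncg_sequence n \<phi> G H x0 L N P \<omega>t \<omega>f x M tr fb"
proof -
  interpret arncg_problem n \<phi> G H x0 L N P by (rule assms(1))
  let ?g = "\<lambda>k. norm (G (x k))"
  show ?thesis
  proof (unfold_locales, rule run)
    fix k assume "G (x k) \<noteq> 0"
    then have pos: "0 < ?g j" if "j \<le> k" for j using arncg_run_nonzero_before[OF run _ that] by simp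
    have gk: "0 < ?g k" "0 < ?g (k - 1)" using pos[of k] pos[of "k - 1"] by auto
    from choice show "0 < \<omega>t k \<and> \<omega>t k \<le> \<omega>f k \<and> \<omega>f k \<le> sqrt (norm (G (x k)))"
    proof
      assume c: "reg_choice1 \<theta> ?g \<omega>t \<omega>f"
      define \<delta> where "\<delta> = min 1 (?g k * inverse (?g (k - 1)))"
      have d: "0 < \<delta>" "\<delta> \<le> 1" using gk by (auto simp: \<delta>_def)
      have "\<delta> powr \<theta> \<le> 1" "0 < \<delta> powr \<theta>" using d \<theta> by (auto intro: powr_le1)
      moreover have "\<omega>f k = sqrt (?g k)" "\<omega>t k = \<omega>f k * \<delta> powr \<theta>" using c by (auto simp: reg_choice1_def \<delta>_def)
      ultimately show ?thesis using gk by (simp add: mult_left_le)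
    next
      assume c: "reg_choice2 \<theta> ?g \<omega>t \<omega>f"
      define e where "e = eps_seq ?g"
      have e: "0 < e j" if "j \<le> k" for j
      proof -
        obtain i where "i \<le> j" "eps_seq ?g j = ?g i" using eps_seq_attained by blast
        then show ?thesis using pos[of i] that by (simp add: e_def)
      qed
      define \<delta> where "\<delta> = e k * inverse (e (k - 1))"
      have ek: "0 < e k" "0 < e (k - 1)" "e k \<le> e (k - 1)" "e k \<le> ?g k"
        using e[of k] e[of "k - 1"] eps_seq_antimono[of ?g k] eps_seq_le[of k k ?g] by (auto simp: e_def)
      then have d: "0 < \<delta>" "\<delta> \<le> 1" by (auto simp: \<delta>_def field_simps)
      have "\<delta> powr \<theta> \<le> 1" "0 < \<delta> powr \<theta>" using d \<theta> by (auto intro: powr_le1)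
      moreover have "\<omega>f k = sqrt (e k)" "\<omega>t k = \<omega>f k * \<delta> powr \<theta>" using c by (auto simp: reg_choice2_def \<delta>_def e_def)
      ultimately show ?thesis using ek by (simp add: mult_left_le)
    qed
  qed
qed

context arncg_sequence
begin

abbreviation V where "V \<equiv> (SUP y\<in>S. norm (G y))"
abbreviation \<Delta> where "\<Delta> \<equiv> \<phi> x0 - (INF y\<in>Rn n. \<phi> y)"

text \<open>
  For \<open>V = 0\<close> the logarithms are \<open>ln 0 = 0\<close>.
\<close>

lemma logs_nonneg: "\<forall>\<^sub>F \<epsilon> in at_right 0. 0 \<le> ln (V / \<epsilon>) \<and> 0 \<le> ln (ln (V / \<epsilon>))"
proof -
  have "0 \<le> V" using gradient_sup[OF x0_S] norm_ge_zero order_trans by blast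
  then consider "V = 0" | "V > 0" by linarith
  then show ?thesis
  proof cases
    case 2
    have "\<forall>\<^sub>F \<epsilon> in at_right 0. 0 \<le> ln (V / \<epsilon>)" "\<forall>\<^sub>F \<epsilon> in at_right 0. 0 \<le> ln (ln (V / \<epsilon>))"
      using log_at_top[OF 2] log_log_at_top[OF 2] unfolding filterlim_at_top by blast+
    then show ?thesis by eventually_elim simp
  qed simp
qed

theorem complexity_choice1:
  assumes c: "reg_choice1 \<theta> g \<omega>t \<omega>f" and \<theta>: "\<theta> \<ge> 0"
  shows "\<forall>\<^sub>F \<epsilon> in at_right 0. \<exists>k. g k \<le> \<epsilon> \<and>
    real k \<le> \<Delta> * L powr (1/2) * \<epsilon> powr (-3/2) * ln (ln (V / \<epsilon>)) + \<bar>ln L\<bar> * ln (V / \<epsilon>)"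
proof (cases "G x0 = 0")
  case True
  have D: "0 \<le> \<Delta> * L powr (1/2)" using objective_gap_nonneg by simp
  show ?thesis using logs_nonneg eventually_at_right_less[of "0::real"]
  proof eventually_elim
    case (elim \<epsilon>)
    have "0 \<le> \<Delta> * L powr (1/2) * \<epsilon> powr (-3/2) * ln (ln (V / \<epsilon>)) + \<bar>ln L\<bar> * ln (V / \<epsilon>)"
      using D elim objective_gap_nonneg by (intro add_nonneg_nonneg mult_nonneg_nonneg) auto
    then show ?case using True elim start by (intro exI[of _ 0]) (simp add: g_def)
  qed
next
  case False
  have D: "0 < \<Delta> * L powr (1/2)" using objective_gap_pos[OF False] L_pos by simp
  have "0 < norm (G x0)" using False by simp
  then have V: "0 < V" using gradient_sup[OF x0_S] by linarith
  have gV: "g k \<le> V" for k using gradient_sup[OF iterate_level] by (simp add: g_def)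
  show ?thesis using bound_choice1[OF c \<theta> D V gV] logs_nonneg
  proof eventually_elim
    case (elim \<epsilon>)
    have "0 \<le> \<bar>ln L\<bar> * ln (V / \<epsilon>)" using elim by simp
    then show ?case using elim by (meson add_increasing2 order_trans order_refl)
  qed
qed

theorem complexity_choice2:
  assumes c: "reg_choice2 \<theta> g \<omega>t \<omega>f" and \<theta>: "\<theta> \<ge> 0"
  shows "\<forall>\<^sub>F \<epsilon> in at_right 0. \<exists>k. g k \<le> \<epsilon> \<and>
    real k \<le> \<Delta> * L powr (1/2) * \<epsilon> powr (-3/2) + \<bar>ln L\<bar> + ln (V / \<epsilon>)"
proof (cases "G x0 = 0")
  case True
  have D: "0 \<le> \<Delta> * L powr (1/2)" using objective_gap_nonneg by simp
  show ?thesis using logs_nonneg eventually_at_right_less[of "0::real"]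
  proof eventually_elim
    case (elim \<epsilon>)
    have "0 \<le> \<Delta> * L powr (1/2) * \<epsilon> powr (-3/2) + \<bar>ln L\<bar> + ln (V / \<epsilon>)"
      using D elim objective_gap_nonneg by (intro add_nonneg_nonneg mult_nonneg_nonneg) auto
    then show ?case using True elim start by (intro exI[of _ 0]) (simp add: g_def)
  qed
next
  case False
  have D: "0 < \<Delta> * L powr (1/2)" using objective_gap_pos[OF False] L_pos by simp
  have "0 < norm (G x0)" using False by simp
  then have V: "0 < V" using gradient_sup[OF x0_S] by linarith
  have gV: "g k \<le> V" for k using gradient_sup[OF iterate_level] by (simp add: g_def)
  show ?thesis using bound_choice2[OF c \<theta> D V gV] logs_nonneg
  proof eventually_elim
    case (elim \<epsilon>)
    have "0 \<le> \<bar>ln L\<bar> + ln (V / \<epsilon>)" using elim by simp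
    then show ?case using elim by (auto simp: add.assoc intro: order_trans)
  qed
qed

lemma arbitrarily_small_gradients:
  assumes choice: "reg_choice1 \<theta> g \<omega>t \<omega>f \<or> reg_choice2 \<theta> g \<omega>t \<omega>f" and \<theta>: "\<theta> \<ge> 0" and "\<epsilon> > 0"
  shows "\<exists>k. g k \<le> \<epsilon>"
proof -
  have "\<forall>\<^sub>F \<epsilon> in at_right 0. \<exists>k. g k \<le> \<epsilon>"
    using choice
  proof
    assume "reg_choice1 \<theta> g \<omega>t \<omega>f"
    from complexity_choice1[OF this \<theta>] show ?thesis by eventually_elim blast
  next
    assume "reg_choice2 \<theta> g \<omega>t \<omega>f"
    from complexity_choice2[OF this \<theta>] show ?thesis by eventually_elim blast
  qed
  then obtain b where b: "b > 0" "\<And>y. 0 < y \<Longrightarrow> y < b \<Longrightarrow> \<exists>k. g k \<le> y"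
    by (auto simp: eventually_at_right_field)
  have "0 < min \<epsilon> (b / 2)" "min \<epsilon> (b / 2) < b" using b(1) \<open>\<epsilon> > 0\<close> by auto
  then obtain k where "g k \<le> min \<epsilon> (b / 2)" using b(2) by blast
  then show ?thesis by auto
qed

end

theorem theorem2p2:
  fixes P :: arncg_params and \<theta> :: real
  assumes "valid_params P" and "\<theta> \<ge> 0"
  shows "\<exists>c>0. \<forall>(n::nat) \<phi> G H x0 (L_H::real) N \<omega>t \<omega>f x M tr fb.
    C2_on_Rn n \<phi> G H \<and> x0 \<in> Rn n \<and>
    compact (level_set n \<phi> x0) \<and>
    openin (top_of_set (Rn n)) N \<and> level_set n \<phi> x0 \<subseteq> N \<and>
    L_H > 0 \<and> L_H-lipschitz_on N H \<and>
    arncg_run P \<phi> G H \<omega>t \<omega>f x0 x M tr fb \<and>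
    arncg_trials P \<phi> G H \<omega>t \<omega>f x M tr fb \<subseteq> N
    \<longrightarrow>
    (let g = (\<lambda>k. norm (G (x k)));
         \<Delta> = \<phi> x0 - (INF y\<in>Rn n. \<phi> y);
         U = (SUP y\<in>level_set n \<phi> x0. norm (G y))
     in
       (reg_choice1 \<theta> g \<omega>t \<omega>f \<longrightarrow>
          (\<forall>\<^sub>F \<epsilon> in at_right 0. \<exists>k. g k \<le> \<epsilon> \<and>
             real k \<le> c * (\<Delta> * L_H powr (1/2) * \<epsilon> powr (-3/2) * ln (ln (U / \<epsilon>))
                          + \<bar>ln L_H\<bar> * ln (U / \<epsilon>))))
       \<and>
       (reg_choice2 \<theta> g \<omega>t \<omega>f \<longrightarrow>
          (\<forall>\<^sub>F \<epsilon> in at_right 0. \<exists>k. g k \<le> \<epsilon> \<and>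
             real k \<le> c * (\<Delta> * L_H powr (1/2) * \<epsilon> powr (-3/2)
                          + \<bar>ln L_H\<bar> + ln (U / \<epsilon>))))
       \<and>
       (reg_choice1 \<theta> g \<omega>t \<omega>f \<or> reg_choice2 \<theta> g \<omega>t \<omega>f \<longrightarrow>
          (\<exists>s xs. strict_mono s \<and> (x \<circ> s) \<longlonglongrightarrow> xs \<and> xs \<in> Rn n \<and> G xs = 0) \<and>
          (\<forall>s xs. strict_mono s \<and> (x \<circ> s) \<longlonglongrightarrow> xs \<and> xs \<in> Rn n \<and> G xs = 0 \<and>
                  \<theta> > 1 \<and> (\<forall>v\<in>Rn n - {0}. v \<bullet> blinfun_apply (H xs) v > 0)
             \<longrightarrow> x \<longlonglongrightarrow> xs \<and>
                 (\<exists>r>0. \<forall>y\<in>Rn n. dist y xs < r \<longrightarrow> \<phi> xs \<le> \<phi> y) \<and>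
                 (\<exists>C. \<forall>\<^sub>F k in sequentially. g (Suc k) \<le> C * (g k)\<^sup>2))))"
proof (intro exI[of _ 1] conjI zero_less_one allI impI, goal_cases)
  case (1 n \<phi> G H x0 L_H N \<omega>t \<omega>f x M tr fb)
  then have problem: "arncg_problem n \<phi> G H x0 L_H N P" and run: "arncg_run P \<phi> G H \<omega>t \<omega>f x0 x M tr fb"
    using assms(1) by (simp_all add: arncg_problem_def smooth_problem_def arncg_problem_axioms_def)
  define g where "g = (\<lambda>k. norm (G (x k)))"
  define D where "D = \<phi> x0 - (INF y\<in>Rn n. \<phi> y)"
  define V where "V = (SUP y\<in>level_set n \<phi> x0. norm (G y))"
  have seq: "arncg_sequence n \<phi> G H x0 L_H N P \<omega>t \<omega>f x M tr fb"
    and g: "arncg_sequence.g G x = g"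
    if "reg_choice1 \<theta> g \<omega>t \<omega>f \<or> reg_choice2 \<theta> g \<omega>t \<omega>f"
  proof -
    show seq: "arncg_sequence n \<phi> G H x0 L_H N P \<omega>t \<omega>f x M tr fb"
      by (rule arncg_sequence_choice[OF problem assms(2) run that[unfolded g_def]])
    show "arncg_sequence.g G x = g" by (rule ext) (simp add: arncg_sequence.g_def[OF seq] g_def)
  qed
  have c1: "\<forall>\<^sub>F \<epsilon> in at_right 0. \<exists>k. g k \<le> \<epsilon> \<and>
      real k \<le> 1 * (D * L_H powr (1/2) * \<epsilon> powr (-3/2) * ln (ln (V / \<epsilon>)) + \<bar>ln L_H\<bar> * ln (V / \<epsilon>))"
    if c: "reg_choice1 \<theta> g \<omega>t \<omega>f"
    unfolding D_def V_def mult_1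
    by (rule arncg_sequence.complexity_choice1[OF seq, unfolded g[OF disjI1[OF c]], OF disjI1[OF c] c assms(2)])
  have c2: "\<forall>\<^sub>F \<epsilon> in at_right 0. \<exists>k. g k \<le> \<epsilon> \<and>
      real k \<le> 1 * (D * L_H powr (1/2) * \<epsilon> powr (-3/2) + \<bar>ln L_H\<bar> + ln (V / \<epsilon>))"
    if c: "reg_choice2 \<theta> g \<omega>t \<omega>f"
    unfolding D_def V_def mult_1
    by (rule arncg_sequence.complexity_choice2[OF seq, unfolded g[OF disjI2[OF c]], OF disjI2[OF c] c assms(2)])
  have c3: "\<exists>s xs. strict_mono s \<and> (x \<circ> s) \<longlonglongrightarrow> xs \<and> xs \<in> Rn n \<and> G xs = 0"
    if c: "reg_choice1 \<theta> g \<omega>t \<omega>f \<or> reg_choice2 \<theta> g \<omega>t \<omega>f"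
  proof -
    interpret s: arncg_sequence n \<phi> G H x0 L_H N P \<omega>t \<omega>f x M tr fb by (rule seq[OF c])
    show ?thesis
      by (rule s.stationary_limit_point) (rule s.arbitrarily_small_gradients[unfolded g[OF c], OF c assms(2), folded g[OF c]])
  qed
  have c4: "x \<longlonglongrightarrow> xs \<and> (\<exists>r>0. \<forall>y\<in>Rn n. dist y xs < r \<longrightarrow> \<phi> xs \<le> \<phi> y) \<and>
      (\<exists>C. \<forall>\<^sub>F k in sequentially. g (Suc k) \<le> C * (g k)\<^sup>2)"
    if c: "reg_choice1 \<theta> g \<omega>t \<omega>f \<or> reg_choice2 \<theta> g \<omega>t \<omega>f"
      and lim: "strict_mono s \<and> (x \<circ> s) \<longlonglongrightarrow> xs \<and> xs \<in> Rn n \<and> G xs = 0 \<and>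
        \<theta> > 1 \<and> (\<forall>v\<in>Rn n - {0}. v \<bullet> blinfun_apply (H xs) v > 0)" for s xs
  proof -
    interpret s: arncg_sequence n \<phi> G H x0 L_H N P \<omega>t \<omega>f x M tr fb by (rule seq[OF c])
    from lim have l: "strict_mono s" "(x \<circ> s) \<longlonglongrightarrow> xs" and xs: "xs \<in> Rn n" "G xs = 0"
      and \<theta>: "\<theta> > 1" and pd: "\<forall>v\<in>Rn n - {0}. v \<bullet> blinfun_apply (H xs) v > 0" by simp_all
    obtain m rad where m: "m > 0" and rad: "rad > 0"
      and "\<forall>y\<in>Rn n. dist y xs < rad \<longrightarrow> (\<forall>v\<in>Rn n. m * (norm v)\<^sup>2 \<le> v \<bullet> blinfun_apply (H y) v)"
      using s.uniformly_convex_near[OF xs(1) pd] by auto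
    then have near: "m * (norm v)\<^sup>2 \<le> v \<bullet> blinfun_apply (H y) v"
      if "y \<in> Rn n" "dist y xs < rad" "v \<in> Rn n" for y v
      using that by simp
    have c': "reg_choice1 \<theta> s.g \<omega>t \<omega>f \<or> reg_choice2 \<theta> s.g \<omega>t \<omega>f" unfolding g[OF c] by (rule c)
    have "x \<longlonglongrightarrow> xs" "\<exists>C. \<forall>\<^sub>F k in sequentially. s.g (Suc k) \<le> C * (s.g k)\<^sup>2"
      by (rule s.local_convergence[where s = s and m = m and rad = rad and \<theta> = \<theta> and xs = xs];
          fact l xs m rad near c' \<theta>)+
    moreover have "\<phi> xs \<le> \<phi> y" if "y \<in> Rn n" "dist y xs < rad" for y
      by (rule s.strict_second_order_minimum[where m = m and rad = rad]; fact xs m near that)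
    ultimately show ?thesis using rad unfolding g[OF c] by blast
  qed
  show ?case
    unfolding Let_def
    by (intro conjI impI allI; rule c1[unfolded g_def D_def V_def] c2[unfolded g_def D_def V_def]
        c3[unfolded g_def] c4[unfolded g_def, THEN conjunct1] c4[unfolded g_def, THEN conjunct2, THEN conjunct1]
        c4[unfolded g_def, THEN conjunct2, THEN conjunct2]; assumption)
qed

end
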